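(* Let $(\mathcal{C},\mathbb{E},\mathfrak{s})$ be a small $R$-linear extriangulated category with enough projective morphisms. Then $(\mathbb{E}_{\mathrm{I}}^\bullet,\delta_\sharp)$ is universal among covariant connected sequences of functors having $F^n=\mathbb{E}^n$ with the canonical connecting morphisms for $n\ge0$; that is, for every such covariant connected sequence $(F^\bullet,\delta_\sharp)$ there is a unique sequence of natural transformations $\{\varphi^n\colon F^n\to\mathbb{E}_{\mathrm{I}}^n\}_{n\in\mathbb{Z}}$ such that $\varphi^n=\mathrm{id}$ for all $n\ge0$ and $\varphi^{n+1}_{-,A}\circ\delta_\sharp=\delta_\sharp\circ\varphi^n_{-,C}$ as morphisms $F^n(-,C)\to\mathbb{E}_{\mathrm{I}}^{n+1}(-,A)$ in $\mathrm{Mod}\,\mathcal{C}$ for all $n\in\mathbb{Z}$ and all $\delta\in\mathbb{E}(C,A)$.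
   Context: $R$ is a commutative ring with $1$; $\mathcal{C}$ is an additive $R$-linear category. Extriangulated categories: let $\mathbb{E}\colon\mathcal{C}^{\mathrm{op}}\times\mathcal{C}\to\mathrm{Mod}\,R$ be an $R$-bilinear functor. An element $\delta\in\mathbb{E}(C,A)$ is called an extension; for $a\colon A\to A'$ and $c\colon C'\to C$ put $a_*\delta=\mathbb{E}(C,a)(\delta)$ and $c^*\delta=\mathbb{E}(c,A)(\delta)$. A morphism of extensions from $\delta\in\mathbb{E}(C,A)$ to $\delta'\in\mathbb{E}(C',A')$ is a pair $(a\colon A\to A',\,c\colon C\to C')$ with $a_*\delta=c^*\delta'$. The extension $\delta\oplus\delta'\in\mathbb{E}(C\oplus C',A\oplus A')$ is the one with diagonal components $\delta,\delta'$ and zero off-diagonal components. Sequences $A\xrightarrow{x}B\xrightarrow{y}C$ and $A\xrightarrow{x'}B'\xrightarrow{y'}C$ are equivalent if there is an isomorphism $b\colon B\to B'$ with $bx=x'$, $y'b=y$; the class is written $[A\xrightarrow{x}B\xrightarrow{y}C]$. An additive realization $\mathfrak{s}$ assigns to each $\delta\in\mathbb{E}(C,A)$ such a class $\mathfrak{s}(\delta)=[A\xrightarrow{x}B\xrightarrow{y}C]$ so that: for each morphism $(a,c)\colon\delta\to\delta'$ with $\mathfrak{s}(\delta')=[A'\xrightarrow{x'}B'\xrightarrow{y'}C']$ there is $b\colon B\to B'$ with $bx=x'a$, $y'b=cy$; $\mathfrak{s}(0)=[A\to A\oplus C\to C]$ (canonical maps); and $\mathfrak{s}(\delta\oplus\delta')=\mathfrak{s}(\delta)\oplus\mathfrak{s}(\delta')$.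 The triple $(\mathcal{C},\mathbb{E},\mathfrak{s})$ is an ($R$-linear) extriangulated category if moreover: (ET3) if $\mathfrak{s}(\delta)=[A\xrightarrow{x}B\xrightarrow{y}C]$, $\mathfrak{s}(\delta')=[A'\xrightarrow{x'}B'\xrightarrow{y'}C']$ and $bx=x'a$, then there is $c$ with $cy=y'b$ and $a_*\delta=c^*\delta'$; (ET3)$^{\mathrm{op}}$ the dual; (ET4) if $\delta\in\mathbb{E}(D,A)$ and $\delta'\in\mathbb{E}(F,B)$ are realized by $A\xrightarrow{f}B\xrightarrow{f'}D$ and $B\xrightarrow{g}C\xrightarrow{g'}F$, then there are an object $E$, morphisms $d\colon D\to E$, $e\colon E\to F$, $h=gf$, $h'\colon C\to E$ with $h'g=df'$, $eh'=g'$, and $\delta''\in\mathbb{E}(E,A)$ realized by $A\xrightarrow{h}C\xrightarrow{h'}E$, such that $D\xrightarrow{d}E\xrightarrow{e}F$ realizes $f'_*\delta'$, $d^*\delta''=\delta$ and $f_*\delta''=e^*\delta'$; (ET4)$^{\mathrm{op}}$ the dual. If $\mathfrak{s}(\delta)=[A\xrightarrow{x}B\xrightarrow{y}C]$ one writes $A\xrightarrow{x}B\xrightarrow{y}C\overset{\delta}{\dashrightarrow}$ and calls it an $\mathfrak{s}$-triangle; $x$ is an inflation, $y$ a deflation, $A\to B\to C$ a conflation. A morphism $f$ is projective if $\mathbb{E}(f,-)=0$. There are enough projective morphisms if every object $C$ admits a deflation $G\to C$ which is a projective morphism. $\mathrm{Mod}\,\mathcal{C}$ (resp. $\mathcal{C}\,\mathrm{Mod}$)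 is the category of $R$-linear functors $\mathcal{C}^{\mathrm{op}}\to\mathrm{Mod}\,R$ (resp. $\mathcal{C}\to\mathrm{Mod}\,R$). For $\mathcal{C}$ small, positive extensions are defined by $\mathbb{E}^0=\mathcal{C}(-,-)$, $\mathbb{E}^1=\mathbb{E}$ and inductively by the coend $\mathbb{E}^n(X,Y)=\int^{M\in\mathcal{C}}\mathbb{E}^{n-1}(M,Y)\otimes_R\mathbb{E}(X,M)$; there are natural isomorphisms $\mathbb{E}^{s+t}(X,Y)\cong\int^{M}\mathbb{E}^s(M,Y)\otimes_R\mathbb{E}^t(X,M)$. Write $\rho\cup\lambda\in\mathbb{E}^{s+t}(X,Y)$ for the class of $\rho\otimes\lambda$, $\rho\in\mathbb{E}^s(M,Y)$, $\lambda\in\mathbb{E}^t(X,M)$. For $\delta\in\mathbb{E}(C,A)$ and $n\ge0$, $\delta_\sharp\colon\mathbb{E}^n(-,C)\to\mathbb{E}^{n+1}(-,A)$ is $\lambda\mapsto\delta\cup\lambda$ and $\delta^\sharp\colon\mathbb{E}^n(A,-)\to\mathbb{E}^{n+1}(C,-)$ is $\lambda\mapsto\lambda\cup\delta$; for $n=0$ these are $f\mapsto f^*\delta$ and $f\mapsto f_*\delta$. Negative extensions: for $n\ge0$ put $\mathbb{E}_{\mathrm{I}}^{-n}(C,A)=(\mathcal{C}\,\mathrm{Mod})(\mathbb{E}^n(A,-),\mathcal{C}(C,-))$, an $R$-bilinear functor of $(C,A)$ ($\mathbb{E}_{\mathrm{I}}^0=\mathcal{C}(-,-)$ by Yoneda),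 and $\mathbb{E}_{\mathrm{I}}^{n}=\mathbb{E}^n$ for $n>0$. For $\delta\in\mathbb{E}(C,A)$ and $n\ge0$, $\delta_\sharp\colon\mathbb{E}_{\mathrm{I}}^{-(n+1)}(-,C)\to\mathbb{E}_{\mathrm{I}}^{-n}(-,A)$ is precomposition with $\delta^\sharp\colon\mathbb{E}^n(A,-)\to\mathbb{E}^{n+1}(C,-)$; in non-negative degrees $\delta_\sharp$ is the map $\delta_\sharp$ of $\mathbb{E}^n$. A covariant connected sequence of functors $(F^\bullet,\delta_\sharp)$ is a sequence of $R$-bilinear functors $F^n\colon\mathcal{C}^{\mathrm{op}}\times\mathcal{C}\to\mathrm{Mod}\,R$ ($n\in\mathbb{Z}$) with morphisms $\delta_\sharp\colon F^n(-,C)\to F^{n+1}(-,A)$ in $\mathrm{Mod}\,\mathcal{C}$ for all $\delta\in\mathbb{E}(C,A)$ and $n\in\mathbb{Z}$, natural with respect to morphisms of extensions (for $(a,c)\colon\delta\to\delta'$: $F^{n+1}(-,a)\circ\delta_\sharp=\delta'_\sharp\circ F^n(-,c)$). It has $F^n=\mathbb{E}^n$ with the canonical connecting morphisms for $n\ge0$ if $F^n=\mathbb{E}^n$ for $n\ge0$ and, for these $n$, $\delta_\sharp$ is the map $\delta_\sharp\colon\mathbb{E}^n(-,C)\to\mathbb{E}^{n+1}(-,A)$ above. *)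

theory Defs
  imports "HOL-Algebra.Module"
begin

section \<open>Linear and additive categories\<close>

text \<open>
  Since the objects form a set of some type and the arrows are elements of a type, every category
  of the following kind is small.  The composition \<open>g \<cdot> f\<close> is ``\<open>g\<close> after \<open>f\<close>''.
\<close>

record ('r, 'o, 'm) lincat =
  Ob :: "'o set"
  Hom :: "'o \<Rightarrow> 'o \<Rightarrow> ('r, 'm) module"
  Dom :: "'m \<Rightarrow> 'o"
  Cod :: "'m \<Rightarrow> 'o"
  Idn :: "'o \<Rightarrow> 'm"
  cmp :: "'m \<Rightarrow> 'm \<Rightarrow> 'm"  (infixr \<open>\<cdot>\<index>\<close> 75)

definition arr :: "('r, 'o, 'm) lincat \<Rightarrow> 'o \<Rightarrow> 'o \<Rightarrow> 'm set" where
  "arr \<C> X Y = {f. X \<in> Ob \<C> \<and> Y \<in> Ob \<C> \<and> f \<in> carrier (Hom \<C> X Y)}"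

definition linear_map ::
    "'r ring \<Rightarrow> ('r, 'v) module \<Rightarrow> ('r, 'w) module \<Rightarrow> ('v \<Rightarrow> 'w) \<Rightarrow> bool" where
  "linear_map R M N f \<longleftrightarrow>
     f \<in> carrier M \<rightarrow> carrier N \<and>
     (\<forall>u\<in>carrier M. \<forall>v\<in>carrier M. f (u \<oplus>\<^bsub>M\<^esub> v) = f u \<oplus>\<^bsub>N\<^esub> f v) \<and>
     (\<forall>r\<in>carrier R. \<forall>u\<in>carrier M. f (r \<odot>\<^bsub>M\<^esub> u) = r \<odot>\<^bsub>N\<^esub> f u)"

locale linear_category =
  fixes R :: "'r ring" and \<C> :: "('r, 'o, 'm) lincat" (structure)
  assumes R_cring: "cring R"
    and Hom_module: "\<lbrakk>X \<in> Ob \<C>; Y \<in> Ob \<C>\<rbrakk> \<Longrightarrow> module R (Hom \<C> X Y)"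
    and Dom_arr: "f \<in> arr \<C> X Y \<Longrightarrow> Dom \<C> f = X"
    and Cod_arr: "f \<in> arr \<C> X Y \<Longrightarrow> Cod \<C> f = Y"
    and Idn_arr: "X \<in> Ob \<C> \<Longrightarrow> Idn \<C> X \<in> arr \<C> X X"
    and cmp_arr: "\<lbrakk>f \<in> arr \<C> X Y; g \<in> arr \<C> Y Z\<rbrakk> \<Longrightarrow> g \<cdot> f \<in> arr \<C> X Z"
    and cmp_assoc: "\<lbrakk>f \<in> arr \<C> W X; g \<in> arr \<C> X Y; h \<in> arr \<C> Y Z\<rbrakk>
          \<Longrightarrow> (h \<cdot> g) \<cdot> f = h \<cdot> (g \<cdot> f)"
    and cmp_Idn_right: "f \<in> arr \<C> X Y \<Longrightarrow> f \<cdot> Idn \<C> X = f"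
    and cmp_Idn_left: "f \<in> arr \<C> X Y \<Longrightarrow> Idn \<C> Y \<cdot> f = f"
    and cmp_linear_right: "\<lbrakk>g \<in> arr \<C> Y Z; X \<in> Ob \<C>\<rbrakk>
          \<Longrightarrow> linear_map R (Hom \<C> X Y) (Hom \<C> X Z) (\<lambda>f. g \<cdot> f)"
    and cmp_linear_left: "\<lbrakk>f \<in> arr \<C> X Y; Z \<in> Ob \<C>\<rbrakk>
          \<Longrightarrow> linear_map R (Hom \<C> Y Z) (Hom \<C> X Z) (\<lambda>g. g \<cdot> f)"

definition iso_arr :: "('r, 'o, 'm) lincat \<Rightarrow> 'o \<Rightarrow> 'o \<Rightarrow> 'm \<Rightarrow> bool" where
  "iso_arr \<C> X Y f \<longleftrightarrow>
     f \<in> arr \<C> X Y \<and>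
     (\<exists>g\<in>arr \<C> Y X. g \<cdot>\<^bsub>\<C>\<^esub> f = Idn \<C> X \<and> f \<cdot>\<^bsub>\<C>\<^esub> g = Idn \<C> Y)"

definition zero_object :: "('r, 'o, 'm) lincat \<Rightarrow> 'o \<Rightarrow> bool" where
  "zero_object \<C> Z \<longleftrightarrow>
     Z \<in> Ob \<C> \<and> (\<forall>X\<in>Ob \<C>. (\<exists>!f. f \<in> arr \<C> X Z) \<and> (\<exists>!f. f \<in> arr \<C> Z X))"

text \<open>\<open>biproduct \<C> A B S i j p q\<close>: \<open>S = A \<oplus> B\<close> with inclusions \<open>i, j\<close> and projections \<open>p, q\<close>.\<close>

definition biproduct ::
    "('r, 'o, 'm) lincat \<Rightarrow> 'o \<Rightarrow> 'o \<Rightarrow> 'o \<Rightarrow> 'm \<Rightarrow> 'm \<Rightarrow> 'm \<Rightarrow> 'm \<Rightarrow> bool" where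
  "biproduct \<C> A B S i j p q \<longleftrightarrow>
     i \<in> arr \<C> A S \<and> j \<in> arr \<C> B S \<and> p \<in> arr \<C> S A \<and> q \<in> arr \<C> S B \<and>
     p \<cdot>\<^bsub>\<C>\<^esub> i = Idn \<C> A \<and> q \<cdot>\<^bsub>\<C>\<^esub> j = Idn \<C> B \<and>
     p \<cdot>\<^bsub>\<C>\<^esub> j = \<zero>\<^bsub>Hom \<C> B A\<^esub> \<and> q \<cdot>\<^bsub>\<C>\<^esub> i = \<zero>\<^bsub>Hom \<C> A B\<^esub> \<and>
     (i \<cdot>\<^bsub>\<C>\<^esub> p) \<oplus>\<^bsub>Hom \<C> S S\<^esub> (j \<cdot>\<^bsub>\<C>\<^esub> q) = Idn \<C> S"

locale additive_category = linear_category +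
  assumes has_zero_object: "\<exists>Z. zero_object \<C> Z"
    and has_biproducts: "\<lbrakk>A \<in> Ob \<C>; B \<in> Ob \<C>\<rbrakk> \<Longrightarrow> \<exists>S i j p q. biproduct \<C> A B S i j p q"


section \<open>Bilinear functors to modules\<close>

text \<open>
  A functor \<open>F\<close> from \<open>\<C>\<^sup>o\<^sup>p \<times> \<C>\<close> to \<open>R\<close>-modules: \<open>val F X Y\<close> is the module \<open>F(X, Y)\<close>,
  \<open>pull F f Y\<close> is \<open>F(f, Y)\<close> and \<open>push F X g\<close> is \<open>F(X, g)\<close>.
\<close>

record ('r, 'o, 'm, 'v) bifun =
  val :: "'o \<Rightarrow> 'o \<Rightarrow> ('r, 'v) module"
  pull :: "'m \<Rightarrow> 'o \<Rightarrow> 'v \<Rightarrow> 'v"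
  push :: "'o \<Rightarrow> 'm \<Rightarrow> 'v \<Rightarrow> 'v"

definition elt ::
    "('r, 'o, 'm) lincat \<Rightarrow> ('r, 'o, 'm, 'v) bifun \<Rightarrow> 'o \<Rightarrow> 'o \<Rightarrow> 'v set" where
  "elt \<C> F X Y = {v. X \<in> Ob \<C> \<and> Y \<in> Ob \<C> \<and> v \<in> carrier (val F X Y)}"

locale bilinear_functor = linear_category +
  fixes F :: "('r, 'o, 'm, 'v) bifun"
  assumes val_module: "\<lbrakk>X \<in> Ob \<C>; Y \<in> Ob \<C>\<rbrakk> \<Longrightarrow> module R (val F X Y)"
    and pull_linear: "\<lbrakk>f \<in> arr \<C> X' X; Y \<in> Ob \<C>\<rbrakk>
          \<Longrightarrow> linear_map R (val F X Y) (val F X' Y) (pull F f Y)"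
    and push_linear: "\<lbrakk>g \<in> arr \<C> Y Y'; X \<in> Ob \<C>\<rbrakk>
          \<Longrightarrow> linear_map R (val F X Y) (val F X Y') (push F X g)"
    and pull_Idn: "v \<in> elt \<C> F X Y \<Longrightarrow> pull F (Idn \<C> X) Y v = v"
    and push_Idn: "v \<in> elt \<C> F X Y \<Longrightarrow> push F X (Idn \<C> Y) v = v"
    and pull_cmp: "\<lbrakk>f \<in> arr \<C> X' X; f' \<in> arr \<C> X'' X'; v \<in> elt \<C> F X Y\<rbrakk>
          \<Longrightarrow> pull F (f \<cdot> f') Y v = pull F f' Y (pull F f Y v)"
    and push_cmp: "\<lbrakk>g \<in> arr \<C> Y Y'; g' \<in> arr \<C> Y' Y''; v \<in> elt \<C> F X Y\<rbrakk>
          \<Longrightarrow> push F X (g' \<cdot> g) v = push F X g' (push F X g v)"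
    and pull_push: "\<lbrakk>f \<in> arr \<C> X' X; g \<in> arr \<C> Y Y'; v \<in> elt \<C> F X Y\<rbrakk>
          \<Longrightarrow> pull F f Y' (push F X g v) = push F X' g (pull F f Y v)"
    and pull_add: "\<lbrakk>f \<in> arr \<C> X' X; f' \<in> arr \<C> X' X; v \<in> elt \<C> F X Y\<rbrakk>
          \<Longrightarrow> pull F (f \<oplus>\<^bsub>Hom \<C> X' X\<^esub> f') Y v = pull F f Y v \<oplus>\<^bsub>val F X' Y\<^esub> pull F f' Y v"
    and pull_smult: "\<lbrakk>r \<in> carrier R; f \<in> arr \<C> X' X; v \<in> elt \<C> F X Y\<rbrakk>
          \<Longrightarrow> pull F (r \<odot>\<^bsub>Hom \<C> X' X\<^esub> f) Y v = r \<odot>\<^bsub>val F X' Y\<^esub> pull F f Y v"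
    and push_add: "\<lbrakk>g \<in> arr \<C> Y Y'; g' \<in> arr \<C> Y Y'; v \<in> elt \<C> F X Y\<rbrakk>
          \<Longrightarrow> push F X (g \<oplus>\<^bsub>Hom \<C> Y Y'\<^esub> g') v = push F X g v \<oplus>\<^bsub>val F X Y'\<^esub> push F X g' v"
    and push_smult: "\<lbrakk>r \<in> carrier R; g \<in> arr \<C> Y Y'; v \<in> elt \<C> F X Y\<rbrakk>
          \<Longrightarrow> push F X (r \<odot>\<^bsub>Hom \<C> Y Y'\<^esub> g) v = r \<odot>\<^bsub>val F X Y'\<^esub> push F X g v"

definition hom_functor :: "('r, 'o, 'm) lincat \<Rightarrow> ('r, 'o, 'm, 'm) bifun" where
  "hom_functor \<C> = \<lparr>val = Hom \<C>, pull = (\<lambda>f Y h. h \<cdot>\<^bsub>\<C>\<^esub> f), push = (\<lambda>X g h. g \<cdot>\<^bsub>\<C>\<^esub> h)\<rparr>"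

text \<open>
  The multiplicative fields of a module record carry no information; they are left unspecified.
\<close>

definition transport_module :: "('v \<Rightarrow> 'w) \<Rightarrow> ('r, 'v) module \<Rightarrow> ('r, 'w) module" where
  "transport_module i M =
     \<lparr>carrier = i ` carrier M, mult = undefined, one = undefined,
      zero = i \<zero>\<^bsub>M\<^esub>, add = (\<lambda>u v. i (the_inv i u \<oplus>\<^bsub>M\<^esub> the_inv i v)),
      smult = (\<lambda>r u. i (r \<odot>\<^bsub>M\<^esub> the_inv i u))\<rparr>"

text \<open>A functor with its values moved into another type along an injection \<open>i\<close>.\<close>

definition transport ::
    "('v \<Rightarrow> 'w) \<Rightarrow> ('r, 'o, 'm, 'v) bifun \<Rightarrow> ('r, 'o, 'm, 'w) bifun" where
  "transport i F =
     \<lparr>val = (\<lambda>X Y. transport_module i (val F X Y)),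
      pull = (\<lambda>f Y v. i (pull F f Y (the_inv i v))),
      push = (\<lambda>X g v. i (push F X g (the_inv i v)))\<rparr>"

text \<open>Equality of functors; values of the representing functions outside their domains are ignored.\<close>

definition same_module :: "'r ring \<Rightarrow> ('r, 'v) module \<Rightarrow> ('r, 'v) module \<Rightarrow> bool" where
  "same_module R M N \<longleftrightarrow>
     carrier M = carrier N \<and> \<zero>\<^bsub>M\<^esub> = \<zero>\<^bsub>N\<^esub> \<and>
     (\<forall>u\<in>carrier M. \<forall>v\<in>carrier M. u \<oplus>\<^bsub>M\<^esub> v = u \<oplus>\<^bsub>N\<^esub> v) \<and>
     (\<forall>r\<in>carrier R. \<forall>u\<in>carrier M. r \<odot>\<^bsub>M\<^esub> u = r \<odot>\<^bsub>N\<^esub> u)"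

definition same_functor ::
    "'r ring \<Rightarrow> ('r, 'o, 'm) lincat \<Rightarrow> ('r, 'o, 'm, 'v) bifun \<Rightarrow> ('r, 'o, 'm, 'v) bifun \<Rightarrow> bool"
  where
  "same_functor R \<C> F G \<longleftrightarrow>
     (\<forall>X\<in>Ob \<C>. \<forall>Y\<in>Ob \<C>. same_module R (val F X Y) (val G X Y)) \<and>
     (\<forall>X' X Y f v. f \<in> arr \<C> X' X \<longrightarrow> v \<in> elt \<C> F X Y \<longrightarrow> pull F f Y v = pull G f Y v) \<and>
     (\<forall>X Y Y' g v. g \<in> arr \<C> Y Y' \<longrightarrow> v \<in> elt \<C> F X Y \<longrightarrow> push F X g v = push G X g v)"

text \<open>
  Natural transformations between bilinear functors, in both variables.  The components are made
  extensional, so that equality of transformations is equality of functions.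
\<close>

definition nat_transformation ::
    "'r ring \<Rightarrow> ('r, 'o, 'm) lincat \<Rightarrow> ('r, 'o, 'm, 'v) bifun \<Rightarrow> ('r, 'o, 'm, 'w) bifun \<Rightarrow>
     ('o \<Rightarrow> 'o \<Rightarrow> 'v \<Rightarrow> 'w) \<Rightarrow> bool" where
  "nat_transformation R \<C> F G \<phi> \<longleftrightarrow>
     (\<forall>X\<in>Ob \<C>. \<forall>Y\<in>Ob \<C>. linear_map R (val F X Y) (val G X Y) (\<phi> X Y) \<and>
                          \<phi> X Y \<in> extensional (carrier (val F X Y))) \<and>
     (\<forall>X Y. \<not> (X \<in> Ob \<C> \<and> Y \<in> Ob \<C>) \<longrightarrow> \<phi> X Y = undefined) \<and>
     (\<forall>X' X Y f v. f \<in> arr \<C> X' X \<longrightarrow> v \<in> elt \<C> F X Y \<longrightarrow>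
        \<phi> X' Y (pull F f Y v) = pull G f Y (\<phi> X Y v)) \<and>
     (\<forall>X Y Y' g v. g \<in> arr \<C> Y Y' \<longrightarrow> v \<in> elt \<C> F X Y \<longrightarrow>
        \<phi> X Y' (push F X g v) = push G X g (\<phi> X Y v))"


section \<open>Extriangulated categories\<close>

text \<open>A sequence \<open>A \<rightarrow> B \<rightarrow> C\<close> with fixed ends is a triple \<open>(x, B, y)\<close>.\<close>

definition seq_class ::
    "('r, 'o, 'm) lincat \<Rightarrow> 'o \<Rightarrow> 'o \<Rightarrow> 'm \<Rightarrow> 'o \<Rightarrow> 'm \<Rightarrow> ('m \<times> 'o \<times> 'm) set" where
  "seq_class \<C> A C x B y =
     {(x', B', y'). x' \<in> arr \<C> A B' \<and> y' \<in> arr \<C> B' C \<and>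
        (\<exists>b. iso_arr \<C> B B' b \<and> b \<cdot>\<^bsub>\<C>\<^esub> x = x' \<and> y' \<cdot>\<^bsub>\<C>\<^esub> b = y)}"

definition ext_morphism ::
    "('r, 'o, 'm) lincat \<Rightarrow> ('r, 'o, 'm, 'e) bifun \<Rightarrow>
     'o \<Rightarrow> 'o \<Rightarrow> 'e \<Rightarrow> 'o \<Rightarrow> 'o \<Rightarrow> 'e \<Rightarrow> 'm \<Rightarrow> 'm \<Rightarrow> bool" where
  "ext_morphism \<C> \<E> C A \<delta> C' A' \<delta>' a c \<longleftrightarrow>
     \<delta> \<in> elt \<C> \<E> C A \<and> \<delta>' \<in> elt \<C> \<E> C' A' \<and> a \<in> arr \<C> A A' \<and> c \<in> arr \<C> C C' \<and>
     push \<E> C a \<delta> = pull \<E> c A' \<delta>'"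

text \<open>\<open>striangle \<C> \<E> s A x B y C \<delta>\<close>: \<open>\<delta> \<in> \<E>(C, A)\<close> and \<open>s(\<delta>) = [A \<rightarrow> B \<rightarrow> C]\<close>.\<close>

definition striangle ::
    "('r, 'o, 'm) lincat \<Rightarrow> ('r, 'o, 'm, 'e) bifun \<Rightarrow>
     ('o \<Rightarrow> 'o \<Rightarrow> 'e \<Rightarrow> ('m \<times> 'o \<times> 'm) set) \<Rightarrow>
     'o \<Rightarrow> 'm \<Rightarrow> 'o \<Rightarrow> 'm \<Rightarrow> 'o \<Rightarrow> 'e \<Rightarrow> bool" where
  "striangle \<C> \<E> s A x B y C \<delta> \<longleftrightarrow>
     \<delta> \<in> elt \<C> \<E> C A \<and> x \<in> arr \<C> A B \<and> y \<in> arr \<C> B C \<and> s C A \<delta> = seq_class \<C> A C x B y"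

text \<open>
  The value \<open>s C A \<delta>\<close> is the equivalence class of sequences assigned to \<open>\<delta> \<in> \<E>(C, A)\<close>.
  Direct sums are only determined up to isomorphism, so the conditions on \<open>s(0)\<close> and
  \<open>s(\<delta> \<oplus> \<delta>')\<close> are stated for all choices of biproducts; as \<open>s\<close> takes values in equivalence
  classes, this is the same as stating them for one choice.
\<close>

locale extriangulated_category = additive_category R \<C> + bilinear_functor R \<C> \<E>
  for R :: "'r ring" and \<C> :: "('r, 'o, 'm) lincat" (structure)
    and \<E> :: "('r, 'o, 'm, 'e) bifun" +
  fixes s :: "'o \<Rightarrow> 'o \<Rightarrow> 'e \<Rightarrow> ('m \<times> 'o \<times> 'm) set"
  assumes realized: "\<delta> \<in> elt \<C> \<E> C A \<Longrightarrow> \<exists>x B y. striangle \<C> \<E> s A x B y C \<delta>"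
    and realization:
      "\<lbrakk>ext_morphism \<C> \<E> C A \<delta> C' A' \<delta>' a c;
        striangle \<C> \<E> s A x B y C \<delta>; striangle \<C> \<E> s A' x' B' y' C' \<delta>'\<rbrakk>
       \<Longrightarrow> \<exists>b\<in>arr \<C> B B'. b \<cdot> x = x' \<cdot> a \<and> y' \<cdot> b = c \<cdot> y"
    and realization_zero:
      "biproduct \<C> A C S i j p q \<Longrightarrow> striangle \<C> \<E> s A i S q C \<zero>\<^bsub>val \<E> C A\<^esub>"
    and realization_sum:
      "\<lbrakk>striangle \<C> \<E> s A x B y C \<delta>; striangle \<C> \<E> s A' x' B' y' C' \<delta>';
        biproduct \<C> A A' SA iA jA pA qA;
        biproduct \<C> B B' SB iB jB pB qB;
        biproduct \<C> C C' SC iC jC pC qC;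
        \<epsilon> \<in> elt \<C> \<E> SC SA;
        pull \<E> iC A (push \<E> SC pA \<epsilon>) = \<delta>;
        pull \<E> jC A' (push \<E> SC qA \<epsilon>) = \<delta>';
        pull \<E> jC A (push \<E> SC pA \<epsilon>) = \<zero>\<^bsub>val \<E> C' A\<^esub>;
        pull \<E> iC A' (push \<E> SC qA \<epsilon>) = \<zero>\<^bsub>val \<E> C A'\<^esub>\<rbrakk>
       \<Longrightarrow> striangle \<C> \<E> s
             SA ((iB \<cdot> x \<cdot> pA) \<oplus>\<^bsub>Hom \<C> SA SB\<^esub> (jB \<cdot> x' \<cdot> qA))
             SB ((iC \<cdot> y \<cdot> pB) \<oplus>\<^bsub>Hom \<C> SB SC\<^esub> (jC \<cdot> y' \<cdot> qB)) SC \<epsilon>"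
    and ET3:
      "\<lbrakk>striangle \<C> \<E> s A x B y C \<delta>; striangle \<C> \<E> s A' x' B' y' C' \<delta>';
        a \<in> arr \<C> A A'; b \<in> arr \<C> B B'; b \<cdot> x = x' \<cdot> a\<rbrakk>
       \<Longrightarrow> \<exists>c\<in>arr \<C> C C'. c \<cdot> y = y' \<cdot> b \<and> push \<E> C a \<delta> = pull \<E> c A' \<delta>'"
    and ET3_op:
      "\<lbrakk>striangle \<C> \<E> s A x B y C \<delta>; striangle \<C> \<E> s A' x' B' y' C' \<delta>';
        b \<in> arr \<C> B B'; c \<in> arr \<C> C C'; c \<cdot> y = y' \<cdot> b\<rbrakk>
       \<Longrightarrow> \<exists>a\<in>arr \<C> A A'. b \<cdot> x = x' \<cdot> a \<and> push \<E> C a \<delta> = pull \<E> c A' \<delta>'"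
    and ET4:
      "\<lbrakk>striangle \<C> \<E> s A f B f' D \<delta>; striangle \<C> \<E> s B g C g' F \<delta>'\<rbrakk>
       \<Longrightarrow> \<exists>E d e h' \<delta>''.
             d \<in> arr \<C> D E \<and> e \<in> arr \<C> E F \<and> h' \<in> arr \<C> C E \<and>
             h' \<cdot> g = d \<cdot> f' \<and> e \<cdot> h' = g' \<and>
             striangle \<C> \<E> s A (g \<cdot> f) C h' E \<delta>'' \<and>
             striangle \<C> \<E> s D d E e F (push \<E> F f' \<delta>') \<and>
             pull \<E> d A \<delta>'' = \<delta> \<and>
             push \<E> E f \<delta>'' = pull \<E> e B \<delta>'"
    and ET4_op:
      "\<lbrakk>striangle \<C> \<E> s D f' B f A \<delta>; striangle \<C> \<E> s F g' C g B \<delta>'\<rbrakk>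
       \<Longrightarrow> \<exists>E d e h' \<delta>''.
             d \<in> arr \<C> E D \<and> e \<in> arr \<C> F E \<and> h' \<in> arr \<C> E C \<and>
             g \<cdot> h' = f' \<cdot> d \<and> h' \<cdot> e = g' \<and>
             striangle \<C> \<E> s E h' C (f \<cdot> g) A \<delta>'' \<and>
             striangle \<C> \<E> s F e E d D (pull \<E> f' F \<delta>') \<and>
             push \<E> A d \<delta>'' = \<delta> \<and>
             pull \<E> f E \<delta>'' = push \<E> B e \<delta>'"

definition projective_morphism ::
    "('r, 'o, 'm) lincat \<Rightarrow> ('r, 'o, 'm, 'e) bifun \<Rightarrow> 'o \<Rightarrow> 'o \<Rightarrow> 'm \<Rightarrow> bool" where
  "projective_morphism \<C> \<E> X Y f \<longleftrightarrow>
     f \<in> arr \<C> X Y \<and> (\<forall>A. \<forall>\<delta>\<in>elt \<C> \<E> Y A. pull \<E> f A \<delta> = \<zero>\<^bsub>val \<E> X A\<^esub>)"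

definition deflation ::
    "('r, 'o, 'm) lincat \<Rightarrow> ('r, 'o, 'm, 'e) bifun \<Rightarrow>
     ('o \<Rightarrow> 'o \<Rightarrow> 'e \<Rightarrow> ('m \<times> 'o \<times> 'm) set) \<Rightarrow> 'o \<Rightarrow> 'o \<Rightarrow> 'm \<Rightarrow> bool" where
  "deflation \<C> \<E> s B C y \<longleftrightarrow> (\<exists>A x \<delta>. striangle \<C> \<E> s A x B y C \<delta>)"

definition enough_projective_morphisms ::
    "('r, 'o, 'm) lincat \<Rightarrow> ('r, 'o, 'm, 'e) bifun \<Rightarrow>
     ('o \<Rightarrow> 'o \<Rightarrow> 'e \<Rightarrow> ('m \<times> 'o \<times> 'm) set) \<Rightarrow> bool" where
  "enough_projective_morphisms \<C> \<E> s \<longleftrightarrow>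
     (\<forall>C\<in>Ob \<C>. \<exists>G g. deflation \<C> \<E> s G C g \<and> projective_morphism \<C> \<E> G C g)"


section \<open>Positive extensions\<close>

text \<open>
  All functors \<open>\<E>\<^sup>n\<close>, \<open>n \<ge> 0\<close>, take values in the following type: morphisms for \<open>n = 0\<close>,
  extensions for \<open>n = 1\<close>, and, for \<open>n \<ge> 2\<close>, formal sums of tensors \<open>\<rho> \<otimes> \<tau>\<close> with
  \<open>\<rho> \<in> \<E>\<^sup>n\<^sup>-\<^sup>1(M, Y)\<close> and \<open>\<tau> \<in> \<E>(X, M)\<close>, recorded as lists of triples \<open>(M, \<rho>, \<tau>)\<close>.  The quotient
  defining the coend is formed by selecting one list in every equivalence class: classes
  themselves would live in a type that grows with \<open>n\<close>.
\<close>

datatype ('o, 'm, 'e) pext =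
    HomEl (hom_of: 'm)
  | ExtEl (ext_of: 'e)
  | SumEl (terms_of: "('o \<times> ('o, 'm, 'e) pext \<times> 'e) list")

definition coend_terms ::
    "('r, 'o, 'm) lincat \<Rightarrow> ('r, 'o, 'm, 'v) bifun \<Rightarrow> ('r, 'o, 'm, 'e) bifun \<Rightarrow> 'o \<Rightarrow> 'o \<Rightarrow>
     ('o \<times> 'v \<times> 'e) set" where
  "coend_terms \<C> G \<E> X Y = {(M, \<rho>, \<tau>). \<rho> \<in> elt \<C> G M Y \<and> \<tau> \<in> elt \<C> \<E> X M}"

text \<open>
  The congruence on formal sums whose quotient is the coend of \<open>G(M, Y) \<otimes>\<^sub>R \<E>(X, M)\<close> over \<open>M\<close>:
  commutativity and the relations of the tensor product, and dinaturality in \<open>M\<close>.  Lists carry only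
  a monoid structure, but \<open>\<rho> \<otimes> \<tau>\<close> and \<open>(-\<rho>) \<otimes> \<tau>\<close> add up to \<open>0 \<otimes> \<tau>\<close>, which is
  identified with the empty sum, so that the quotient is a group.
\<close>

inductive coend_eq ::
    "'r ring \<Rightarrow> ('r, 'o, 'm) lincat \<Rightarrow> ('r, 'o, 'm, 'v) bifun \<Rightarrow> ('r, 'o, 'm, 'e) bifun \<Rightarrow>
     'o \<Rightarrow> 'o \<Rightarrow> ('o \<times> 'v \<times> 'e) list \<Rightarrow> ('o \<times> 'v \<times> 'e) list \<Rightarrow> bool"
  for R \<C> G \<E> X Y where
  coend_refl: "l \<in> lists (coend_terms \<C> G \<E> X Y) \<Longrightarrow> coend_eq R \<C> G \<E> X Y l l"
| coend_sym: "coend_eq R \<C> G \<E> X Y l k \<Longrightarrow> coend_eq R \<C> G \<E> X Y k l"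
| coend_trans: "\<lbrakk>coend_eq R \<C> G \<E> X Y l k; coend_eq R \<C> G \<E> X Y k m\<rbrakk> \<Longrightarrow> coend_eq R \<C> G \<E> X Y l m"
| coend_append: "\<lbrakk>coend_eq R \<C> G \<E> X Y l l'; coend_eq R \<C> G \<E> X Y k k'\<rbrakk>
    \<Longrightarrow> coend_eq R \<C> G \<E> X Y (l @ k) (l' @ k')"
| coend_commute: "\<lbrakk>l \<in> lists (coend_terms \<C> G \<E> X Y); k \<in> lists (coend_terms \<C> G \<E> X Y)\<rbrakk>
    \<Longrightarrow> coend_eq R \<C> G \<E> X Y (l @ k) (k @ l)"
| coend_zero: "\<tau> \<in> elt \<C> \<E> X M \<Longrightarrow> Y \<in> Ob \<C> \<Longrightarrow> coend_eq R \<C> G \<E> X Y [(M, \<zero>\<^bsub>val G M Y\<^esub>, \<tau>)] []"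
| coend_add_left: "\<lbrakk>\<rho> \<in> elt \<C> G M Y; \<rho>' \<in> elt \<C> G M Y; \<tau> \<in> elt \<C> \<E> X M\<rbrakk>
    \<Longrightarrow> coend_eq R \<C> G \<E> X Y [(M, \<rho> \<oplus>\<^bsub>val G M Y\<^esub> \<rho>', \<tau>)] [(M, \<rho>, \<tau>), (M, \<rho>', \<tau>)]"
| coend_add_right: "\<lbrakk>\<rho> \<in> elt \<C> G M Y; \<tau> \<in> elt \<C> \<E> X M; \<tau>' \<in> elt \<C> \<E> X M\<rbrakk>
    \<Longrightarrow> coend_eq R \<C> G \<E> X Y [(M, \<rho>, \<tau> \<oplus>\<^bsub>val \<E> X M\<^esub> \<tau>')] [(M, \<rho>, \<tau>), (M, \<rho>, \<tau>')]"
| coend_smult: "\<lbrakk>r \<in> carrier R; \<rho> \<in> elt \<C> G M Y; \<tau> \<in> elt \<C> \<E> X M\<rbrakk>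
    \<Longrightarrow> coend_eq R \<C> G \<E> X Y [(M, r \<odot>\<^bsub>val G M Y\<^esub> \<rho>, \<tau>)] [(M, \<rho>, r \<odot>\<^bsub>val \<E> X M\<^esub> \<tau>)]"
| coend_dinatural: "\<lbrakk>f \<in> arr \<C> M M'; \<rho> \<in> elt \<C> G M' Y; \<tau> \<in> elt \<C> \<E> X M\<rbrakk>
    \<Longrightarrow> coend_eq R \<C> G \<E> X Y [(M, pull G f Y \<rho>, \<tau>)] [(M', \<rho>, push \<E> X f \<tau>)]"

definition coend_class ::
    "'r ring \<Rightarrow> ('r, 'o, 'm) lincat \<Rightarrow> ('r, 'o, 'm, ('o, 'm, 'e) pext) bifun \<Rightarrow>
     ('r, 'o, 'm, 'e) bifun \<Rightarrow> 'o \<Rightarrow> 'o \<Rightarrow> ('o \<times> ('o, 'm, 'e) pext \<times> 'e) list \<Rightarrow>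
     ('o, 'm, 'e) pext" where
  "coend_class R \<C> G \<E> X Y l = SumEl (SOME k. coend_eq R \<C> G \<E> X Y l k)"

definition coend ::
    "'r ring \<Rightarrow> ('r, 'o, 'm) lincat \<Rightarrow> ('r, 'o, 'm, ('o, 'm, 'e) pext) bifun \<Rightarrow>
     ('r, 'o, 'm, 'e) bifun \<Rightarrow> ('r, 'o, 'm, ('o, 'm, 'e) pext) bifun" where
  "coend R \<C> G \<E> =
     \<lparr>val = (\<lambda>X Y.
        \<lparr>carrier = coend_class R \<C> G \<E> X Y ` lists (coend_terms \<C> G \<E> X Y),
         mult = undefined, one = undefined,
         zero = coend_class R \<C> G \<E> X Y [],
         add = (\<lambda>u v. coend_class R \<C> G \<E> X Y (terms_of u @ terms_of v)),
         smult = (\<lambda>r u. coend_class R \<C> G \<E> X Y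
                    (map (\<lambda>(M, \<rho>, \<tau>). (M, r \<odot>\<^bsub>val G M Y\<^esub> \<rho>, \<tau>)) (terms_of u)))\<rparr>),
      pull = (\<lambda>f Y u. coend_class R \<C> G \<E> (Dom \<C> f) Y
                    (map (\<lambda>(M, \<rho>, \<tau>). (M, \<rho>, pull \<E> f M \<tau>)) (terms_of u))),
      push = (\<lambda>X g u. coend_class R \<C> G \<E> X (Cod \<C> g)
                    (map (\<lambda>(M, \<rho>, \<tau>). (M, push G M g \<rho>, \<tau>)) (terms_of u)))\<rparr>"

fun Epos ::
    "'r ring \<Rightarrow> ('r, 'o, 'm) lincat \<Rightarrow> ('r, 'o, 'm, 'e) bifun \<Rightarrow> nat \<Rightarrow>
     ('r, 'o, 'm, ('o, 'm, 'e) pext) bifun" where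
  "Epos R \<C> \<E> 0 = transport HomEl (hom_functor \<C>)"
| "Epos R \<C> \<E> (Suc 0) = transport ExtEl \<E>"
| "Epos R \<C> \<E> (Suc (Suc n)) = coend R \<C> (Epos R \<C> \<E> (Suc n)) \<E>"

text \<open>
  \<open>cup R \<C> \<E> s t X M Y \<rho> \<tau>\<close> is \<open>\<rho> \<union> \<tau> \<in> \<E>\<^sup>s\<^sup>+\<^sup>t(X, Y)\<close> for \<open>\<rho> \<in> \<E>\<^sup>s(M, Y)\<close> and \<open>\<tau> \<in> \<E>\<^sup>t(X, M)\<close>.
  It is the functorial action if \<open>s\<close> or \<open>t\<close> is \<open>0\<close> (co-Yoneda) and the class of \<open>\<rho> \<otimes> \<tau>\<close> if
  \<open>t = 1\<close>; for \<open>t \<ge> 2\<close> it is given by associativity,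
  \<open>\<rho> \<union> (\<Sum> \<rho>' \<otimes> \<tau>') = \<Sum> (\<rho> \<union> \<rho>') \<otimes> \<tau>'\<close>.
\<close>

fun cup ::
    "'r ring \<Rightarrow> ('r, 'o, 'm) lincat \<Rightarrow> ('r, 'o, 'm, 'e) bifun \<Rightarrow> nat \<Rightarrow> nat \<Rightarrow>
     'o \<Rightarrow> 'o \<Rightarrow> 'o \<Rightarrow> ('o, 'm, 'e) pext \<Rightarrow> ('o, 'm, 'e) pext \<Rightarrow> ('o, 'm, 'e) pext" where
  "cup R \<C> \<E> s 0 X M Y \<rho> \<tau> = pull (Epos R \<C> \<E> s) (hom_of \<tau>) Y \<rho>"
| "cup R \<C> \<E> 0 (Suc 0) X M Y \<rho> \<tau> = push (Epos R \<C> \<E> 1) X (hom_of \<rho>) \<tau>"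
| "cup R \<C> \<E> (Suc s) (Suc 0) X M Y \<rho> \<tau> =
     coend_class R \<C> (Epos R \<C> \<E> (Suc s)) \<E> X Y [(M, \<rho>, ext_of \<tau>)]"
| "cup R \<C> \<E> s (Suc (Suc t)) X M Y \<rho> \<tau> =
     coend_class R \<C> (Epos R \<C> \<E> (s + Suc t)) \<E> X Y
       (map (\<lambda>(M', \<rho>', \<tau>'). (M', cup R \<C> \<E> s (Suc t) M' M Y \<rho> \<rho>', \<tau>')) (terms_of \<tau>))"

text \<open>For \<open>\<delta> \<in> \<E>(C, A)\<close>: the maps \<open>\<delta>\<^sub>\<sharp> : \<E>\<^sup>n(X, C) \<rightarrow> \<E>\<^sup>n\<^sup>+\<^sup>1(X, A)\<close> and
  \<open>\<delta>\<^sup>\<sharp> : \<E>\<^sup>n(A, Y) \<rightarrow> \<E>\<^sup>n\<^sup>+\<^sup>1(C, Y)\<close>.\<close>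

definition lower_sharp ::
    "'r ring \<Rightarrow> ('r, 'o, 'm) lincat \<Rightarrow> ('r, 'o, 'm, 'e) bifun \<Rightarrow> nat \<Rightarrow>
     'o \<Rightarrow> 'o \<Rightarrow> 'e \<Rightarrow> 'o \<Rightarrow> ('o, 'm, 'e) pext \<Rightarrow> ('o, 'm, 'e) pext" where
  "lower_sharp R \<C> \<E> n C A \<delta> X \<tau> = cup R \<C> \<E> 1 n X C A (ExtEl \<delta>) \<tau>"

definition upper_sharp ::
    "'r ring \<Rightarrow> ('r, 'o, 'm) lincat \<Rightarrow> ('r, 'o, 'm, 'e) bifun \<Rightarrow> nat \<Rightarrow>
     'o \<Rightarrow> 'o \<Rightarrow> 'e \<Rightarrow> 'o \<Rightarrow> ('o, 'm, 'e) pext \<Rightarrow> ('o, 'm, 'e) pext" where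
  "upper_sharp R \<C> \<E> n C A \<delta> Y \<tau> = cup R \<C> \<E> n 1 C A Y \<tau> (ExtEl \<delta>)"


lemma the_inv_ExtEl [simp]: "the_inv ExtEl (ExtEl \<delta>) = \<delta>"
  by (rule the_inv_f_f) (simp add: inj_def)

lemma lower_sharp_0: "lower_sharp R \<C> \<E> 0 C A \<delta> X (HomEl f) = ExtEl (pull \<E> f A \<delta>)"
  by (simp add: lower_sharp_def transport_def)

lemma upper_sharp_0: "upper_sharp R \<C> \<E> 0 C A \<delta> Y (HomEl g) = ExtEl (push \<E> C g \<delta>)"
  by (simp add: upper_sharp_def transport_def)


section \<open>Negative extensions\<close>

text \<open>The module of natural transformations from \<open>G(A, -)\<close> to \<open>H(C, -)\<close>.\<close>

definition nat_module ::
    "'r ring \<Rightarrow> ('r, 'o, 'm) lincat \<Rightarrow> ('r, 'o, 'm, 'v) bifun \<Rightarrow> 'o \<Rightarrow>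
     ('r, 'o, 'm, 'w) bifun \<Rightarrow> 'o \<Rightarrow> ('r, 'o \<Rightarrow> 'v \<Rightarrow> 'w) module" where
  "nat_module R \<C> G A H C =
     \<lparr>carrier = {\<theta> \<in> extensional (Ob \<C>).
        (\<forall>Y\<in>Ob \<C>. linear_map R (val G A Y) (val H C Y) (\<theta> Y) \<and>
                   \<theta> Y \<in> extensional (carrier (val G A Y))) \<and>
        (\<forall>Y Y' f v. f \<in> arr \<C> Y Y' \<longrightarrow> v \<in> elt \<C> G A Y \<longrightarrow>
           \<theta> Y' (push G A f v) = push H C f (\<theta> Y v))},
      mult = undefined, one = undefined,
      zero = (\<lambda>Y\<in>Ob \<C>. \<lambda>v\<in>carrier (val G A Y). \<zero>\<^bsub>val H C Y\<^esub>),
      add = (\<lambda>\<theta> \<theta>'. \<lambda>Y\<in>Ob \<C>. \<lambda>v\<in>carrier (val G A Y). \<theta> Y v \<oplus>\<^bsub>val H C Y\<^esub> \<theta>' Y v),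
      smult = (\<lambda>r \<theta>. \<lambda>Y\<in>Ob \<C>. \<lambda>v\<in>carrier (val G A Y). r \<odot>\<^bsub>val H C Y\<^esub> \<theta> Y v)\<rparr>"

type_synonym ('o, 'm, 'e) neg_ext = "'o \<Rightarrow> ('o, 'm, 'e) pext \<Rightarrow> 'm"

text \<open>\<open>Eneg R \<C> \<E> n\<close> is the functor sending \<open>(C, A)\<close> to the natural transformations from
  \<open>\<E>\<^sup>n(A, -)\<close> to \<open>\<C>(C, -)\<close>.\<close>

definition Eneg ::
    "'r ring \<Rightarrow> ('r, 'o, 'm) lincat \<Rightarrow> ('r, 'o, 'm, 'e) bifun \<Rightarrow> nat \<Rightarrow>
     ('r, 'o, 'm, ('o, 'm, 'e) neg_ext) bifun" where
  "Eneg R \<C> \<E> n =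
     \<lparr>val = (\<lambda>C A. nat_module R \<C> (Epos R \<C> \<E> n) A (hom_functor \<C>) C),
      pull = (\<lambda>c A \<theta>. \<lambda>Y\<in>Ob \<C>. \<lambda>v\<in>carrier (val (Epos R \<C> \<E> n) A Y). \<theta> Y v \<cdot>\<^bsub>\<C>\<^esub> c),
      push = (\<lambda>C a \<theta>. \<lambda>Y\<in>Ob \<C>. \<lambda>v\<in>carrier (val (Epos R \<C> \<E> n) (Cod \<C> a) Y).
                \<theta> Y (pull (Epos R \<C> \<E> n) a Y v))\<rparr>"

text \<open>Precomposition with \<open>\<delta>\<^sup>\<sharp> : \<E>\<^sup>n(A, -) \<rightarrow> \<E>\<^sup>n\<^sup>+\<^sup>1(C, -)\<close>.\<close>

definition precomp_sharp ::
    "'r ring \<Rightarrow> ('r, 'o, 'm) lincat \<Rightarrow> ('r, 'o, 'm, 'e) bifun \<Rightarrow> nat \<Rightarrow>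
     'o \<Rightarrow> 'o \<Rightarrow> 'e \<Rightarrow> ('o, 'm, 'e) neg_ext \<Rightarrow> ('o, 'm, 'e) neg_ext" where
  "precomp_sharp R \<C> \<E> n C A \<delta> \<theta> =
     (\<lambda>Y\<in>Ob \<C>. \<lambda>v\<in>carrier (val (Epos R \<C> \<E> n) A Y). \<theta> Y (upper_sharp R \<C> \<E> n C A \<delta> Y v))"

text \<open>
  A functor of an integer-indexed sequence takes values in a sum type, whose left summand holds the
  values in non-negative degrees, so that the requirement that it be equal to \<open>\<E>\<^sup>n\<close> there
  leaves the negative degrees free to take values in any type.
\<close>

definition EI ::
    "'r ring \<Rightarrow> ('r, 'o, 'm) lincat \<Rightarrow> ('r, 'o, 'm, 'e) bifun \<Rightarrow> int \<Rightarrow>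
     ('r, 'o, 'm, ('o, 'm, 'e) pext + ('o, 'm, 'e) neg_ext) bifun" where
  "EI R \<C> \<E> n =
     (if n \<ge> 0 then transport Inl (Epos R \<C> \<E> (nat n)) else transport Inr (Eneg R \<C> \<E> (nat (- n))))"

text \<open>
  In degree \<open>-1\<close> the value \<open>\<theta> \<circ> \<delta>\<^sup>\<sharp> : \<C>(A, -) \<rightarrow> \<C>(X, -)\<close> of \<open>\<delta>\<^sub>\<sharp>\<close> at \<open>\<theta>\<close> is converted into a morphism
  \<open>X \<rightarrow> A\<close> by the Yoneda isomorphism, evaluation at the identity of \<open>A\<close>.
\<close>

definition EI_sharp ::
    "'r ring \<Rightarrow> ('r, 'o, 'm) lincat \<Rightarrow> ('r, 'o, 'm, 'e) bifun \<Rightarrow> int \<Rightarrow>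
     'o \<Rightarrow> 'o \<Rightarrow> 'e \<Rightarrow> 'o \<Rightarrow> ('o, 'm, 'e) pext + ('o, 'm, 'e) neg_ext \<Rightarrow>
     ('o, 'm, 'e) pext + ('o, 'm, 'e) neg_ext" where
  "EI_sharp R \<C> \<E> n C A \<delta> X v =
     (if n \<ge> 0 then Inl (lower_sharp R \<C> \<E> (nat n) C A \<delta> X (projl v))
      else if n = -1 then Inl (HomEl (precomp_sharp R \<C> \<E> 0 C A \<delta> (projr v) A (HomEl (Idn \<C> A))))
      else Inr (precomp_sharp R \<C> \<E> (nat (- n - 1)) C A \<delta> (projr v)))"


section \<open>Connected sequences of functors\<close>

text \<open>\<open>d n C A \<delta> X\<close> is the component at \<open>X\<close> of \<open>\<delta>\<^sub>\<sharp> : F\<^sup>n(-, C) \<rightarrow> F\<^sup>n\<^sup>+\<^sup>1(-, A)\<close>.\<close>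

locale connected_sequence = linear_category R \<C>
  for R :: "'r ring" and \<C> :: "('r, 'o, 'm) lincat" (structure) +
  fixes \<E> :: "('r, 'o, 'm, 'e) bifun"
    and F :: "int \<Rightarrow> ('r, 'o, 'm, 'v) bifun"
    and d :: "int \<Rightarrow> 'o \<Rightarrow> 'o \<Rightarrow> 'e \<Rightarrow> 'o \<Rightarrow> 'v \<Rightarrow> 'v"
  assumes functors: "bilinear_functor R \<C> (F n)"
    and d_linear: "\<lbrakk>\<delta> \<in> elt \<C> \<E> C A; X \<in> Ob \<C>\<rbrakk>
          \<Longrightarrow> linear_map R (val (F n) X C) (val (F (n + 1)) X A) (d n C A \<delta> X)"
    and d_natural: "\<lbrakk>\<delta> \<in> elt \<C> \<E> C A; f \<in> arr \<C> X' X; v \<in> elt \<C> (F n) X C\<rbrakk>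
          \<Longrightarrow> d n C A \<delta> X' (pull (F n) f C v) = pull (F (n + 1)) f A (d n C A \<delta> X v)"
    and d_ext_morphism: "\<lbrakk>ext_morphism \<C> \<E> C A \<delta> C' A' \<delta>' a c; v \<in> elt \<C> (F n) X C\<rbrakk>
          \<Longrightarrow> push (F (n + 1)) X a (d n C A \<delta> X v) = d n C' A' \<delta>' X (push (F n) X c v)"

definition canonical_nonneg ::
    "'r ring \<Rightarrow> ('r, 'o, 'm) lincat \<Rightarrow> ('r, 'o, 'm, 'e) bifun \<Rightarrow>
     (int \<Rightarrow> ('r, 'o, 'm, ('o, 'm, 'e) pext + 'f) bifun) \<Rightarrow>
     (int \<Rightarrow> 'o \<Rightarrow> 'o \<Rightarrow> 'e \<Rightarrow> 'o \<Rightarrow> ('o, 'm, 'e) pext + 'f \<Rightarrow> ('o, 'm, 'e) pext + 'f) \<Rightarrow> bool" where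
  "canonical_nonneg R \<C> \<E> F d \<longleftrightarrow>
     (\<forall>n. same_functor R \<C> (F (int n)) (transport Inl (Epos R \<C> \<E> n))) \<and>
     (\<forall>n C A X \<delta> \<tau>. \<delta> \<in> elt \<C> \<E> C A \<longrightarrow> \<tau> \<in> elt \<C> (Epos R \<C> \<E> n) X C \<longrightarrow>
        d (int n) C A \<delta> X (Inl \<tau>) = Inl (lower_sharp R \<C> \<E> n C A \<delta> X \<tau>))"

definition sequence_morphism ::
    "'r ring \<Rightarrow> ('r, 'o, 'm) lincat \<Rightarrow> ('r, 'o, 'm, 'e) bifun \<Rightarrow>
     (int \<Rightarrow> ('r, 'o, 'm, 'v) bifun) \<Rightarrow> (int \<Rightarrow> 'o \<Rightarrow> 'o \<Rightarrow> 'e \<Rightarrow> 'o \<Rightarrow> 'v \<Rightarrow> 'v) \<Rightarrow>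
     (int \<Rightarrow> ('r, 'o, 'm, 'w) bifun) \<Rightarrow> (int \<Rightarrow> 'o \<Rightarrow> 'o \<Rightarrow> 'e \<Rightarrow> 'o \<Rightarrow> 'w \<Rightarrow> 'w) \<Rightarrow>
     (int \<Rightarrow> 'o \<Rightarrow> 'o \<Rightarrow> 'v \<Rightarrow> 'w) \<Rightarrow> bool" where
  "sequence_morphism R \<C> \<E> F d G d' \<phi> \<longleftrightarrow>
     (\<forall>n. nat_transformation R \<C> (F n) (G n) (\<phi> n)) \<and>
     (\<forall>n C A \<delta> X v. \<delta> \<in> elt \<C> \<E> C A \<longrightarrow> v \<in> elt \<C> (F n) X C \<longrightarrow>
        \<phi> (n + 1) X A (d n C A \<delta> X v) = d' n C A \<delta> X (\<phi> n X C v))"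

end

theory Submission
  imports Defs
begin

text \<open>
  A natural transformation \<open>F\<^sup>-\<^sup>n(X, A) \<rightarrow> (\<C> Mod)(\<E>\<^sup>n(A, -), \<C>(X, -))\<close> is the same as a pairing
  \<open>\<E>\<^sup>n(A, Y) \<times> F\<^sup>-\<^sup>n(X, A) \<rightarrow> \<C>(X, Y)\<close>, bilinear over \<open>R\<close>, natural in \<open>X\<close> and \<open>Y\<close> and dinatural in \<open>A\<close>.
  The connecting morphism of the negative extensions is precomposition with \<open>\<rho> \<mapsto> \<rho> \<union> \<tau>\<close>, so a
  family of such transformations commutes with the connecting morphisms exactly if its pairings satisfy
  \<open>\<langle>\<rho> \<union> \<tau>, v\<rangle> = \<langle>\<rho>, \<tau>\<^sub>\<sharp> v\<rangle>\<close> for \<open>\<tau> \<in> \<E>(A, M)\<close> and \<open>\<rho> \<in> \<E>\<^sup>n\<^sup>-\<^sup>1(M, Y)\<close>.  Since \<open>\<E>\<^sup>n\<close> is generated by such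
  products, and since the pairing with \<open>\<E>\<^sup>0 = \<C>\<close> is the composition of \<open>\<C>\<close> under the identification
  \<open>F\<^sup>0 = \<C>\<close>, there is at most one such family: a product \<open>\<tau>\<^sub>1 \<union> \<dots> \<union> \<tau>\<^sub>n\<close> has to act on \<open>F\<^sup>-\<^sup>n\<close> as
  the composite \<open>(\<tau>\<^sub>1)\<^sub>\<sharp> \<dots> (\<tau>\<^sub>n)\<^sub>\<sharp>\<close>, with values in \<open>F\<^sup>0 = \<C>\<close>
  (\<open>negative_components_determined\<close>).

  Conversely, this formula defines the pairing in degree \<open>n\<close> from the one in degree \<open>n - 1\<close>, because
  \<open>\<E>\<^sup>n(A, Y)\<close> is the coend of \<open>\<E>\<^sup>n\<^sup>-\<^sup>1(M, Y) \<otimes> \<E>(A, M)\<close>: it suffices that \<open>(\<rho>, \<tau>) \<mapsto> \<langle>\<rho>, \<tau>\<^sub>\<sharp> v\<rangle>\<close> is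
  bilinear and dinatural in \<open>M\<close> (\<open>extend_pairing_balanced\<close>).  Dinaturality is the naturality of \<open>\<tau>\<^sub>\<sharp>\<close>
  with respect to morphisms of extensions.  Linearity in \<open>\<tau>\<close> is not an axiom of a connected sequence;
  it follows from that same naturality, applied to an extension by a biproduct
  (\<open>D_linear_in_extension\<close>).  All remaining naturality properties of the pairing are equations between
  linear maps on \<open>\<E>\<^sup>n\<close> and need to be checked on products only.

  The larger part of the work is to see that the objects involved are what they are meant to be: that
  the coend is a bilinear functor with its universal property, that the products \<open>\<rho> \<union> \<tau>\<close> present
  \<open>\<E>\<^sup>n\<^sup>+\<^sup>1\<close> as a coend for all \<open>n \<ge> 0\<close>, and that the \<open>\<E>\<^sub>I\<^sup>n\<close> with \<open>\<delta>\<^sub>\<sharp>\<close> form a connected sequence.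
\<close>


section \<open>Linear maps\<close>

lemma linear_mapI:
  assumes "\<And>u. u \<in> carrier M \<Longrightarrow> f u \<in> carrier N"
    and "\<And>u v. \<lbrakk>u \<in> carrier M; v \<in> carrier M\<rbrakk> \<Longrightarrow> f (u \<oplus>\<^bsub>M\<^esub> v) = f u \<oplus>\<^bsub>N\<^esub> f v"
    and "\<And>r u. \<lbrakk>r \<in> carrier R; u \<in> carrier M\<rbrakk> \<Longrightarrow> f (r \<odot>\<^bsub>M\<^esub> u) = r \<odot>\<^bsub>N\<^esub> f u"
  shows "linear_map R M N f"
  using assms by (auto simp: linear_map_def)

lemma linear_map_closed: "linear_map R M N f \<Longrightarrow> u \<in> carrier M \<Longrightarrow> f u \<in> carrier N"
  by (auto simp: linear_map_def)

lemma linear_map_add: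
  "linear_map R M N f \<Longrightarrow> u \<in> carrier M \<Longrightarrow> v \<in> carrier M \<Longrightarrow> f (u \<oplus>\<^bsub>M\<^esub> v) = f u \<oplus>\<^bsub>N\<^esub> f v"
  by (auto simp: linear_map_def)

lemma linear_map_smult:
  "linear_map R M N f \<Longrightarrow> r \<in> carrier R \<Longrightarrow> u \<in> carrier M \<Longrightarrow> f (r \<odot>\<^bsub>M\<^esub> u) = r \<odot>\<^bsub>N\<^esub> f u"
  by (auto simp: linear_map_def)

lemma linear_map_zero:
  assumes f: "linear_map R M N f" and M: "module R M" and N: "module R N"
  shows "f \<zero>\<^bsub>M\<^esub> = \<zero>\<^bsub>N\<^esub>"
proof -
  interpret M: module R M by fact
  interpret N: module R N by fact
  have c: "f \<zero>\<^bsub>M\<^esub> \<in> carrier N"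
    using linear_map_closed[OF f] by simp
  have "f \<zero>\<^bsub>M\<^esub> \<oplus>\<^bsub>N\<^esub> f \<zero>\<^bsub>M\<^esub> = f \<zero>\<^bsub>M\<^esub>"
    using linear_map_add[OF f, of "\<zero>\<^bsub>M\<^esub>" "\<zero>\<^bsub>M\<^esub>"] by simp
  then show ?thesis
    using c N.add.l_cancel_one by metis
qed

lemma linear_map_cong:
  assumes "linear_map R M N f" and M: "module R M" and "\<And>u. u \<in> carrier M \<Longrightarrow> g u = f u"
  shows "linear_map R M N g"
proof -
  interpret M: module R M by fact
  show ?thesis
    using assms by (auto simp: linear_map_def)
qed

lemma linear_map_compose:
  "linear_map R M N f \<Longrightarrow> linear_map R N P g \<Longrightarrow> linear_map R M P (\<lambda>u. g (f u))"
  by (auto simp: linear_map_def Pi_iff)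

lemma linear_map_sum:
  assumes f: "linear_map R M N f" and g: "linear_map R M N g" and N: "module R N"
  shows "linear_map R M N (\<lambda>u. f u \<oplus>\<^bsub>N\<^esub> g u)"
proof -
  interpret N: module R N by fact
  show ?thesis
    using linear_map_closed[OF f] linear_map_closed[OF g]
    by (intro linear_mapI)
      (simp_all add: linear_map_add[OF f] linear_map_add[OF g] linear_map_smult[OF f]
        linear_map_smult[OF g] N.smult_r_distr N.a_ac)
qed

lemma linear_map_scale:
  assumes f: "linear_map R M N f" and N: "module R N" and r: "r \<in> carrier R"
  shows "linear_map R M N (\<lambda>u. r \<odot>\<^bsub>N\<^esub> f u)"
proof -
  interpret N: module R N by fact
  show ?thesis
    using linear_map_closed[OF f] r
    by (intro linear_mapI)
      (simp_all add: linear_map_add[OF f] linear_map_smult[OF f] N.smult_r_distr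
        N.smult_assoc1[symmetric] N.m_comm)
qed

fun lsum :: "('r, 'v) module \<Rightarrow> 'v list \<Rightarrow> 'v" where
  "lsum N [] = \<zero>\<^bsub>N\<^esub>"
| "lsum N (v # vs) = v \<oplus>\<^bsub>N\<^esub> lsum N vs"

lemma lsum_closed: "module R N \<Longrightarrow> set vs \<subseteq> carrier N \<Longrightarrow> lsum N vs \<in> carrier N"
proof (induction vs)
  case (Cons v vs)
  interpret N: module R N by fact
  from Cons show ?case by simp
qed (simp add: module_def abelian_group_def abelian_monoid.zero_closed)

lemma lsum_append:
  "module R N \<Longrightarrow> set us \<subseteq> carrier N \<Longrightarrow> set vs \<subseteq> carrier N \<Longrightarrow>
    lsum N (us @ vs) = lsum N us \<oplus>\<^bsub>N\<^esub> lsum N vs"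
proof (induction us)
  case Nil
  interpret N: module R N by fact
  from Nil show ?case by (simp add: lsum_closed[where R = R])
next
  case (Cons u us)
  interpret N: module R N by fact
  from Cons show ?case by (simp add: lsum_closed[where R = R] N.a_assoc)
qed


section \<open>Transport along injections\<close>

lemma transport_module_simps [simp]:
  "carrier (transport_module i M) = i ` carrier M"
  "\<zero>\<^bsub>transport_module i M\<^esub> = i \<zero>\<^bsub>M\<^esub>"
  "inj i \<Longrightarrow> i u \<oplus>\<^bsub>transport_module i M\<^esub> i v = i (u \<oplus>\<^bsub>M\<^esub> v)"
  "inj i \<Longrightarrow> r \<odot>\<^bsub>transport_module i M\<^esub> i u = i (r \<odot>\<^bsub>M\<^esub> u)"
  by (simp_all add: transport_module_def the_inv_f_f)

lemma transport_simps [simp]: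
  "val (transport i F) X Y = transport_module i (val F X Y)"
  "inj i \<Longrightarrow> pull (transport i F) f Y (i v) = i (pull F f Y v)"
  "inj i \<Longrightarrow> push (transport i F) X g (i v) = i (push F X g v)"
  by (simp_all add: transport_def the_inv_f_f)

lemma module_transport:
  assumes i: "inj i" and M: "module R M"
  shows "module R (transport_module i M)"
proof -
  interpret M: module R M by fact
  show ?thesis
  proof (intro moduleI abelian_groupI)
    fix u assume "u \<in> carrier (transport_module i M)"
    then obtain v where v: "v \<in> carrier M" "u = i v" by auto
    have "i (\<ominus>\<^bsub>M\<^esub> v) \<oplus>\<^bsub>transport_module i M\<^esub> u = \<zero>\<^bsub>transport_module i M\<^esub>"
      using v i by (simp add: M.l_neg)
    then show "\<exists>w\<in>carrier (transport_module i M). w \<oplus>\<^bsub>transport_module i M\<^esub> u = \<zero>\<^bsub>transport_module i M\<^esub>"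
      using v by auto
  qed (use i in \<open>auto simp: M.a_ac M.smult_l_distr M.smult_r_distr M.smult_assoc1
        intro: M.is_cring\<close>)
qed

lemma linear_map_transport: "inj i \<Longrightarrow> linear_map R M (transport_module i M) i"
  by (auto intro!: linear_mapI)

lemma linear_map_from_transport:
  "inj i \<Longrightarrow> linear_map R (transport_module i M) N f \<longleftrightarrow> linear_map R M N (\<lambda>u. f (i u))"
  by (auto simp: linear_map_def)

lemma linear_map_between_transports:
  "inj i \<Longrightarrow> linear_map R M N f \<Longrightarrow> (\<And>u. u \<in> carrier M \<Longrightarrow> g (i u) = i (f u)) \<Longrightarrow> module R M \<Longrightarrow>
    linear_map R (transport_module i M) (transport_module i N) g"
  unfolding linear_map_from_transport
  by (rule linear_map_cong[where f = "\<lambda>u. i (f u)"])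
    (auto intro: linear_map_compose linear_map_transport)

lemma elt_transport:
  "v \<in> elt \<C> (transport i F) X Y \<longleftrightarrow> (\<exists>u\<in>elt \<C> F X Y. v = i u)"
  by (auto simp: elt_def)

section \<open>Elements of bilinear functors\<close>

lemma arrD: "f \<in> arr \<C> X Y \<Longrightarrow> X \<in> Ob \<C>" "f \<in> arr \<C> X Y \<Longrightarrow> Y \<in> Ob \<C>"
    "f \<in> arr \<C> X Y \<Longrightarrow> f \<in> carrier (Hom \<C> X Y)"
  by (auto simp: arr_def)

lemma eltD: "v \<in> elt \<C> F X Y \<Longrightarrow> X \<in> Ob \<C>" "v \<in> elt \<C> F X Y \<Longrightarrow> Y \<in> Ob \<C>"
    "v \<in> elt \<C> F X Y \<Longrightarrow> v \<in> carrier (val F X Y)"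
  by (auto simp: elt_def)

lemma eltI: "\<lbrakk>X \<in> Ob \<C>; Y \<in> Ob \<C>; v \<in> carrier (val F X Y)\<rbrakk> \<Longrightarrow> v \<in> elt \<C> F X Y"
  by (auto simp: elt_def)

context bilinear_functor
begin

lemma pull_closed: "f \<in> arr \<C> X' X \<Longrightarrow> v \<in> elt \<C> F X Y \<Longrightarrow> pull F f Y v \<in> elt \<C> F X' Y"
  using linear_map_closed[OF pull_linear] by (auto simp: elt_def arr_def)

lemma push_closed: "g \<in> arr \<C> Y Y' \<Longrightarrow> v \<in> elt \<C> F X Y \<Longrightarrow> push F X g v \<in> elt \<C> F X Y'"
  using linear_map_closed[OF push_linear] by (auto simp: elt_def arr_def)

lemma zero_elt: "X \<in> Ob \<C> \<Longrightarrow> Y \<in> Ob \<C> \<Longrightarrow> \<zero>\<^bsub>val F X Y\<^esub> \<in> elt \<C> F X Y"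
  using val_module[of X Y]
  by (simp add: elt_def module_def abelian_group_def abelian_monoid.zero_closed)

lemma add_closed:
  "u \<in> elt \<C> F X Y \<Longrightarrow> v \<in> elt \<C> F X Y \<Longrightarrow> u \<oplus>\<^bsub>val F X Y\<^esub> v \<in> elt \<C> F X Y"
  using val_module[of X Y]
  by (auto simp: elt_def module_def abelian_group_def intro: abelian_monoid.a_closed)

lemma smult_closed:
  "r \<in> carrier R \<Longrightarrow> v \<in> elt \<C> F X Y \<Longrightarrow> r \<odot>\<^bsub>val F X Y\<^esub> v \<in> elt \<C> F X Y"
  using val_module[of X Y] by (auto simp: elt_def intro: module.smult_closed)

lemma push_sum:
  "\<lbrakk>g \<in> arr \<C> Y Y'; u \<in> elt \<C> F X Y; v \<in> elt \<C> F X Y\<rbrakk>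
    \<Longrightarrow> push F X g (u \<oplus>\<^bsub>val F X Y\<^esub> v) = push F X g u \<oplus>\<^bsub>val F X Y'\<^esub> push F X g v"
  by (meson eltD linear_map_add push_linear)

lemma pull_scale:
  "\<lbrakk>f \<in> arr \<C> X' X; r \<in> carrier R; v \<in> elt \<C> F X Y\<rbrakk>
    \<Longrightarrow> pull F f Y (r \<odot>\<^bsub>val F X Y\<^esub> v) = r \<odot>\<^bsub>val F X' Y\<^esub> pull F f Y v"
  by (meson eltD linear_map_smult pull_linear)

lemma bilinear_functor_transport:
  assumes i: "inj i"
  shows "bilinear_functor R \<C> (transport i F)"
proof (rule bilinear_functor.intro[OF linear_category_axioms], rule bilinear_functor_axioms.intro)
  fix X Y assume "X \<in> Ob \<C>" "Y \<in> Ob \<C>"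
  then show "module R (val (transport i F) X Y)"
    by (simp add: i module_transport val_module)
next
  fix f X' X Y assume "f \<in> arr \<C> X' X" "Y \<in> Ob \<C>"
  then show "linear_map R (val (transport i F) X Y) (val (transport i F) X' Y) (pull (transport i F) f Y)"
    using i by (auto intro!: linear_map_between_transports[OF i pull_linear] val_module dest: arrD)
next
  fix g Y Y' X assume "g \<in> arr \<C> Y Y'" "X \<in> Ob \<C>"
  then show "linear_map R (val (transport i F) X Y) (val (transport i F) X Y') (push (transport i F) X g)"
    using i by (auto intro!: linear_map_between_transports[OF i push_linear] val_module dest: arrD)
qed (auto simp: elt_transport i pull_Idn push_Idn pull_cmp push_cmp pull_push pull_add pull_smult
       push_add push_smult)

end

lemma (in linear_category) bilinear_hom_functor: "bilinear_functor R \<C> (hom_functor \<C>)"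
proof (rule bilinear_functor.intro[OF linear_category_axioms], rule bilinear_functor_axioms.intro)
  fix v v' f X' X Y
  assume "v \<in> arr \<C> X' X" "v' \<in> arr \<C> X' X" "f \<in> elt \<C> (hom_functor \<C>) X Y"
  then show "pull (hom_functor \<C>) (v \<oplus>\<^bsub>Hom \<C> X' X\<^esub> v') Y f =
      pull (hom_functor \<C>) v Y f \<oplus>\<^bsub>val (hom_functor \<C>) X' Y\<^esub> pull (hom_functor \<C>) v' Y f"
    using linear_map_add[OF cmp_linear_right] by (auto simp: hom_functor_def elt_def arr_def)
next
  fix r v f X' X Y
  assume "r \<in> carrier R" "v \<in> arr \<C> X' X" "f \<in> elt \<C> (hom_functor \<C>) X Y"
  then show "pull (hom_functor \<C>) (r \<odot>\<^bsub>Hom \<C> X' X\<^esub> v) Y f =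
      r \<odot>\<^bsub>val (hom_functor \<C>) X' Y\<^esub> pull (hom_functor \<C>) v Y f"
    using linear_map_smult[OF cmp_linear_right] by (auto simp: hom_functor_def elt_def arr_def)
next
  fix v v' f X Y Y'
  assume "v \<in> arr \<C> Y Y'" "v' \<in> arr \<C> Y Y'" "f \<in> elt \<C> (hom_functor \<C>) X Y"
  then show "push (hom_functor \<C>) X (v \<oplus>\<^bsub>Hom \<C> Y Y'\<^esub> v') f =
      push (hom_functor \<C>) X v f \<oplus>\<^bsub>val (hom_functor \<C>) X Y'\<^esub> push (hom_functor \<C>) X v' f"
    using linear_map_add[OF cmp_linear_left] by (auto simp: hom_functor_def elt_def arr_def)
next
  fix r v f X Y Y'
  assume "r \<in> carrier R" "v \<in> arr \<C> Y Y'" "f \<in> elt \<C> (hom_functor \<C>) X Y"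
  then show "push (hom_functor \<C>) X (r \<odot>\<^bsub>Hom \<C> Y Y'\<^esub> v) f =
      r \<odot>\<^bsub>val (hom_functor \<C>) X Y'\<^esub> push (hom_functor \<C>) X v f"
    using linear_map_smult[OF cmp_linear_left] by (auto simp: hom_functor_def elt_def arr_def)
qed (auto simp: hom_functor_def elt_def arr_def Hom_module cmp_linear_right cmp_linear_left
       intro!: cmp_Idn_left cmp_Idn_right cmp_assoc cmp_assoc[symmetric])


section \<open>The coend of two bilinear functors\<close>

locale tensor_functors = G: bilinear_functor R \<C> G + E: bilinear_functor R \<C> \<E>
  for R :: "'r ring" and \<C> :: "('r, 'o, 'm) lincat" (structure)
    and G :: "('r, 'o, 'm, ('o, 'm, 'e) pext) bifun" and \<E> :: "('r, 'o, 'm, 'e) bifun"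
begin

abbreviation "tms X Y \<equiv> coend_terms \<C> G \<E> X Y"
abbreviation "ceq X Y \<equiv> coend_eq R \<C> G \<E> X Y"
abbreviation "cls X Y \<equiv> coend_class R \<C> G \<E> X Y"
abbreviation "T \<equiv> coend R \<C> G \<E>"

lemma tms_iff: "(M, \<rho>, \<tau>) \<in> tms X Y \<longleftrightarrow> \<rho> \<in> elt \<C> G M Y \<and> \<tau> \<in> elt \<C> \<E> X M"
  by (simp add: coend_terms_def)

lemma map_lists:
  assumes "l \<in> lists (tms X Y)"
    and h: "\<And>M \<rho> \<tau>. \<rho> \<in> elt \<C> G M Y \<Longrightarrow> \<tau> \<in> elt \<C> \<E> X M \<Longrightarrow> h (M, \<rho>, \<tau>) \<in> S"
  shows "map h l \<in> lists S"
  using assms(1) by (induction l) (auto simp: coend_terms_def h)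

lemma smult_lists:
  "r \<in> carrier R \<Longrightarrow> l \<in> lists (tms X Y) \<Longrightarrow>
    map (\<lambda>(M, \<rho>, \<tau>). (M, r \<odot>\<^bsub>val G M Y\<^esub> \<rho>, \<tau>)) l \<in> lists (tms X Y)"
  by (rule map_lists) (auto simp: tms_iff intro: G.smult_closed)

lemma ceq_lists: "ceq X Y l k \<Longrightarrow> l \<in> lists (tms X Y) \<and> k \<in> lists (tms X Y)"
proof (induction rule: coend_eq.induct)
  case (coend_zero \<tau> M)
  then show ?case by (auto simp: tms_iff dest: eltD intro: G.zero_elt)
next
  case (coend_dinatural f M M' \<rho> \<tau>)
  then show ?case by (auto simp: tms_iff intro: G.pull_closed E.push_closed)
qed (auto simp: tms_iff intro: G.add_closed E.add_closed G.smult_closed E.smult_closed)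

lemma cls_eqI: "ceq X Y l k \<Longrightarrow> cls X Y l = cls X Y k"
proof -
  assume "ceq X Y l k"
  then have "ceq X Y l = ceq X Y k"
    by (blast intro: coend_sym coend_trans)
  then show ?thesis by (simp add: coend_class_def)
qed

lemma ceq_representative: "l \<in> lists (tms X Y) \<Longrightarrow> ceq X Y l (terms_of (cls X Y l))"
  by (auto simp: coend_class_def intro: someI coend_refl)

lemma terms_of_cls: "l \<in> lists (tms X Y) \<Longrightarrow> terms_of (cls X Y l) \<in> lists (tms X Y)"
  using ceq_lists[OF ceq_representative] by blast

lemma coend_carrier: "carrier (val T X Y) = cls X Y ` lists (tms X Y)"
  by (simp add: coend_def)

lemma coend_zero_cls: "\<zero>\<^bsub>val T X Y\<^esub> = cls X Y []"
  by (simp add: coend_def)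

lemma coend_add_cls:
  assumes "l \<in> lists (tms X Y)" "k \<in> lists (tms X Y)"
  shows "cls X Y l \<oplus>\<^bsub>val T X Y\<^esub> cls X Y k = cls X Y (l @ k)"
proof -
  have "ceq X Y (terms_of (cls X Y l) @ terms_of (cls X Y k)) (l @ k)"
    using assms by (intro coend_append coend_sym[OF ceq_representative])
  then show ?thesis by (simp add: coend_def cls_eqI)
qed

text \<open>
  Scalar multiplication acts on representatives; this is why it is well defined on classes.
\<close>

lemma ceq_smult:
  assumes r: "r \<in> carrier R" and "ceq X Y l k"
  shows "ceq X Y (map (\<lambda>(M, \<rho>, \<tau>). (M, r \<odot>\<^bsub>val G M Y\<^esub> \<rho>, \<tau>)) l) (map (\<lambda>(M, \<rho>, \<tau>). (M, r \<odot>\<^bsub>val G M Y\<^esub> \<rho>, \<tau>)) k)"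
    (is "ceq X Y (map ?h l) (map ?h k)")
  using assms(2)
proof (induction rule: coend_eq.induct)
  case (coend_refl l)
  with r show ?case
    by (intro coend_eq.coend_refl smult_lists)
next
  case (coend_commute l k)
  with r have "ceq X Y (map ?h l @ map ?h k) (map ?h k @ map ?h l)"
    by (intro coend_eq.coend_commute smult_lists)
  then show ?case by simp
next
  case (coend_zero \<tau> M)
  then interpret M: module R "val G M Y" by (auto dest: eltD intro: G.val_module)
  from coend_zero r show ?case by (auto intro: coend_eq.coend_zero)
next
  case (coend_add_left \<rho> M \<rho>' \<tau>)
  then interpret M: module R "val G M Y" by (auto dest: eltD intro: G.val_module)
  have "r \<odot>\<^bsub>val G M Y\<^esub> (\<rho> \<oplus>\<^bsub>val G M Y\<^esub> \<rho>') = r \<odot>\<^bsub>val G M Y\<^esub> \<rho> \<oplus>\<^bsub>val G M Y\<^esub> r \<odot>\<^bsub>val G M Y\<^esub> \<rho>'"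
    by (intro M.smult_r_distr r eltD(3)[OF coend_add_left(1)] eltD(3)[OF coend_add_left(2)])
  with coend_add_left r show ?case
    by (auto intro: coend_eq.coend_add_left G.smult_closed)
next
  case (coend_add_right \<rho> M \<tau> \<tau>')
  with r show ?case by (auto intro: coend_eq.coend_add_right G.smult_closed)
next
  case (coend_smult r' \<rho> M \<tau>)
  then interpret M: module R "val G M Y" by (auto dest: eltD intro: G.val_module)
  have "r \<odot>\<^bsub>val G M Y\<^esub> (r' \<odot>\<^bsub>val G M Y\<^esub> \<rho>) = r' \<odot>\<^bsub>val G M Y\<^esub> (r \<odot>\<^bsub>val G M Y\<^esub> \<rho>)"
    using coend_smult r by (metis M.m_comm M.smult_assoc1 eltD(3))
  with coend_smult r show ?case
    by (auto intro: coend_eq.coend_smult G.smult_closed)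
next
  case (coend_dinatural f M M' \<rho> \<tau>)
  with r show ?case
    by (auto simp: G.pull_scale[symmetric] intro: coend_eq.coend_dinatural G.smult_closed)
qed (auto intro: coend_eq.coend_sym coend_eq.coend_trans coend_eq.coend_append)

lemma coend_smult_cls:
  assumes "r \<in> carrier R" "l \<in> lists (tms X Y)"
  shows "r \<odot>\<^bsub>val T X Y\<^esub> cls X Y l = cls X Y (map (\<lambda>(M, \<rho>, \<tau>). (M, r \<odot>\<^bsub>val G M Y\<^esub> \<rho>, \<tau>)) l)"
  using cls_eqI[OF ceq_smult[OF assms(1) coend_sym[OF ceq_representative[OF assms(2)]]]]
  by (simp add: coend_def)

lemma module_coend:
  assumes Y: "Y \<in> Ob \<C>"
  shows "module R (val T X Y)"
proof (intro moduleI abelian_groupI)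
  note cc = coend_carrier coend_zero_cls
  show "cring R" by (rule G.R_cring)
  interpret R: cring R by (rule G.R_cring)
  fix u assume "u \<in> carrier (val T X Y)"
  then obtain l where l: "l \<in> lists (tms X Y)" "u = cls X Y l"
    by (auto simp: cc)
  have elts: "\<rho> \<in> elt \<C> G M Y" if "(M, \<rho>, \<tau>) \<in> set l" for M \<rho> \<tau>
    using l that tms_iff by blast
  define sm where "sm r = map (\<lambda>(M, \<rho>, \<tau>). (M, r \<odot>\<^bsub>val G M Y\<^esub> \<rho>, \<tau> :: 'e))" for r
  have sm: "sm r k \<in> lists (tms X Y)" if "r \<in> carrier R" "k \<in> lists (tms X Y)" for r k
    unfolding sm_def using that by (rule smult_lists)
  have smc: "r \<odot>\<^bsub>val T X Y\<^esub> cls X Y k = cls X Y (sm r k)"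
    if "r \<in> carrier R" "k \<in> lists (tms X Y)" for r k
    using coend_smult_cls[OF that] by (simp add: sm_def)
  have mod: "module R (val G M Y)" if "\<rho> \<in> elt \<C> G M Y" for M \<rho>
    using that by (auto dest: eltD intro: G.val_module)
  show "\<zero>\<^bsub>val T X Y\<^esub> \<oplus>\<^bsub>val T X Y\<^esub> u = u"
    using l by (simp add: coend_zero_cls coend_add_cls)
  \<comment> \<open>The classes of \<open>(-\<rho>) \<otimes> \<tau>\<close> and \<open>\<rho> \<otimes> \<tau>\<close> are inverse to each other; commuting the
    summands past each other, the inverses of all terms of \<open>l\<close> add up to an inverse of \<open>l\<close>.\<close>
  have "ceq X Y (map (\<lambda>(M, \<rho>, \<tau>). (M, \<ominus>\<^bsub>val G M Y\<^esub> \<rho>, \<tau>)) k @ k) [] \<and>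
      map (\<lambda>(M, \<rho>, \<tau>). (M, \<ominus>\<^bsub>val G M Y\<^esub> \<rho>, \<tau>)) k \<in> lists (tms X Y)"
    if "k \<in> lists (tms X Y)" for k
    using that
  proof (induction k)
    case Nil
    show ?case by (auto intro: coend_refl)
  next
    case (Cons t k)
    obtain M \<rho> \<tau> where t: "t = (M, \<rho>, \<tau>)" by (cases t)
    with Cons have el: "\<rho> \<in> elt \<C> G M Y" "\<tau> \<in> elt \<C> \<E> X M" by (auto simp: tms_iff)
    interpret M: module R "val G M Y" using el by (intro mod)
    have neg: "\<ominus>\<^bsub>val G M Y\<^esub> \<rho> \<in> elt \<C> G M Y" using el by (auto simp: elt_def)
    let ?n = "map (\<lambda>(M, \<rho>, \<tau>). (M, \<ominus>\<^bsub>val G M Y\<^esub> \<rho>, \<tau>)) k"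
    let ?a = "[(M, \<ominus>\<^bsub>val G M Y\<^esub> \<rho>, \<tau>)]" and ?b = "[(M, \<rho>, \<tau>)]"
    have IH: "ceq X Y (?n @ k) []" "?n \<in> lists (tms X Y)" using Cons by auto
    have k: "k \<in> lists (tms X Y)" using Cons by auto
    have ab: "?a \<in> lists (tms X Y)" "?b \<in> lists (tms X Y)" using el neg by (auto simp: tms_iff)
    have "ceq X Y [(M, \<ominus>\<^bsub>val G M Y\<^esub> \<rho> \<oplus>\<^bsub>val G M Y\<^esub> \<rho>, \<tau>)] (?a @ ?b)"
      using coend_add_left[OF neg el] by simp
    then have 1: "ceq X Y (?a @ ?b) []"
      using el coend_trans[OF coend_sym coend_eq.coend_zero[OF el(2) Y]] by (simp add: M.l_neg elt_def)
    have "ceq X Y (?a @ (?n @ ?b) @ k) (?a @ (?b @ ?n) @ k)"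
      using ab IH(2) k by (intro coend_append coend_refl coend_commute) auto
    moreover have "ceq X Y ((?a @ ?b) @ (?n @ k)) ([] @ [])"
      by (intro coend_append 1 IH)
    ultimately have "ceq X Y (?a @ (?n @ ?b) @ k) []"
      by (auto intro: coend_trans)
    then show ?case using IH(2) ab t by auto
  qed
  from this[OF l(1)] obtain k where "k \<in> lists (tms X Y)" "ceq X Y (k @ l) []"
    by blast
  then have "cls X Y k \<in> carrier (val T X Y)" "cls X Y k \<oplus>\<^bsub>val T X Y\<^esub> u = \<zero>\<^bsub>val T X Y\<^esub>"
    using l by (auto simp: cc coend_add_cls simp del: in_lists_conv_set intro: cls_eqI)
  then show "\<exists>v\<in>carrier (val T X Y). v \<oplus>\<^bsub>val T X Y\<^esub> u = \<zero>\<^bsub>val T X Y\<^esub>" by blast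
  show "\<one>\<^bsub>R\<^esub> \<odot>\<^bsub>val T X Y\<^esub> u = u"
  proof -
    have "sm \<one>\<^bsub>R\<^esub> l = l"
      unfolding sm_def by (intro map_idI) (auto dest!: elts simp: module.smult_one[OF mod] eltD(3))
    then show ?thesis using smc[OF R.one_closed l(1)] l by simp
  qed
  {
    fix r assume r: "r \<in> carrier R"
    then show "r \<odot>\<^bsub>val T X Y\<^esub> u \<in> carrier (val T X Y)"
      using l sm[OF r l(1)] by (auto simp: smc cc)
    fix v assume "v \<in> carrier (val T X Y)"
    then obtain k where k: "k \<in> lists (tms X Y)" "v = cls X Y k"
      by (auto simp: cc)
    show "r \<odot>\<^bsub>val T X Y\<^esub> (u \<oplus>\<^bsub>val T X Y\<^esub> v) = r \<odot>\<^bsub>val T X Y\<^esub> u \<oplus>\<^bsub>val T X Y\<^esub> r \<odot>\<^bsub>val T X Y\<^esub> v"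
      using l k r sm[OF r l(1)] sm[OF r k(1)] by (simp add: coend_add_cls smc) (simp add: sm_def)
  }
  {
    fix r r' assume r: "r \<in> carrier R" "r' \<in> carrier R"
    show "(r \<otimes>\<^bsub>R\<^esub> r') \<odot>\<^bsub>val T X Y\<^esub> u = r \<odot>\<^bsub>val T X Y\<^esub> (r' \<odot>\<^bsub>val T X Y\<^esub> u)"
    proof -
      have "sm (r \<otimes>\<^bsub>R\<^esub> r') l = sm r (sm r' l)"
        unfolding sm_def map_map using r
        by (intro map_cong refl) (auto dest!: elts simp: module.smult_assoc1[OF mod] eltD(3))
      then show ?thesis using l r sm by (simp add: smc)
    qed
    have "ceq X Y (sm (r \<oplus>\<^bsub>R\<^esub> r') l) (sm r l @ sm r' l)"
      using l(1)
    proof (induction l)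
      case Nil
      then show ?case by (auto simp: sm_def intro: coend_refl)
    next
      case (Cons t k)
      obtain M \<rho> \<tau> where t: "t = (M, \<rho>, \<tau>)" by (cases t)
      with Cons have el: "\<rho> \<in> elt \<C> G M Y" "\<tau> \<in> elt \<C> \<E> X M" and k: "k \<in> lists (tms X Y)"
        by (auto simp: tms_iff)
      have 1: "ceq X Y (sm (r \<oplus>\<^bsub>R\<^esub> r') [t]) (sm r [t] @ sm r' [t])"
        using coend_add_left[of "r \<odot>\<^bsub>val G M Y\<^esub> \<rho>" \<C> G M Y "r' \<odot>\<^bsub>val G M Y\<^esub> \<rho>" \<tau> \<E> X R] el r
        by (auto simp: t sm_def module.smult_l_distr[OF mod[OF el(1)]] G.smult_closed dest: eltD)
      have t': "[t] \<in> lists (tms X Y)" using t el by (auto simp: tms_iff)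
      have "ceq X Y (sm (r \<oplus>\<^bsub>R\<^esub> r') [t] @ sm (r \<oplus>\<^bsub>R\<^esub> r') k) ((sm r [t] @ sm r' [t]) @ (sm r k @ sm r' k))"
        by (intro coend_append 1 Cons.IH k)
      moreover have "ceq X Y (sm r [t] @ (sm r' [t] @ sm r k) @ sm r' k) (sm r [t] @ (sm r k @ sm r' [t]) @ sm r' k)"
        by (intro coend_append coend_refl coend_commute sm k t' r)
      ultimately have "ceq X Y (sm (r \<oplus>\<^bsub>R\<^esub> r') [t] @ sm (r \<oplus>\<^bsub>R\<^esub> r') k) ((sm r [t] @ sm r k) @ (sm r' [t] @ sm r' k))"
        by (auto intro: coend_trans)
      then show ?case by (simp add: sm_def)
    qed
    then show "(r \<oplus>\<^bsub>R\<^esub> r') \<odot>\<^bsub>val T X Y\<^esub> u = r \<odot>\<^bsub>val T X Y\<^esub> u \<oplus>\<^bsub>val T X Y\<^esub> r' \<odot>\<^bsub>val T X Y\<^esub> u"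
      using l r sm by (simp add: smc coend_add_cls cls_eqI)
  }
  fix v assume "v \<in> carrier (val T X Y)"
  then obtain k where k: "k \<in> lists (tms X Y)" "v = cls X Y k"
    by (auto simp: cc)
  show "u \<oplus>\<^bsub>val T X Y\<^esub> v \<in> carrier (val T X Y)"
    using l k by (auto simp: coend_add_cls cc)
  show "u \<oplus>\<^bsub>val T X Y\<^esub> v = v \<oplus>\<^bsub>val T X Y\<^esub> u"
    using l k by (auto simp: coend_add_cls intro!: cls_eqI coend_commute)
  fix w assume "w \<in> carrier (val T X Y)"
  then obtain m where m: "m \<in> lists (tms X Y)" "w = cls X Y m"
    by (auto simp: cc)
  show "(u \<oplus>\<^bsub>val T X Y\<^esub> v) \<oplus>\<^bsub>val T X Y\<^esub> w = u \<oplus>\<^bsub>val T X Y\<^esub> (v \<oplus>\<^bsub>val T X Y\<^esub> w)"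
    using l k m by (simp add: coend_add_cls)
next
  show "\<zero>\<^bsub>val T X Y\<^esub> \<in> carrier (val T X Y)"
    by (auto simp: coend_zero_cls coend_carrier)
qed

end


text \<open>The families \<open>\<beta>\<close> that factor through the coend at \<open>(X, Y)\<close>.\<close>

definition balanced ::
    "'r ring \<Rightarrow> ('r, 'o, 'm) lincat \<Rightarrow> ('r, 'o, 'm, 'v) bifun \<Rightarrow> ('r, 'o, 'm, 'e) bifun \<Rightarrow>
     'o \<Rightarrow> 'o \<Rightarrow> ('r, 'n) module \<Rightarrow> ('o \<Rightarrow> 'v \<Rightarrow> 'e \<Rightarrow> 'n) \<Rightarrow> bool" where
  "balanced R \<C> G \<E> X Y N \<beta> \<longleftrightarrow>
     (\<forall>M \<tau>. \<tau> \<in> elt \<C> \<E> X M \<longrightarrow> linear_map R (val G M Y) N (\<lambda>\<rho>. \<beta> M \<rho> \<tau>)) \<and>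
     (\<forall>M \<rho>. \<rho> \<in> elt \<C> G M Y \<longrightarrow> linear_map R (val \<E> X M) N (\<beta> M \<rho>)) \<and>
     (\<forall>f M M' \<rho> \<tau>. f \<in> arr \<C> M M' \<longrightarrow> \<rho> \<in> elt \<C> G M' Y \<longrightarrow> \<tau> \<in> elt \<C> \<E> X M \<longrightarrow>
        \<beta> M (pull G f Y \<rho>) \<tau> = \<beta> M' \<rho> (push \<E> X f \<tau>))"

lemma balancedI:
  assumes "\<And>M \<tau>. \<tau> \<in> elt \<C> \<E> X M \<Longrightarrow> linear_map R (val G M Y) N (\<lambda>\<rho>. \<beta> M \<rho> \<tau>)"
    and "\<And>M \<rho>. \<rho> \<in> elt \<C> G M Y \<Longrightarrow> linear_map R (val \<E> X M) N (\<beta> M \<rho>)"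
    and "\<And>f M M' \<rho> \<tau>. \<lbrakk>f \<in> arr \<C> M M'; \<rho> \<in> elt \<C> G M' Y; \<tau> \<in> elt \<C> \<E> X M\<rbrakk>
      \<Longrightarrow> \<beta> M (pull G f Y \<rho>) \<tau> = \<beta> M' \<rho> (push \<E> X f \<tau>)"
  shows "balanced R \<C> G \<E> X Y N \<beta>"
  using assms by (simp add: balanced_def)

lemma balancedD:
  assumes "balanced R \<C> G \<E> X Y N \<beta>"
  shows balanced_left: "\<tau> \<in> elt \<C> \<E> X M \<Longrightarrow> linear_map R (val G M Y) N (\<lambda>\<rho>. \<beta> M \<rho> \<tau>)"
    and balanced_right: "\<rho> \<in> elt \<C> G M Y \<Longrightarrow> linear_map R (val \<E> X M) N (\<beta> M \<rho>)"
    and balanced_dinatural: "\<lbrakk>f \<in> arr \<C> M M'; \<rho> \<in> elt \<C> G M' Y; \<tau> \<in> elt \<C> \<E> X M\<rbrakk>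
      \<Longrightarrow> \<beta> M (pull G f Y \<rho>) \<tau> = \<beta> M' \<rho> (push \<E> X f \<tau>)"
  using assms by (simp_all add: balanced_def)

definition coend_lift ::
    "('r, 'n) module \<Rightarrow> ('o \<Rightarrow> ('o, 'm, 'e) pext \<Rightarrow> 'e \<Rightarrow> 'n) \<Rightarrow> ('o, 'm, 'e) pext \<Rightarrow> 'n" where
  "coend_lift N \<beta> u = lsum N (map (\<lambda>(M, \<rho>, \<tau>). \<beta> M \<rho> \<tau>) (terms_of u))"

context tensor_functors
begin

text \<open>
  The universal property of the coend rests on this: every generating relation of the congruence is
  one of the conditions of a balanced family.
\<close>

lemma ceq_lsum:
  assumes N: "module R N" and \<beta>: "balanced R \<C> G \<E> X Y N \<beta>" and "ceq X Y l k"
  shows "lsum N (map (\<lambda>(M, \<rho>, \<tau>). \<beta> M \<rho> \<tau>) l) = lsum N (map (\<lambda>(M, \<rho>, \<tau>). \<beta> M \<rho> \<tau>) k)"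
    (is "lsum N (map ?b l) = lsum N (map ?b k)")
proof -
  interpret N: module R N by fact
  have cl: "\<beta> M \<rho> \<tau> \<in> carrier N" if "\<rho> \<in> elt \<C> G M Y" "\<tau> \<in> elt \<C> \<E> X M" for M \<rho> \<tau>
    using linear_map_closed[OF balanced_left[OF \<beta>]] that by (simp add: elt_def)
  have cls: "set (map ?b l) \<subseteq> carrier N" if "l \<in> lists (tms X Y)" for l
    using map_lists[OF that, of ?b "carrier N"] cl by auto
  show ?thesis
    using assms(3)
  proof (induction rule: coend_eq.induct)
    case (coend_append l l' k k')
    then have "l \<in> lists (tms X Y)" "k \<in> lists (tms X Y)" "l' \<in> lists (tms X Y)"
      "k' \<in> lists (tms X Y)" using ceq_lists by blast+
    then show ?case
      using coend_append.IH unfolding map_append by (simp only: lsum_append[OF N cls cls])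
  next
    case (coend_commute l k)
    then show ?case
      using lsum_closed[OF N] cls unfolding map_append
      by (simp only: lsum_append[OF N cls cls]) (meson N.a_comm)
  next
    case (coend_zero \<tau> M)
    then show ?case
      using linear_map_zero[OF balanced_left[OF \<beta> coend_zero(1)] G.val_module N]
      by (auto dest: eltD)
  next
    case (coend_add_left \<rho> M \<rho>' \<tau>)
    then show ?case
      using linear_map_add[OF balanced_left[OF \<beta>]] cl by (auto simp: eltD(3))
  next
    case (coend_add_right \<rho> M \<tau> \<tau>')
    then show ?case
      using linear_map_add[OF balanced_right[OF \<beta>]] cl by (auto simp: eltD(3))
  next
    case (coend_smult r \<rho> M \<tau>)
    then show ?case
      using linear_map_smult[OF balanced_left[OF \<beta>]] linear_map_smult[OF balanced_right[OF \<beta>]]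
      by (auto simp: eltD(3))
  next
    case (coend_dinatural f M M' \<rho> \<tau>)
    then show ?case
      using balanced_dinatural[OF \<beta>] by auto
  qed auto
qed

lemma coend_lift_cls:
  assumes "module R N" "balanced R \<C> G \<E> X Y N \<beta>" "l \<in> lists (tms X Y)"
  shows "coend_lift N \<beta> (cls X Y l) = lsum N (map (\<lambda>(M, \<rho>, \<tau>). \<beta> M \<rho> \<tau>) l)"
  unfolding coend_lift_def
  by (rule ceq_lsum[OF assms(1,2) coend_sym[OF ceq_representative[OF assms(3)]]])

lemma balanced_closed:
  assumes "balanced R \<C> G \<E> X Y N \<beta>" "\<rho> \<in> elt \<C> G M Y" "\<tau> \<in> elt \<C> \<E> X M"
  shows "\<beta> M \<rho> \<tau> \<in> carrier N"
  using linear_map_closed[OF balanced_left[OF assms(1,3)] eltD(3)[OF assms(2)]] .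

lemma coend_lift_generator:
  assumes N: "module R N" and \<beta>: "balanced R \<C> G \<E> X Y N \<beta>"
    and el: "\<rho> \<in> elt \<C> G M Y" "\<tau> \<in> elt \<C> \<E> X M"
  shows "coend_lift N \<beta> (cls X Y [(M, \<rho>, \<tau>)]) = \<beta> M \<rho> \<tau>"
proof -
  interpret N: module R N by fact
  show ?thesis
    using el balanced_closed[OF \<beta> el] by (subst coend_lift_cls[OF N \<beta>]) (auto simp: tms_iff)
qed

lemma coend_lift_linear:
  assumes N: "module R N" and \<beta>: "balanced R \<C> G \<E> X Y N \<beta>"
  shows "linear_map R (val T X Y) N (coend_lift N \<beta>)"
proof -
  interpret N: module R N by fact
  let ?b = "\<lambda>(M, \<rho>, \<tau>). \<beta> M \<rho> \<tau>"
  have sub: "set (map ?b l) \<subseteq> carrier N" if "l \<in> lists (tms X Y)" for l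
    using map_lists[OF that, of ?b "carrier N"] balanced_closed[OF \<beta>] by auto
  note lift = coend_lift_cls[OF N \<beta>]
  show ?thesis
  proof (rule linear_mapI)
    fix u assume "u \<in> carrier (val T X Y)"
    then obtain l where l: "l \<in> lists (tms X Y)" "u = cls X Y l"
      by (auto simp: coend_carrier)
    show "coend_lift N \<beta> u \<in> carrier N"
      using lsum_closed[OF N sub[OF l(1)]] by (simp only: l(2) lift[OF l(1)])
    {
      fix v assume "v \<in> carrier (val T X Y)"
      then obtain k where k: "k \<in> lists (tms X Y)" "v = cls X Y k"
        by (auto simp: coend_carrier)
      have "coend_lift N \<beta> (cls X Y (l @ k)) = lsum N (map ?b l @ map ?b k)"
        unfolding map_append[symmetric] using l k by (intro lift) auto
      then show "coend_lift N \<beta> (u \<oplus>\<^bsub>val T X Y\<^esub> v) = coend_lift N \<beta> u \<oplus>\<^bsub>N\<^esub> coend_lift N \<beta> v"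
        by (simp only: l(2) k(2) coend_add_cls[OF l(1) k(1)] lsum_append[OF N sub sub] lift l(1) k(1))
    }
    fix r assume r: "r \<in> carrier R"
    have "lsum N (map ?b (map (\<lambda>(M, \<rho>, \<tau>). (M, r \<odot>\<^bsub>val G M Y\<^esub> \<rho>, \<tau>)) l)) = r \<odot>\<^bsub>N\<^esub> lsum N (map ?b l)"
      using l(1)
    proof (induction l)
      case (Cons t l)
      obtain M \<rho> \<tau> where t: "t = (M, \<rho>, \<tau>)" by (cases t)
      with Cons have el: "\<rho> \<in> elt \<C> G M Y" "\<tau> \<in> elt \<C> \<E> X M" and l: "l \<in> lists (tms X Y)"
        by (auto simp: tms_iff)
      show ?case
        using Cons.IH linear_map_smult[OF balanced_left[OF \<beta> el(2)] r eltD(3)[OF el(1)]]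
          balanced_closed[OF \<beta> el] lsum_closed[OF N sub[OF l]] r
        by (simp add: t N.smult_r_distr)
    qed (simp add: r)
    then show "coend_lift N \<beta> (r \<odot>\<^bsub>val T X Y\<^esub> u) = r \<odot>\<^bsub>N\<^esub> coend_lift N \<beta> u"
      by (simp only: l(2) coend_smult_cls[OF r l(1)] lift l(1) smult_lists[OF r l(1)])
  qed
qed

lemma cls_closed: "l \<in> lists (tms X Y) \<Longrightarrow> cls X Y l \<in> carrier (val T X Y)"
  by (auto simp: coend_carrier)

lemma generator_closed:
  "\<rho> \<in> elt \<C> G M Y \<Longrightarrow> \<tau> \<in> elt \<C> \<E> X M \<Longrightarrow> cls X Y [(M, \<rho>, \<tau>)] \<in> elt \<C> T X Y"
  by (auto simp: tms_iff dest: eltD intro!: eltI cls_closed)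

text \<open>
  Operations that are defined by mapping a function over the terms of a representative thereby become
  instances of \<open>coend_lift\<close>, which makes them well defined and linear.
\<close>

lemma cls_eq_lsum:
  assumes Y: "Y \<in> Ob \<C>" and "l \<in> lists (tms X Y)"
  shows "cls X Y l = lsum (val T X Y) (map (\<lambda>t. cls X Y [t]) l)"
  using assms(2)
proof (induction l)
  case Nil
  show ?case by (simp add: coend_zero_cls)
next
  case (Cons t l)
  then show ?case
    using coend_add_cls[of "[t]" X Y l] by auto
qed

lemma balanced_generator:
  assumes X: "X \<in> Ob \<C>" and Y: "Y \<in> Ob \<C>"
  shows "balanced R \<C> G \<E> X Y (val T X Y) (\<lambda>M \<rho> \<tau>. cls X Y [(M, \<rho>, \<tau>)])"
proof (rule balancedI)
  fix M \<tau> assume \<tau>: "\<tau> \<in> elt \<C> \<E> X M"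
  then have M: "M \<in> Ob \<C>" by (simp add: eltD)
  show "linear_map R (val G M Y) (val T X Y) (\<lambda>\<rho>. cls X Y [(M, \<rho>, \<tau>)])"
  proof (rule linear_mapI)
    fix u v assume "u \<in> carrier (val G M Y)" "v \<in> carrier (val G M Y)"
    then have "u \<in> elt \<C> G M Y" "v \<in> elt \<C> G M Y" using M Y by (simp_all add: elt_def)
    then show "cls X Y [(M, u \<oplus>\<^bsub>val G M Y\<^esub> v, \<tau>)] = cls X Y [(M, u, \<tau>)] \<oplus>\<^bsub>val T X Y\<^esub> cls X Y [(M, v, \<tau>)]"
      using \<tau> by (subst coend_add_cls) (auto simp: tms_iff intro!: cls_eqI coend_add_left)
  next
    fix u r assume "u \<in> carrier (val G M Y)" "r \<in> carrier R"
    moreover from this have "u \<in> elt \<C> G M Y" using M Y by (simp_all add: elt_def)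
    ultimately show "cls X Y [(M, r \<odot>\<^bsub>val G M Y\<^esub> u, \<tau>)] = r \<odot>\<^bsub>val T X Y\<^esub> cls X Y [(M, u, \<tau>)]"
      using \<tau> by (subst coend_smult_cls) (auto simp: tms_iff)
  qed (use M Y \<tau> in \<open>auto simp: tms_iff intro!: cls_closed eltI\<close>)
next
  fix M \<rho> assume \<rho>: "\<rho> \<in> elt \<C> G M Y"
  then have M: "M \<in> Ob \<C>" by (simp add: eltD)
  show "linear_map R (val \<E> X M) (val T X Y) (\<lambda>\<tau>. cls X Y [(M, \<rho>, \<tau>)])"
  proof (rule linear_mapI)
    fix u v assume "u \<in> carrier (val \<E> X M)" "v \<in> carrier (val \<E> X M)"
    then have "u \<in> elt \<C> \<E> X M" "v \<in> elt \<C> \<E> X M" using M X by (simp_all add: elt_def)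
    then show "cls X Y [(M, \<rho>, u \<oplus>\<^bsub>val \<E> X M\<^esub> v)] = cls X Y [(M, \<rho>, u)] \<oplus>\<^bsub>val T X Y\<^esub> cls X Y [(M, \<rho>, v)]"
      using \<rho> by (subst coend_add_cls) (auto simp: tms_iff intro!: cls_eqI coend_add_right)
  next
    fix u r assume "u \<in> carrier (val \<E> X M)" "r \<in> carrier R"
    moreover from this have "u \<in> elt \<C> \<E> X M" using M X by (simp_all add: elt_def)
    ultimately show "cls X Y [(M, \<rho>, r \<odot>\<^bsub>val \<E> X M\<^esub> u)] = r \<odot>\<^bsub>val T X Y\<^esub> cls X Y [(M, \<rho>, u)]"
      using \<rho> by (subst coend_smult_cls) (auto simp: tms_iff intro!: cls_eqI coend_sym[OF coend_smult])
  qed (use M X \<rho> in \<open>auto simp: tms_iff intro!: cls_closed eltI\<close>)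
next
  fix f M M' \<rho> \<tau>
  assume "f \<in> arr \<C> M M'" "\<rho> \<in> elt \<C> G M' Y" "\<tau> \<in> elt \<C> \<E> X M"
  then show "cls X Y [(M, pull G f Y \<rho>, \<tau>)] = cls X Y [(M', \<rho>, push \<E> X f \<tau>)]"
    by (intro cls_eqI coend_dinatural)
qed

text \<open>
  The classes of single tensors generate the coend.  All functor laws below compare two linear maps and
  are verified on single tensors.
\<close>

lemma coend_hom_ext:
  assumes f: "linear_map R (val T X Y) N f" and g: "linear_map R (val T X Y) N g"
    and N: "module R N" and Y: "Y \<in> Ob \<C>" and u: "u \<in> carrier (val T X Y)"
    and gen: "\<And>M \<rho> \<tau>. \<rho> \<in> elt \<C> G M Y \<Longrightarrow> \<tau> \<in> elt \<C> \<E> X M \<Longrightarrow>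
      f (cls X Y [(M, \<rho>, \<tau>)]) = g (cls X Y [(M, \<rho>, \<tau>)])"
  shows "f u = g u"
proof -
  obtain l where l: "l \<in> lists (tms X Y)" "u = cls X Y l"
    using u by (auto simp: coend_carrier)
  have "f (cls X Y l) = g (cls X Y l)"
    using l(1)
  proof (induction l)
    case Nil
    show ?case
      using linear_map_zero[OF f module_coend[OF Y] N] linear_map_zero[OF g module_coend[OF Y] N]
      by (simp add: coend_zero_cls)
  next
    case (Cons t l)
    then have l: "[t] \<in> lists (tms X Y)" "l \<in> lists (tms X Y)" by auto
    have "f (cls X Y [t]) = g (cls X Y [t])"
      using l(1) gen by (cases t) (auto simp: tms_iff)
    then show ?case
      using Cons.IH linear_map_add[OF f cls_closed[OF l(1)] cls_closed[OF l(2)]]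
        linear_map_add[OF g cls_closed[OF l(1)] cls_closed[OF l(2)]]
      by (simp add: coend_add_cls[OF l])
  qed
  with l show ?thesis by simp
qed

lemma terms_of_carrier: "u \<in> carrier (val T X Y) \<Longrightarrow> terms_of u \<in> lists (tms X Y)"
  unfolding coend_carrier by (erule imageE) (simp only: terms_of_cls)

lemma coend_pull_lift:
  assumes f: "f \<in> arr \<C> X' X" and Y: "Y \<in> Ob \<C>"
  shows "balanced R \<C> G \<E> X Y (val T X' Y) (\<lambda>M \<rho> \<tau>. cls X' Y [(M, \<rho>, pull \<E> f M \<tau>)])"
    and "u \<in> carrier (val T X Y) \<Longrightarrow>
      pull T f Y u = coend_lift (val T X' Y) (\<lambda>M \<rho> \<tau>. cls X' Y [(M, \<rho>, pull \<E> f M \<tau>)]) u"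
proof -
  note bal = balanced_generator[OF arrD(1)[OF f] Y]
  show "balanced R \<C> G \<E> X Y (val T X' Y) (\<lambda>M \<rho> \<tau>. cls X' Y [(M, \<rho>, pull \<E> f M \<tau>)])"
  proof (rule balancedI)
    fix M \<rho> assume \<rho>: "\<rho> \<in> elt \<C> G M Y"
    show "linear_map R (val \<E> X M) (val T X' Y) (\<lambda>\<tau>. cls X' Y [(M, \<rho>, pull \<E> f M \<tau>)])"
      by (rule linear_map_compose[OF E.pull_linear[OF f] balanced_right[OF bal \<rho>]])
        (use \<rho> in \<open>simp add: eltD\<close>)
  qed (use f bal in \<open>auto simp: E.pull_push intro!: balanced_left[OF bal] balanced_dinatural[OF bal] E.pull_closed\<close>)
  assume "u \<in> carrier (val T X Y)"
  then have "terms_of u \<in> lists (tms X Y)"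
    by (rule terms_of_carrier)
  then have "map (\<lambda>(M, \<rho>, \<tau>). (M, \<rho>, pull \<E> f M \<tau>)) (terms_of u) \<in> lists (tms X' Y)"
    by (rule map_lists) (auto simp: tms_iff intro: E.pull_closed f)
  from cls_eq_lsum[OF Y this]
  show "pull T f Y u = coend_lift (val T X' Y) (\<lambda>M \<rho> \<tau>. cls X' Y [(M, \<rho>, pull \<E> f M \<tau>)]) u"
    using G.Dom_arr[OF f] by (simp add: coend_def coend_lift_def o_def case_prod_unfold)
qed

lemma coend_push_lift:
  assumes g: "g \<in> arr \<C> Y Y'" and X: "X \<in> Ob \<C>"
  shows "balanced R \<C> G \<E> X Y (val T X Y') (\<lambda>M \<rho> \<tau>. cls X Y' [(M, push G M g \<rho>, \<tau>)])"
    and "u \<in> carrier (val T X Y) \<Longrightarrow>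
      push T X g u = coend_lift (val T X Y') (\<lambda>M \<rho> \<tau>. cls X Y' [(M, push G M g \<rho>, \<tau>)]) u"
proof -
  have Y': "Y' \<in> Ob \<C>" using g by (rule arrD)
  note bal = balanced_generator[OF X Y']
  show "balanced R \<C> G \<E> X Y (val T X Y') (\<lambda>M \<rho> \<tau>. cls X Y' [(M, push G M g \<rho>, \<tau>)])"
  proof (rule balancedI)
    fix M \<tau> assume \<tau>: "\<tau> \<in> elt \<C> \<E> X M"
    show "linear_map R (val G M Y) (val T X Y') (\<lambda>\<rho>. cls X Y' [(M, push G M g \<rho>, \<tau>)])"
      by (rule linear_map_compose[OF G.push_linear[OF g] balanced_left[OF bal \<tau>]])
        (use \<tau> in \<open>simp add: eltD\<close>)
  qed (use g bal in \<open>auto simp flip: G.pull_push intro!: balanced_right[OF bal] balanced_dinatural[OF bal] G.push_closed\<close>)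
  assume "u \<in> carrier (val T X Y)"
  then have "terms_of u \<in> lists (tms X Y)"
    by (rule terms_of_carrier)
  then have "map (\<lambda>(M, \<rho>, \<tau>). (M, push G M g \<rho>, \<tau>)) (terms_of u) \<in> lists (tms X Y')"
    by (rule map_lists) (auto simp: tms_iff intro: G.push_closed g)
  from cls_eq_lsum[OF Y' this]
  show "push T X g u = coend_lift (val T X Y') (\<lambda>M \<rho> \<tau>. cls X Y' [(M, push G M g \<rho>, \<tau>)]) u"
    using G.Cod_arr[OF g] by (simp add: coend_def coend_lift_def o_def case_prod_unfold)
qed

lemma coend_pull_linear:
  assumes f: "f \<in> arr \<C> X' X" and Y: "Y \<in> Ob \<C>"
  shows "linear_map R (val T X Y) (val T X' Y) (pull T f Y)"
  using coend_lift_linear[OF module_coend[OF Y] coend_pull_lift(1)[OF f Y]] module_coend[OF Y]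
  by (rule linear_map_cong) (rule coend_pull_lift(2)[OF f Y])

lemma coend_push_linear:
  assumes g: "g \<in> arr \<C> Y Y'" and X: "X \<in> Ob \<C>"
  shows "linear_map R (val T X Y) (val T X Y') (push T X g)"
  using coend_lift_linear[OF module_coend[OF arrD(2)[OF g]] coend_push_lift(1)[OF g X]]
    module_coend[OF arrD(1)[OF g]]
  by (rule linear_map_cong) (rule coend_push_lift(2)[OF g X])

lemma coend_pull_generator:
  assumes "f \<in> arr \<C> X' X" "\<rho> \<in> elt \<C> G M Y" "\<tau> \<in> elt \<C> \<E> X M"
  shows "pull T f Y (cls X Y [(M, \<rho>, \<tau>)]) = cls X' Y [(M, \<rho>, pull \<E> f M \<tau>)]"
  using coend_lift_generator[OF module_coend coend_pull_lift(1)[OF assms(1)] assms(2,3)]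
    coend_pull_lift(2)[OF assms(1) _ eltD(3)[OF generator_closed[OF assms(2,3)]]]
  by (simp add: eltD(2)[OF assms(2)])

lemma coend_push_generator:
  assumes "g \<in> arr \<C> Y Y'" "\<rho> \<in> elt \<C> G M Y" "\<tau> \<in> elt \<C> \<E> X M"
  shows "push T X g (cls X Y [(M, \<rho>, \<tau>)]) = cls X Y' [(M, push G M g \<rho>, \<tau>)]"
  using coend_lift_generator[OF module_coend coend_push_lift(1)[OF assms(1)] assms(2,3)]
    coend_push_lift(2)[OF assms(1) _ eltD(3)[OF generator_closed[OF assms(2,3)]]]
  by (simp add: eltD(1)[OF assms(3)] arrD(2)[OF assms(1)])

lemma bilinear_functor_coend: "bilinear_functor R \<C> T"
proof (rule bilinear_functor.intro[OF G.linear_category_axioms], rule bilinear_functor_axioms.intro)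
  note gen = coend_pull_generator coend_push_generator
  {
    fix v X Y assume v: "v \<in> elt \<C> T X Y"
    note X = eltD(1)[OF v] and Y = eltD(2)[OF v] and vc = eltD(3)[OF v]
    have id: "linear_map R (val T X Y) (val T X Y) (\<lambda>u. u)" by (rule linear_mapI) simp_all
    show "pull T (Idn \<C> X) Y v = v"
      by (rule coend_hom_ext[OF coend_pull_linear[OF G.Idn_arr[OF X] Y] id module_coend[OF Y] Y vc])
        (simp add: gen[OF G.Idn_arr[OF X]] E.pull_Idn)
    show "push T X (Idn \<C> Y) v = v"
      by (rule coend_hom_ext[OF coend_push_linear[OF G.Idn_arr[OF Y] X] id module_coend[OF Y] Y vc])
        (simp add: gen[OF G.Idn_arr[OF Y]] G.push_Idn)
  }
  {
    fix f X' X Y v assume f: "f \<in> arr \<C> X' X" and v: "v \<in> elt \<C> T X Y"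
    note X = eltD(1)[OF v] and Y = eltD(2)[OF v] and vc = eltD(3)[OF v] and X' = arrD(1)[OF f]
    note lin = coend_pull_linear[OF f Y]
    {
      fix f' X'' assume f': "f' \<in> arr \<C> X'' X'"
      show "pull T (f \<cdot> f') Y v = pull T f' Y (pull T f Y v)"
        by (rule coend_hom_ext[OF coend_pull_linear[OF G.cmp_arr[OF f' f] Y]
              linear_map_compose[OF lin coend_pull_linear[OF f' Y]] module_coend[OF Y] Y vc])
          (simp add: gen[OF f] gen[OF f'] gen[OF G.cmp_arr[OF f' f]] E.pull_closed[OF f] eltD(3)[OF E.pull_closed[OF f]] E.pull_cmp[OF f f'])
    }
    {
      fix f' assume f': "f' \<in> arr \<C> X' X"
      interpret H: module R "Hom \<C> X' X" by (rule G.Hom_module[OF X' X])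
      have s: "f \<oplus>\<^bsub>Hom \<C> X' X\<^esub> f' \<in> arr \<C> X' X" using f f' by (simp add: arr_def)
      show "pull T (f \<oplus>\<^bsub>Hom \<C> X' X\<^esub> f') Y v = pull T f Y v \<oplus>\<^bsub>val T X' Y\<^esub> pull T f' Y v"
        by (rule coend_hom_ext[OF coend_pull_linear[OF s Y]
              linear_map_sum[OF lin coend_pull_linear[OF f' Y] module_coend[OF Y]] module_coend[OF Y] Y vc])
          (simp add: gen[OF f] gen[OF f'] gen[OF s] E.pull_add[OF f f']
            E.pull_closed[OF f] eltD(3)[OF E.pull_closed[OF f]] E.pull_closed[OF f'] eltD(3)[OF E.pull_closed[OF f']]
            linear_map_add[OF balanced_right[OF balanced_generator[OF X' Y]]])
    }
    {
      fix r assume r: "r \<in> carrier R"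
      interpret H: module R "Hom \<C> X' X" by (rule G.Hom_module[OF X' X])
      have s: "r \<odot>\<^bsub>Hom \<C> X' X\<^esub> f \<in> arr \<C> X' X" using f r by (simp add: arr_def)
      show "pull T (r \<odot>\<^bsub>Hom \<C> X' X\<^esub> f) Y v = r \<odot>\<^bsub>val T X' Y\<^esub> pull T f Y v"
        by (rule coend_hom_ext[OF coend_pull_linear[OF s Y]
              linear_map_scale[OF lin module_coend[OF Y] r] module_coend[OF Y] Y vc])
          (simp add: gen[OF f] gen[OF s] E.pull_smult[OF r f] E.pull_closed[OF f] eltD(3)[OF E.pull_closed[OF f]] r
            linear_map_smult[OF balanced_right[OF balanced_generator[OF X' Y]]])
    }
    {
      fix g Y' assume g: "g \<in> arr \<C> Y Y'"
      note Y' = arrD(2)[OF g]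
      show "pull T f Y' (push T X g v) = push T X' g (pull T f Y v)"
        by (rule coend_hom_ext[OF linear_map_compose[OF coend_push_linear[OF g X] coend_pull_linear[OF f Y']]
              linear_map_compose[OF lin coend_push_linear[OF g X']] module_coend[OF Y'] Y vc])
          (simp add: gen[OF f] gen[OF g] E.pull_closed[OF f] eltD(3)[OF E.pull_closed[OF f]] G.push_closed[OF g] eltD(3)[OF G.push_closed[OF g]])
    }
  }
  {
    fix g Y Y' X v assume g: "g \<in> arr \<C> Y Y'" and v: "v \<in> elt \<C> T X Y"
    note X = eltD(1)[OF v] and Y = eltD(2)[OF v] and vc = eltD(3)[OF v] and Y' = arrD(2)[OF g]
    note lin = coend_push_linear[OF g X]
    {
      fix g' Y'' assume g': "g' \<in> arr \<C> Y' Y''"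
      show "push T X (g' \<cdot> g) v = push T X g' (push T X g v)"
        by (rule coend_hom_ext[OF coend_push_linear[OF G.cmp_arr[OF g g'] X]
              linear_map_compose[OF lin coend_push_linear[OF g' X]] module_coend[OF arrD(2)[OF g']] Y vc])
          (simp add: gen[OF g] gen[OF g'] gen[OF G.cmp_arr[OF g g']] G.push_closed[OF g] eltD(3)[OF G.push_closed[OF g]] G.push_cmp[OF g g'])
    }
    {
      fix g' assume g': "g' \<in> arr \<C> Y Y'"
      interpret H: module R "Hom \<C> Y Y'" by (rule G.Hom_module[OF Y Y'])
      have s: "g \<oplus>\<^bsub>Hom \<C> Y Y'\<^esub> g' \<in> arr \<C> Y Y'" using g g' by (simp add: arr_def)
      show "push T X (g \<oplus>\<^bsub>Hom \<C> Y Y'\<^esub> g') v = push T X g v \<oplus>\<^bsub>val T X Y'\<^esub> push T X g' v"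
        by (rule coend_hom_ext[OF coend_push_linear[OF s X]
              linear_map_sum[OF lin coend_push_linear[OF g' X] module_coend[OF Y']] module_coend[OF Y'] Y vc])
          (simp add: gen[OF g] gen[OF g'] gen[OF s] G.push_add[OF g g']
            G.push_closed[OF g] eltD(3)[OF G.push_closed[OF g]] G.push_closed[OF g'] eltD(3)[OF G.push_closed[OF g']]
            linear_map_add[OF balanced_left[OF balanced_generator[OF X Y']]])
    }
    {
      fix r assume r: "r \<in> carrier R"
      interpret H: module R "Hom \<C> Y Y'" by (rule G.Hom_module[OF Y Y'])
      have s: "r \<odot>\<^bsub>Hom \<C> Y Y'\<^esub> g \<in> arr \<C> Y Y'" using g r by (simp add: arr_def)
      show "push T X (r \<odot>\<^bsub>Hom \<C> Y Y'\<^esub> g) v = r \<odot>\<^bsub>val T X Y'\<^esub> push T X g v"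
        by (rule coend_hom_ext[OF coend_push_linear[OF s X]
              linear_map_scale[OF lin module_coend[OF Y'] r] module_coend[OF Y'] Y vc])
          (simp add: gen[OF g] gen[OF s] G.push_smult[OF r g] G.push_closed[OF g] eltD(3)[OF G.push_closed[OF g]] r
            linear_map_smult[OF balanced_left[OF balanced_generator[OF X Y']]])
    }
  }
qed (auto intro: module_coend coend_pull_linear coend_push_linear)

end


section \<open>Positive extensions\<close>

locale ext_bifunctor = bilinear_functor R \<C> \<E>
  for R :: "'r ring" and \<C> :: "('r, 'o, 'm) lincat" (structure)
    and \<E> :: "('r, 'o, 'm, 'e) bifun"
begin

abbreviation "P n \<equiv> Epos R \<C> \<E> n"
abbreviation "up n \<equiv> upper_sharp R \<C> \<E> n"
abbreviation "low n \<equiv> lower_sharp R \<C> \<E> n"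

lemma inj_pext [simp]: "inj HomEl" "inj ExtEl"
  by (simp_all add: inj_def)

lemma bilinear_functor_Epos: "bilinear_functor R \<C> (P n)"
proof (induction n)
  case 0
  show ?case
    using bilinear_functor.bilinear_functor_transport[OF bilinear_hom_functor inj_pext(1)] by simp
next
  case (Suc n)
  show ?case
  proof (cases n)
    case 0
    then show ?thesis
      using bilinear_functor_transport[OF inj_pext(2)] by simp
  next
    case (Suc m)
    then show ?thesis
      using tensor_functors.bilinear_functor_coend[OF tensor_functors.intro[OF Suc.IH bilinear_functor_axioms]]
      by simp
  qed
qed

sublocale P: bilinear_functor R \<C> "P n" for n
  by (rule bilinear_functor_Epos)

sublocale T: tensor_functors R \<C> "P (Suc n)" \<E> for n
  by (intro tensor_functors.intro bilinear_functor_Epos bilinear_functor_axioms)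

lemma elt_P0: "u \<in> elt \<C> (P 0) X Y \<longleftrightarrow> (\<exists>f\<in>arr \<C> X Y. u = HomEl f)"
  by (auto simp: elt_transport) (auto simp: hom_functor_def elt_def arr_def)

lemma elt_P1: "u \<in> elt \<C> (P (Suc 0)) X Y \<longleftrightarrow> (\<exists>\<delta>\<in>elt \<C> \<E> X Y. u = ExtEl \<delta>)"
  by (auto simp: elt_transport)

lemma pull_P0: "pull (P 0) f Y (HomEl h) = HomEl (h \<cdot> f)"
  by (simp add: hom_functor_def)

lemma push_P0: "push (P 0) X g (HomEl h) = HomEl (g \<cdot> h)"
  by (simp add: hom_functor_def)

lemma val_P0: "val (P 0) X Y = transport_module HomEl (Hom \<C> X Y)"
  by (simp add: hom_functor_def)

lemma pull_P1: "pull (P (Suc 0)) f Y (ExtEl \<delta>) = ExtEl (pull \<E> f Y \<delta>)"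
  by simp

lemma push_P1: "push (P (Suc 0)) X g (ExtEl \<delta>) = ExtEl (push \<E> X g \<delta>)"
  by simp

lemma val_P1: "val (P (Suc 0)) X Y = transport_module ExtEl (val \<E> X Y)"
  by simp

end

text \<open>
  The recursive equations of \<open>\<E>\<^sup>n\<close> separate degrees that the arguments below treat alike, so they are
  applied only on demand.
\<close>

declare Epos.simps [simp del]

context ext_bifunctor
begin

lemma up_Suc: "up (Suc n) C A \<delta> Y \<rho> = T.cls n C Y [(A, \<rho>, \<delta>)]"
  by (simp add: upper_sharp_def)

lemma push_by_linear:
  assumes \<tau>: "\<tau> \<in> elt \<C> \<E> X M" and Y: "Y \<in> Ob \<C>"
  shows "linear_map R (Hom \<C> M Y) (val \<E> X Y) (\<lambda>g. push \<E> X g \<tau>)"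
proof (rule linear_mapI)
  fix g assume "g \<in> carrier (Hom \<C> M Y)"
  then have g: "g \<in> arr \<C> M Y" using \<tau> Y by (simp add: arr_def eltD)
  show "push \<E> X g \<tau> \<in> carrier (val \<E> X Y)"
    using push_closed[OF g \<tau>] by (simp add: elt_def)
  show "push \<E> X (r \<odot>\<^bsub>Hom \<C> M Y\<^esub> g) \<tau> = r \<odot>\<^bsub>val \<E> X Y\<^esub> push \<E> X g \<tau>" if "r \<in> carrier R" for r
    using push_smult[OF that g \<tau>] .
  fix g' assume "g' \<in> carrier (Hom \<C> M Y)"
  then have g': "g' \<in> arr \<C> M Y" using \<tau> Y by (simp add: arr_def eltD)
  show "push \<E> X (g \<oplus>\<^bsub>Hom \<C> M Y\<^esub> g') \<tau> = push \<E> X g \<tau> \<oplus>\<^bsub>val \<E> X Y\<^esub> push \<E> X g' \<tau>"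
    using push_add[OF g g' \<tau>] .
qed

text \<open>
  By the co-Yoneda lemma \<open>\<E>\<^sup>1\<close> is the coend of \<open>\<E>\<^sup>0\<close> and \<open>\<E>\<close> as well, although it is not
  constructed that way.  Presenting \<open>\<E>\<^sup>n\<^sup>+\<^sup>1\<close> as the coend of \<open>\<E>\<^sup>n\<close> and \<open>\<E>\<close> for all \<open>n \<ge> 0\<close> alike,
  with \<open>up n\<close> as the universal balanced family, permits inductions on the degree that start at \<open>n = 0\<close>.
\<close>

lemma up_balanced:
  assumes X: "X \<in> Ob \<C>" and Y: "Y \<in> Ob \<C>"
  shows "balanced R \<C> (P n) \<E> X Y (val (P (Suc n)) X Y) (\<lambda>M \<rho> \<tau>. up n X M \<tau> Y \<rho>)"
proof (cases n)
  case 0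
  have "balanced R \<C> (P 0) \<E> X Y (val (P (Suc 0)) X Y) (\<lambda>M \<rho> \<tau>. up 0 X M \<tau> Y \<rho>)"
  proof (rule balancedI)
    fix M \<tau> assume \<tau>: "\<tau> \<in> elt \<C> \<E> X M"
    show "linear_map R (val (P 0) M Y) (val (P (Suc 0)) X Y) (up 0 X M \<tau> Y)"
      unfolding val_P0 val_P1 linear_map_from_transport[OF inj_pext(1)] upper_sharp_0
      by (rule linear_map_compose[OF push_by_linear[OF \<tau> Y] linear_map_transport[OF inj_pext(2)]])
  next
    fix M \<rho> assume "\<rho> \<in> elt \<C> (P 0) M Y"
    then obtain g where g: "g \<in> arr \<C> M Y" "\<rho> = HomEl g" by (auto simp: elt_P0)
    show "linear_map R (val \<E> X M) (val (P (Suc 0)) X Y) (\<lambda>\<tau>. up 0 X M \<tau> Y \<rho>)"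
      unfolding val_P1 g(2) upper_sharp_0
      by (rule linear_map_compose[OF push_linear[OF g(1) X] linear_map_transport[OF inj_pext(2)]])
  next
    fix f M M' \<rho> \<tau>
    assume f: "f \<in> arr \<C> M M'" and "\<rho> \<in> elt \<C> (P 0) M' Y" and \<tau>: "\<tau> \<in> elt \<C> \<E> X M"
    then obtain g where g: "g \<in> arr \<C> M' Y" "\<rho> = HomEl g" by (auto simp: elt_P0)
    show "up 0 X M \<tau> Y (pull (P 0) f Y \<rho>) = up 0 X M' (push \<E> X f \<tau>) Y \<rho>"
      unfolding g(2) pull_P0 upper_sharp_0 push_cmp[OF f g(1) \<tau>] ..
  qed
  then show ?thesis by (simp only: 0)
next
  case (Suc m)
  then show ?thesis
    using T.balanced_generator[OF X Y, of m] by (simp add: up_Suc Epos.simps)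
qed

lemma up_closed:
  assumes "\<rho> \<in> elt \<C> (P n) M Y" "\<tau> \<in> elt \<C> \<E> X M"
  shows "up n X M \<tau> Y \<rho> \<in> elt \<C> (P (Suc n)) X Y"
  using linear_map_closed[OF balanced_left[OF up_balanced assms(2)] eltD(3)[OF assms(1)]] assms
  by (meson eltD(1) eltD(2) eltI)

lemma up_dinatural:
  assumes "f \<in> arr \<C> M M'" "\<rho> \<in> elt \<C> (P n) M' Y" "\<tau> \<in> elt \<C> \<E> X M"
  shows "up n X M \<tau> Y (pull (P n) f Y \<rho>) = up n X M' (push \<E> X f \<tau>) Y \<rho>"
  using balanced_dinatural[OF up_balanced assms] assms by (meson eltD(1) eltD(2))

lemma up_pull:
  assumes f: "f \<in> arr \<C> X' X" and \<rho>: "\<rho> \<in> elt \<C> (P n) M Y" and \<tau>: "\<tau> \<in> elt \<C> \<E> X M"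
  shows "pull (P (Suc n)) f Y (up n X M \<tau> Y \<rho>) = up n X' M (pull \<E> f M \<tau>) Y \<rho>"
proof (cases n)
  case 0
  with \<rho> obtain g where g: "g \<in> arr \<C> M Y" "\<rho> = HomEl g"
    by (auto simp: elt_P0)
  show ?thesis
    unfolding 0 g(2) upper_sharp_0 pull_P1 pull_push[OF f g(1) \<tau>] ..
next
  case (Suc m)
  then show ?thesis
    using T.coend_pull_generator[OF f _ \<tau>, of \<rho> m Y] \<rho> by (simp add: up_Suc Epos.simps)
qed

lemma up_push:
  assumes g: "g \<in> arr \<C> Y Y'" and \<rho>: "\<rho> \<in> elt \<C> (P n) M Y" and \<tau>: "\<tau> \<in> elt \<C> \<E> X M"
  shows "push (P (Suc n)) X g (up n X M \<tau> Y \<rho>) = up n X M \<tau> Y' (push (P n) M g \<rho>)"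
proof (cases n)
  case 0
  with \<rho> obtain h where h: "h \<in> arr \<C> M Y" "\<rho> = HomEl h"
    by (auto simp: elt_P0)
  show ?thesis
    unfolding 0 h(2) upper_sharp_0 push_P1 push_P0 push_cmp[OF h(1) g \<tau>] ..
next
  case (Suc m)
  then show ?thesis
    using T.coend_push_generator[OF g _ \<tau>, of \<rho> m] \<rho> by (simp add: up_Suc Epos.simps)
qed

lemma up_hom_ext:
  assumes f: "linear_map R (val (P (Suc n)) X Y) N f" and g: "linear_map R (val (P (Suc n)) X Y) N g"
    and N: "module R N" and u: "u \<in> elt \<C> (P (Suc n)) X Y"
    and gen: "\<And>M \<rho> \<tau>. \<rho> \<in> elt \<C> (P n) M Y \<Longrightarrow> \<tau> \<in> elt \<C> \<E> X M \<Longrightarrow>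
      f (up n X M \<tau> Y \<rho>) = g (up n X M \<tau> Y \<rho>)"
  shows "f u = g u"
proof (cases n)
  case 0
  with u obtain \<tau> where \<tau>: "\<tau> \<in> elt \<C> \<E> X Y" "u = ExtEl \<tau>"
    by (auto simp: elt_P1)
  then have "u = up 0 X Y \<tau> Y (HomEl (Idn \<C> Y))"
    by (simp add: upper_sharp_0 push_Idn)
  moreover have "HomEl (Idn \<C> Y) \<in> elt \<C> (P 0) Y Y"
    unfolding elt_P0 using Idn_arr eltD(2)[OF \<tau>(1)] by blast
  ultimately show ?thesis
    using gen \<tau>(1) 0 by blast
next
  case (Suc m)
  then show ?thesis
    using T.coend_hom_ext[of m X Y N f g u] assms eltD(2,3)[OF u] by (simp add: up_Suc Epos.simps)
qed

text \<open>
  The linear map induced on \<open>\<E>\<^sup>n\<^sup>+\<^sup>1(X, Y)\<close> by a balanced family.  In degree \<open>n = 0\<close>, where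
  \<open>\<tau> \<in> \<E>(X, Y)\<close> is the product of the identity of \<open>Y\<close> with \<open>\<tau>\<close>, it is evaluation at the identity.
\<close>

definition ext_lift :: "nat \<Rightarrow> ('r, 'n) module \<Rightarrow> 'o \<Rightarrow>
    ('o \<Rightarrow> ('o, 'm, 'e) pext \<Rightarrow> 'e \<Rightarrow> 'n) \<Rightarrow> ('o, 'm, 'e) pext \<Rightarrow> 'n" where
  "ext_lift n N Y \<beta> = (if n = 0 then \<lambda>u. \<beta> Y (HomEl (Idn \<C> Y)) (ext_of u) else coend_lift N \<beta>)"

lemma ext_lift_linear:
  assumes N: "module R N" and \<beta>: "balanced R \<C> (P n) \<E> X Y N \<beta>" and Y: "Y \<in> Ob \<C>"
  shows "linear_map R (val (P (Suc n)) X Y) N (ext_lift n N Y \<beta>)"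
proof (cases n)
  case 0
  have "HomEl (Idn \<C> Y) \<in> elt \<C> (P 0) Y Y"
    unfolding elt_P0 using Idn_arr Y by blast
  from balanced_right[OF \<beta>[unfolded 0] this] show ?thesis
    unfolding 0 val_P1 linear_map_from_transport[OF inj_pext(2)] ext_lift_def by simp
next
  case (Suc m)
  then show ?thesis
    using T.coend_lift_linear[OF N, of m X Y \<beta>] \<beta> by (simp add: ext_lift_def Epos.simps)
qed

lemma ext_lift_up:
  assumes N: "module R N" and \<beta>: "balanced R \<C> (P n) \<E> X Y N \<beta>"
    and \<rho>: "\<rho> \<in> elt \<C> (P n) M Y" and \<tau>: "\<tau> \<in> elt \<C> \<E> X M"
  shows "ext_lift n N Y \<beta> (up n X M \<tau> Y \<rho>) = \<beta> M \<rho> \<tau>"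
proof (cases n)
  case 0
  with \<rho> obtain g where g: "g \<in> arr \<C> M Y" "\<rho> = HomEl g"
    by (auto simp: elt_P0)
  have id: "HomEl (Idn \<C> Y) \<in> elt \<C> (P 0) Y Y"
    unfolding elt_P0 using Idn_arr arrD[OF g(1)] by blast
  show ?thesis
    using balanced_dinatural[OF \<beta>[unfolded 0] g(1) id \<tau>]
    by (simp add: 0 g(2) ext_lift_def upper_sharp_0 pull_P0 cmp_Idn_left[OF g(1)])
next
  case (Suc m)
  then show ?thesis
    using T.coend_lift_generator[OF N, of m X Y \<beta> \<rho> M \<tau>] \<beta> \<rho> \<tau> by (simp add: ext_lift_def up_Suc Epos.simps)
qed

text \<open>
  Both connecting maps multiply by an extension, on opposite sides, so that
  \<open>\<delta>\<^sub>\<sharp>(\<rho> \<union> \<tau>) = \<delta>\<^sub>\<sharp>(\<rho>) \<union> \<tau>\<close>; hence \<open>\<delta>\<^sub>\<sharp>\<close> in degree \<open>n + 1\<close> is the map induced by \<open>\<delta>\<^sub>\<sharp>(\<rho>) \<union> \<tau>\<close>.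
\<close>

lemma low_Suc:
  assumes \<delta>: "\<delta> \<in> elt \<C> \<E> C A" and u: "u \<in> elt \<C> (P (Suc n)) X C"
    and closed: "\<And>M \<rho>. \<rho> \<in> elt \<C> (P n) M C \<Longrightarrow> low n C A \<delta> M \<rho> \<in> elt \<C> (P (Suc n)) M A"
  shows "low (Suc n) C A \<delta> X u =
    ext_lift n (val (P (Suc (Suc n))) X A) C (\<lambda>M \<rho> \<tau>. up (Suc n) X M \<tau> A (low n C A \<delta> M \<rho>)) u"
proof (cases n)
  case 0
  with u obtain \<tau> where \<tau>: "\<tau> \<in> elt \<C> \<E> X C" "u = ExtEl \<tau>"
    by (auto simp: elt_P1)
  show ?thesis
    unfolding 0 \<tau>(2) ext_lift_def by (simp add: lower_sharp_0 up_Suc pull_Idn[OF \<delta>]) (simp add: lower_sharp_def)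
next
  case (Suc m)
  have "terms_of u \<in> lists (T.tms m X C)"
    using T.terms_of_carrier[of u m X C] eltD(3)[OF u] by (simp add: Suc Epos.simps)
  then have "map (\<lambda>(M, \<rho>, \<tau>). (M, low n C A \<delta> M \<rho>, \<tau>)) (terms_of u) \<in> lists (T.tms n X A)"
    by (rule T.map_lists) (use closed[unfolded Suc] in \<open>auto simp: T.tms_iff Suc\<close>)
  from T.cls_eq_lsum[OF eltD(2)[OF \<delta>] this] show ?thesis
    by (simp add: Suc ext_lift_def coend_lift_def up_Suc o_def case_prod_unfold Epos.simps)
      (simp add: lower_sharp_def case_prod_unfold Epos.simps)
qed

lemma up_low_balanced:
  assumes \<delta>: "\<delta> \<in> elt \<C> \<E> C A" and X: "X \<in> Ob \<C>"
    and lin: "\<And>M. M \<in> Ob \<C> \<Longrightarrow> linear_map R (val (P n) M C) (val (P (Suc n)) M A) (low n C A \<delta> M)"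
    and nat: "\<And>f M M' u. f \<in> arr \<C> M M' \<Longrightarrow> u \<in> elt \<C> (P n) M' C \<Longrightarrow>
      low n C A \<delta> M (pull (P n) f C u) = pull (P (Suc n)) f A (low n C A \<delta> M' u)"
  shows "balanced R \<C> (P n) \<E> X C (val (P (Suc (Suc n))) X A)
    (\<lambda>M \<rho> \<tau>. up (Suc n) X M \<tau> A (low n C A \<delta> M \<rho>))"
proof (rule balancedI)
  note upb = up_balanced[OF X eltD(2)[OF \<delta>], of "Suc n"]
  have closed: "low n C A \<delta> M \<rho> \<in> elt \<C> (P (Suc n)) M A" if "\<rho> \<in> elt \<C> (P n) M C" for M \<rho>
    using linear_map_closed[OF lin[OF eltD(1)[OF that]] eltD(3)[OF that]] eltD(2)[OF \<delta>] eltD(1)[OF that]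
    by (intro eltI)
  {
    fix M \<tau> assume \<tau>: "\<tau> \<in> elt \<C> \<E> X M"
    show "linear_map R (val (P n) M C) (val (P (Suc (Suc n))) X A)
        (\<lambda>\<rho>. up (Suc n) X M \<tau> A (low n C A \<delta> M \<rho>))"
      by (rule linear_map_compose[OF lin balanced_left[OF upb \<tau>]]) (rule eltD[OF \<tau>])
  }
  {
    fix M \<rho> assume \<rho>: "\<rho> \<in> elt \<C> (P n) M C"
    show "linear_map R (val \<E> X M) (val (P (Suc (Suc n))) X A)
        (\<lambda>\<tau>. up (Suc n) X M \<tau> A (low n C A \<delta> M \<rho>))"
      by (rule balanced_right[OF upb closed[OF \<rho>]])
  }
  fix f M M' \<rho> \<tau>
  assume "f \<in> arr \<C> M M'" "\<rho> \<in> elt \<C> (P n) M' C" "\<tau> \<in> elt \<C> \<E> X M"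
  then show "up (Suc n) X M \<tau> A (low n C A \<delta> M (pull (P n) f C \<rho>)) =
      up (Suc n) X M' (push \<E> X f \<tau>) A (low n C A \<delta> M' \<rho>)"
    by (simp add: nat up_dinatural closed)
qed

text \<open>
  Linearity and naturality are proved in one induction: for the map induced on the coend to exist in
  the next degree, \<open>\<delta>\<^sub>\<sharp>(\<rho>) \<union> \<tau>\<close> has to be linear and dinatural in \<open>\<rho>\<close>.
\<close>

lemma low_linear_natural:
  assumes \<delta>: "\<delta> \<in> elt \<C> \<E> C A"
  shows "(\<forall>X\<in>Ob \<C>. linear_map R (val (P n) X C) (val (P (Suc n)) X A) (low n C A \<delta> X)) \<and>
    (\<forall>f X X' u. f \<in> arr \<C> X' X \<longrightarrow> u \<in> elt \<C> (P n) X C \<longrightarrow>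
      low n C A \<delta> X' (pull (P n) f C u) = pull (P (Suc n)) f A (low n C A \<delta> X u))"
    (is "?L n \<and> ?N n")
proof (induction n)
  note C = eltD(1)[OF \<delta>] and A = eltD(2)[OF \<delta>]
  case 0
  have "linear_map R (Hom \<C> X C) (val \<E> X A) (\<lambda>f. pull \<E> f A \<delta>)" if X: "X \<in> Ob \<C>" for X
    using X C pull_add[OF _ _ \<delta>] pull_smult[OF _ _ \<delta>] pull_closed[OF _ \<delta>]
    by (intro linear_mapI) (auto simp: arr_def elt_def)
  then have "?L 0"
    unfolding val_P0 val_P1 linear_map_from_transport[OF inj_pext(1)] lower_sharp_0
    by (auto intro: linear_map_compose[OF _ linear_map_transport[OF inj_pext(2)]])
  moreover have "?N 0"
    by (auto simp: elt_P0 pull_P0 pull_P1 lower_sharp_0 pull_cmp \<delta>)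
  ultimately show ?case ..
next
  note C = eltD(1)[OF \<delta>] and A = eltD(2)[OF \<delta>]
  case (Suc n)
  then have lin: "X \<in> Ob \<C> \<Longrightarrow> linear_map R (val (P n) X C) (val (P (Suc n)) X A) (low n C A \<delta> X)"
    and nat: "f \<in> arr \<C> X' X \<Longrightarrow> u \<in> elt \<C> (P n) X C \<Longrightarrow>
      low n C A \<delta> X' (pull (P n) f C u) = pull (P (Suc n)) f A (low n C A \<delta> X u)" for X X' f u
    by blast+
  have closed: "low n C A \<delta> M \<rho> \<in> elt \<C> (P (Suc n)) M A" if "\<rho> \<in> elt \<C> (P n) M C" for M \<rho>
    using linear_map_closed[OF lin[OF eltD(1)[OF that]] eltD(3)[OF that]] A eltD(1)[OF that]
    by (intro eltI)
  let ?N = "\<lambda>X. val (P (Suc (Suc n))) X A"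
  let ?\<beta> = "\<lambda>X M \<rho> \<tau>. up (Suc n) X M \<tau> A (low n C A \<delta> M \<rho>)"
  have mod: "module R (?N X)" if "X \<in> Ob \<C>" for X
    using that A by (intro P.val_module)
  have bal: "balanced R \<C> (P n) \<E> X C (?N X) (?\<beta> X)" if X: "X \<in> Ob \<C>" for X
    by (rule up_low_balanced[OF \<delta> X lin nat])
  have lin': "linear_map R (val (P (Suc n)) X C) (?N X) (low (Suc n) C A \<delta> X)" if X: "X \<in> Ob \<C>" for X
    by (rule linear_map_cong[OF ext_lift_linear[OF mod[OF X] bal[OF X] C]])
      (use X C in \<open>auto intro!: P.val_module low_Suc[OF \<delta> _ closed] eltI\<close>)
  have gen: "low (Suc n) C A \<delta> X (up n X M \<tau> C \<rho>) = ?\<beta> X M \<rho> \<tau>"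
    if "\<rho> \<in> elt \<C> (P n) M C" "\<tau> \<in> elt \<C> \<E> X M" for X M \<rho> \<tau>
    using ext_lift_up[OF mod bal that] low_Suc[OF \<delta> up_closed[OF that] closed] eltD(1)[OF that(2)]
    by simp
  have "low (Suc n) C A \<delta> X' (pull (P (Suc n)) f C u) = pull (P (Suc (Suc n))) f A (low (Suc n) C A \<delta> X u)"
    if f: "f \<in> arr \<C> X' X" and u: "u \<in> elt \<C> (P (Suc n)) X C" for f X' X u
    by (rule up_hom_ext[OF linear_map_compose[OF P.pull_linear[OF f C] lin'[OF arrD(1)[OF f]]]
          linear_map_compose[OF lin'[OF arrD(2)[OF f]] P.pull_linear[OF f A]] mod[OF arrD(1)[OF f]] u])
      (simp add: gen up_pull[OF f] pull_closed[OF f] closed)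
  with lin' show ?case by blast
qed

lemma low_linear:
  "\<delta> \<in> elt \<C> \<E> C A \<Longrightarrow> X \<in> Ob \<C> \<Longrightarrow> linear_map R (val (P n) X C) (val (P (Suc n)) X A) (low n C A \<delta> X)"
  using low_linear_natural by blast

lemma low_natural:
  "\<lbrakk>\<delta> \<in> elt \<C> \<E> C A; f \<in> arr \<C> X' X; u \<in> elt \<C> (P n) X C\<rbrakk>
    \<Longrightarrow> low n C A \<delta> X' (pull (P n) f C u) = pull (P (Suc n)) f A (low n C A \<delta> X u)"
  using low_linear_natural by blast

lemma low_closed:
  "\<delta> \<in> elt \<C> \<E> C A \<Longrightarrow> u \<in> elt \<C> (P n) X C \<Longrightarrow> low n C A \<delta> X u \<in> elt \<C> (P (Suc n)) X A"
  using linear_map_closed[OF low_linear] by (auto simp: elt_def)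

lemma low_up:
  assumes \<delta>: "\<delta> \<in> elt \<C> \<E> C A" and el: "\<rho> \<in> elt \<C> (P n) M C" "\<tau> \<in> elt \<C> \<E> X M"
  shows "low (Suc n) C A \<delta> X (up n X M \<tau> C \<rho>) = up (Suc n) X M \<tau> A (low n C A \<delta> M \<rho>)"
proof -
  have X: "X \<in> Ob \<C>" using el(2) by (rule eltD)
  note bal = up_low_balanced[OF \<delta> X low_linear[OF \<delta>] low_natural[OF \<delta>]]
  show ?thesis
    using low_Suc[OF \<delta> up_closed[OF el] low_closed[OF \<delta>]]
      ext_lift_up[OF P.val_module[OF X eltD(2)[OF \<delta>]] bal el]
    by simp
qed

lemma low_ext_morphism:
  assumes m: "ext_morphism \<C> \<E> C A \<delta> C' A' \<delta>' a c" and v: "v \<in> elt \<C> (P n) X C"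
  shows "push (P (Suc n)) X a (low n C A \<delta> X v) = low n C' A' \<delta>' X (push (P n) X c v)"
  using v
proof (induction n arbitrary: X v)
  have \<delta>: "\<delta> \<in> elt \<C> \<E> C A" "\<delta>' \<in> elt \<C> \<E> C' A'" and a: "a \<in> arr \<C> A A'" and c: "c \<in> arr \<C> C C'"
    and eq: "push \<E> C a \<delta> = pull \<E> c A' \<delta>'"
    using m by (simp_all add: ext_morphism_def)
  case 0
  then obtain f where f: "f \<in> arr \<C> X C" "v = HomEl f" by (auto simp: elt_P0)
  show ?case
    unfolding f(2) lower_sharp_0 push_P0 push_P1
    using pull_push[OF f(1) a \<delta>(1)] pull_cmp[OF c f(1) \<delta>(2)] eq by simp
next
  have \<delta>: "\<delta> \<in> elt \<C> \<E> C A" "\<delta>' \<in> elt \<C> \<E> C' A'" and a: "a \<in> arr \<C> A A'" and c: "c \<in> arr \<C> C C'"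
    using m by (simp_all add: ext_morphism_def)
  case (Suc n)
  have X: "X \<in> Ob \<C>" using Suc.prems by (rule eltD)
  show ?case
    by (rule up_hom_ext[OF linear_map_compose[OF low_linear[OF \<delta>(1) X] P.push_linear[OF a X]]
          linear_map_compose[OF P.push_linear[OF c X] low_linear[OF \<delta>(2) X]]
          P.val_module[OF X arrD(2)[OF a]] Suc.prems])
      (simp add: low_up \<delta> up_push[OF a] up_push[OF c] low_closed Suc.IH P.push_closed[OF c])
qed

lemma up_ext_morphism:
  assumes m: "ext_morphism \<C> \<E> C A \<delta> C' A' \<delta>' a c" and v: "v \<in> elt \<C> (P n) A' Y"
  shows "pull (P (Suc n)) c Y (up n C' A' \<delta>' Y v) = up n C A \<delta> Y (pull (P n) a Y v)"
  using m up_pull[OF _ v] up_dinatural[OF _ v] by (simp add: ext_morphism_def)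

end


section \<open>Negative extensions\<close>

context linear_category
begin

lemma cmp_add_right:
  "\<lbrakk>g \<in> arr \<C> Y Z; f \<in> arr \<C> X Y; f' \<in> arr \<C> X Y\<rbrakk>
    \<Longrightarrow> g \<cdot> (f \<oplus>\<^bsub>Hom \<C> X Y\<^esub> f') = (g \<cdot> f) \<oplus>\<^bsub>Hom \<C> X Z\<^esub> (g \<cdot> f')"
  by (meson arrD cmp_linear_right linear_map_add)

lemma cmp_add_left:
  "\<lbrakk>f \<in> arr \<C> X Y; g \<in> arr \<C> Y Z; g' \<in> arr \<C> Y Z\<rbrakk>
    \<Longrightarrow> (g \<oplus>\<^bsub>Hom \<C> Y Z\<^esub> g') \<cdot> f = (g \<cdot> f) \<oplus>\<^bsub>Hom \<C> X Z\<^esub> (g' \<cdot> f)"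
  using linear_map_add[OF cmp_linear_left] by (blast dest: arrD)

lemma cmp_smult_right:
  "\<lbrakk>g \<in> arr \<C> Y Z; f \<in> arr \<C> X Y; r \<in> carrier R\<rbrakk>
    \<Longrightarrow> g \<cdot> (r \<odot>\<^bsub>Hom \<C> X Y\<^esub> f) = r \<odot>\<^bsub>Hom \<C> X Z\<^esub> (g \<cdot> f)"
  by (meson arrD cmp_linear_right linear_map_smult)

lemma cmp_smult_left:
  "\<lbrakk>f \<in> arr \<C> X Y; g \<in> arr \<C> Y Z; r \<in> carrier R\<rbrakk>
    \<Longrightarrow> (r \<odot>\<^bsub>Hom \<C> Y Z\<^esub> g) \<cdot> f = r \<odot>\<^bsub>Hom \<C> X Z\<^esub> (g \<cdot> f)"
  using linear_map_smult[OF cmp_linear_left] by (blast dest: arrD)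

lemma cmp_zero_right:
  "\<lbrakk>g \<in> arr \<C> Y Z; X \<in> Ob \<C>\<rbrakk> \<Longrightarrow> g \<cdot> \<zero>\<^bsub>Hom \<C> X Y\<^esub> = \<zero>\<^bsub>Hom \<C> X Z\<^esub>"
  by (meson arrD Hom_module cmp_linear_right linear_map_zero)

end

lemma linear_map_const_zero:
  assumes "module R N"
  shows "linear_map R M N (\<lambda>_. \<zero>\<^bsub>N\<^esub>)"
proof -
  interpret N: module R N by fact
  show ?thesis by (intro linear_mapI) simp_all
qed

context ext_bifunctor
begin

abbreviation "N n \<equiv> Eneg R \<C> \<E> n"

text \<open>
  Elements of \<open>\<E>\<^sub>I\<^sup>-\<^sup>n(X, A)\<close> are extensional functions on the elements of \<open>\<E>\<^sup>n(A, -)\<close>; all operations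
  on them have this form.
\<close>

definition tabulate :: "nat \<Rightarrow> 'o \<Rightarrow> ('o, 'm, 'e) neg_ext \<Rightarrow> ('o, 'm, 'e) neg_ext" where
  "tabulate n A t = (\<lambda>Y\<in>Ob \<C>. \<lambda>v\<in>carrier (val (P n) A Y). t Y v)"

lemma tabulate_apply: "v \<in> elt \<C> (P n) A Y \<Longrightarrow> tabulate n A t Y v = t Y v"
  by (simp add: tabulate_def elt_def)

lemma Eneg_simps:
  "\<theta> \<oplus>\<^bsub>val (N n) X A\<^esub> \<theta>' = tabulate n A (\<lambda>Y v. \<theta> Y v \<oplus>\<^bsub>Hom \<C> X Y\<^esub> \<theta>' Y v)"
  "r \<odot>\<^bsub>val (N n) X A\<^esub> \<theta> = tabulate n A (\<lambda>Y v. r \<odot>\<^bsub>Hom \<C> X Y\<^esub> \<theta> Y v)"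
  "\<zero>\<^bsub>val (N n) X A\<^esub> = tabulate n A (\<lambda>Y v. \<zero>\<^bsub>Hom \<C> X Y\<^esub>)"
  "pull (N n) c A \<theta> = tabulate n A (\<lambda>Y v. \<theta> Y v \<cdot> c)"
  "push (N n) X a \<theta> = tabulate n (Cod \<C> a) (\<lambda>Y v. \<theta> Y (pull (P n) a Y v))"
  "precomp_sharp R \<C> \<E> n C A \<delta> \<theta> = tabulate n A (\<lambda>Y v. \<theta> Y (up n C A \<delta> Y v))"
  by (simp_all add: Eneg_def nat_module_def hom_functor_def tabulate_def precomp_sharp_def)

lemma Eneg_carrier:
  "\<theta> \<in> carrier (val (N n) X A) \<longleftrightarrow> \<theta> \<in> extensional (Ob \<C>) \<and>
    (\<forall>Y\<in>Ob \<C>. linear_map R (val (P n) A Y) (Hom \<C> X Y) (\<theta> Y) \<and>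
      \<theta> Y \<in> extensional (carrier (val (P n) A Y))) \<and>
    (\<forall>Y Y' f v. f \<in> arr \<C> Y Y' \<longrightarrow> v \<in> elt \<C> (P n) A Y \<longrightarrow>
      \<theta> Y' (push (P n) A f v) = f \<cdot> \<theta> Y v)"
  by (simp add: Eneg_def nat_module_def hom_functor_def)

lemma EnegD:
  assumes "\<theta> \<in> elt \<C> (N n) X A"
  shows Eneg_linear: "Y \<in> Ob \<C> \<Longrightarrow> linear_map R (val (P n) A Y) (Hom \<C> X Y) (\<theta> Y)"
    and Eneg_natural: "f \<in> arr \<C> Y Y' \<Longrightarrow> v \<in> elt \<C> (P n) A Y \<Longrightarrow> \<theta> Y' (push (P n) A f v) = f \<cdot> \<theta> Y v"
    and Eneg_arr: "v \<in> elt \<C> (P n) A Y \<Longrightarrow> \<theta> Y v \<in> arr \<C> X Y"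
proof -
  show 1: "Y \<in> Ob \<C> \<Longrightarrow> linear_map R (val (P n) A Y) (Hom \<C> X Y) (\<theta> Y)"
    and "f \<in> arr \<C> Y Y' \<Longrightarrow> v \<in> elt \<C> (P n) A Y \<Longrightarrow> \<theta> Y' (push (P n) A f v) = f \<cdot> \<theta> Y v"
    using assms by (auto simp: elt_def Eneg_carrier)
  assume "v \<in> elt \<C> (P n) A Y"
  then show "\<theta> Y v \<in> arr \<C> X Y"
    using linear_map_closed[OF 1] eltD[OF assms] by (auto simp: arr_def elt_def)
qed

lemma Eneg_eqI:
  assumes "\<theta> \<in> elt \<C> (N n) X A" "\<theta>' \<in> elt \<C> (N n) X A"
    and "\<And>Y v. v \<in> elt \<C> (P n) A Y \<Longrightarrow> \<theta> Y v = \<theta>' Y v"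
  shows "\<theta> = \<theta>'"
proof (rule extensionalityI[of _ "Ob \<C>"])
  fix Y assume Y: "Y \<in> Ob \<C>"
  show "\<theta> Y = \<theta>' Y"
    by (rule extensionalityI[of _ "carrier (val (P n) A Y)"])
      (use assms Y in \<open>auto simp: elt_def Eneg_carrier\<close>)
qed (use assms in \<open>auto simp: elt_def Eneg_carrier\<close>)

lemma tabulate_closed:
  assumes X: "X \<in> Ob \<C>" and A: "A \<in> Ob \<C>"
    and lin: "\<And>Y. Y \<in> Ob \<C> \<Longrightarrow> linear_map R (val (P n) A Y) (Hom \<C> X Y) (t Y)"
    and nat: "\<And>f Y Y' v. f \<in> arr \<C> Y Y' \<Longrightarrow> v \<in> elt \<C> (P n) A Y \<Longrightarrow>
      t Y' (push (P n) A f v) = f \<cdot> t Y v"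
  shows "tabulate n A t \<in> elt \<C> (N n) X A"
proof (rule eltI[OF X A])
  have lin': "linear_map R (val (P n) A Y) (Hom \<C> X Y) (tabulate n A t Y)" if Y: "Y \<in> Ob \<C>" for Y
    by (rule linear_map_cong[OF lin[OF Y] P.val_module[OF A Y]]) (rule tabulate_apply[OF eltI[OF A Y]])
  have nat': "tabulate n A t Y' (push (P n) A f v) = f \<cdot> tabulate n A t Y v"
    if "f \<in> arr \<C> Y Y'" "v \<in> elt \<C> (P n) A Y" for f Y Y' v
    using that nat[OF that] by (simp add: tabulate_apply P.push_closed)
  show "tabulate n A t \<in> carrier (val (N n) X A)"
    unfolding Eneg_carrier using lin' nat' by (auto simp: tabulate_def)
qed

lemma Eneg_add_closed:
  assumes "\<theta> \<in> elt \<C> (N n) X A" "\<theta>' \<in> elt \<C> (N n) X A"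
  shows "\<theta> \<oplus>\<^bsub>val (N n) X A\<^esub> \<theta>' \<in> elt \<C> (N n) X A"
  unfolding Eneg_simps
proof (rule tabulate_closed)
  note X = eltD(1)[OF assms(1)]
  fix Y assume "Y \<in> Ob \<C>"
  then show "linear_map R (val (P n) A Y) (Hom \<C> X Y) (\<lambda>v. \<theta> Y v \<oplus>\<^bsub>Hom \<C> X Y\<^esub> \<theta>' Y v)"
    by (intro linear_map_sum Eneg_linear[OF assms(1)] Eneg_linear[OF assms(2)] Hom_module X)
qed (use assms in \<open>auto simp: Eneg_natural[OF assms(1)] Eneg_natural[OF assms(2)] cmp_add_right
        Eneg_arr[OF assms(1)] Eneg_arr[OF assms(2)] eltD\<close>)

lemma Eneg_smult_closed:
  assumes "r \<in> carrier R" "\<theta> \<in> elt \<C> (N n) X A"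
  shows "r \<odot>\<^bsub>val (N n) X A\<^esub> \<theta> \<in> elt \<C> (N n) X A"
  unfolding Eneg_simps
proof (rule tabulate_closed)
  note X = eltD(1)[OF assms(2)]
  fix Y assume "Y \<in> Ob \<C>"
  then show "linear_map R (val (P n) A Y) (Hom \<C> X Y) (\<lambda>v. r \<odot>\<^bsub>Hom \<C> X Y\<^esub> \<theta> Y v)"
    by (intro linear_map_scale Eneg_linear[OF assms(2)] Hom_module X assms(1))
qed (use assms in \<open>auto simp: Eneg_natural[OF assms(2)] cmp_smult_right Eneg_arr[OF assms(2)] eltD\<close>)

lemma Eneg_zero_closed:
  assumes "X \<in> Ob \<C>" "A \<in> Ob \<C>"
  shows "\<zero>\<^bsub>val (N n) X A\<^esub> \<in> elt \<C> (N n) X A"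
  unfolding Eneg_simps using assms
  by (intro tabulate_closed linear_map_const_zero Hom_module) (simp_all add: cmp_zero_right)

lemma Eneg_apply:
  assumes "v \<in> elt \<C> (P n) A Y"
  shows "(\<theta> \<oplus>\<^bsub>val (N n) X A\<^esub> \<theta>') Y v = \<theta> Y v \<oplus>\<^bsub>Hom \<C> X Y\<^esub> \<theta>' Y v"
    and "(r \<odot>\<^bsub>val (N n) X A\<^esub> \<theta>) Y v = r \<odot>\<^bsub>Hom \<C> X Y\<^esub> \<theta> Y v"
    and "\<zero>\<^bsub>val (N n) X A\<^esub> Y v = \<zero>\<^bsub>Hom \<C> X Y\<^esub>"
    and "pull (N n) c A \<theta> Y v = \<theta> Y v \<cdot> c"
    and "a \<in> arr \<C> B A \<Longrightarrow> push (N n) X a \<theta> Y v = \<theta> Y (pull (P n) a Y v)"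
    and "precomp_sharp R \<C> \<E> n C A \<delta> \<theta> Y v = \<theta> Y (up n C A \<delta> Y v)"
  using assms by (simp_all add: Eneg_simps tabulate_apply Cod_arr)

lemma module_Eneg:
  assumes X: "X \<in> Ob \<C>" and A: "A \<in> Ob \<C>"
  shows "module R (val (N n) X A)"
proof -
  interpret R: cring R by (rule R_cring)
  have car: "\<theta> \<in> carrier (val (N n) X A) \<longleftrightarrow> \<theta> \<in> elt \<C> (N n) X A" for \<theta>
    using X A by (simp add: elt_def)
  note mod = Hom_module[OF X eltD(2)]
  show ?thesis
  proof (intro moduleI abelian_groupI; (unfold car)?)
    fix \<theta> assume t: "\<theta> \<in> elt \<C> (N n) X A"
    note ta = Eneg_arr[OF t, THEN arrD(3)]
    define \<nu> where "\<nu> = (\<ominus>\<^bsub>R\<^esub> \<one>\<^bsub>R\<^esub>) \<odot>\<^bsub>val (N n) X A\<^esub> \<theta>"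
    have nu: "\<nu> \<in> elt \<C> (N n) X A" unfolding \<nu>_def by (intro Eneg_smult_closed t) simp
    have "\<nu> \<oplus>\<^bsub>val (N n) X A\<^esub> \<theta> = \<zero>\<^bsub>val (N n) X A\<^esub>"
    proof (rule Eneg_eqI[OF Eneg_add_closed[OF nu t] Eneg_zero_closed[OF X A]])
      fix Y v assume v: "v \<in> elt \<C> (P n) A Y"
      interpret H: module R "Hom \<C> X Y" by (rule mod[OF v])
      show "(\<nu> \<oplus>\<^bsub>val (N n) X A\<^esub> \<theta>) Y v = \<zero>\<^bsub>val (N n) X A\<^esub> Y v"
        using ta[OF v] by (simp add: \<nu>_def Eneg_apply[OF v] H.smult_l_minus H.l_neg)
    qed
    with nu show "\<exists>\<nu>\<in>carrier (val (N n) X A). \<nu> \<oplus>\<^bsub>val (N n) X A\<^esub> \<theta> = \<zero>\<^bsub>val (N n) X A\<^esub>"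
      by (auto simp: elt_def)
    show "\<zero>\<^bsub>val (N n) X A\<^esub> \<oplus>\<^bsub>val (N n) X A\<^esub> \<theta> = \<theta>"
    proof (rule Eneg_eqI[OF Eneg_add_closed[OF Eneg_zero_closed[OF X A] t] t])
      fix Y v assume v: "v \<in> elt \<C> (P n) A Y"
      interpret H: module R "Hom \<C> X Y" by (rule mod[OF v])
      show "(\<zero>\<^bsub>val (N n) X A\<^esub> \<oplus>\<^bsub>val (N n) X A\<^esub> \<theta>) Y v = \<theta> Y v"
        using ta[OF v] by (simp add: Eneg_apply[OF v])
    qed
    show "\<one>\<^bsub>R\<^esub> \<odot>\<^bsub>val (N n) X A\<^esub> \<theta> = \<theta>"
    proof (rule Eneg_eqI[OF Eneg_smult_closed[OF R.one_closed t] t])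
      fix Y v assume v: "v \<in> elt \<C> (P n) A Y"
      interpret H: module R "Hom \<C> X Y" by (rule mod[OF v])
      show "(\<one>\<^bsub>R\<^esub> \<odot>\<^bsub>val (N n) X A\<^esub> \<theta>) Y v = \<theta> Y v"
        using ta[OF v] by (simp add: Eneg_apply[OF v])
    qed
    {
      fix r r' assume r: "r \<in> carrier R" "r' \<in> carrier R"
      show "(r \<oplus>\<^bsub>R\<^esub> r') \<odot>\<^bsub>val (N n) X A\<^esub> \<theta> =
          r \<odot>\<^bsub>val (N n) X A\<^esub> \<theta> \<oplus>\<^bsub>val (N n) X A\<^esub> r' \<odot>\<^bsub>val (N n) X A\<^esub> \<theta>" (is "?l = ?r")
      proof (rule Eneg_eqI)
        fix Y v assume v: "v \<in> elt \<C> (P n) A Y"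
        interpret H: module R "Hom \<C> X Y" by (rule mod[OF v])
        show "?l Y v = ?r Y v"
          using ta[OF v] r by (simp add: Eneg_apply[OF v] H.smult_l_distr)
      qed (use r t in \<open>auto intro!: Eneg_smult_closed Eneg_add_closed\<close>)
      show "(r \<otimes>\<^bsub>R\<^esub> r') \<odot>\<^bsub>val (N n) X A\<^esub> \<theta> = r \<odot>\<^bsub>val (N n) X A\<^esub> (r' \<odot>\<^bsub>val (N n) X A\<^esub> \<theta>)" (is "?l = ?r")
      proof (rule Eneg_eqI)
        fix Y v assume v: "v \<in> elt \<C> (P n) A Y"
        interpret H: module R "Hom \<C> X Y" by (rule mod[OF v])
        show "?l Y v = ?r Y v"
          using ta[OF v] r by (simp add: Eneg_apply[OF v] H.smult_assoc1)
      qed (use r t in \<open>auto intro!: Eneg_smult_closed\<close>)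
    }
    fix \<theta>' assume t': "\<theta>' \<in> elt \<C> (N n) X A"
    note ta' = Eneg_arr[OF t', THEN arrD(3)]
    show "\<theta> \<oplus>\<^bsub>val (N n) X A\<^esub> \<theta>' = \<theta>' \<oplus>\<^bsub>val (N n) X A\<^esub> \<theta>"
    proof (rule Eneg_eqI[OF Eneg_add_closed[OF t t'] Eneg_add_closed[OF t' t]])
      fix Y v assume v: "v \<in> elt \<C> (P n) A Y"
      interpret H: module R "Hom \<C> X Y" by (rule mod[OF v])
      show "(\<theta> \<oplus>\<^bsub>val (N n) X A\<^esub> \<theta>') Y v = (\<theta>' \<oplus>\<^bsub>val (N n) X A\<^esub> \<theta>) Y v"
        using ta[OF v] ta'[OF v] by (simp add: Eneg_apply[OF v] H.a_comm)
    qed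
    {
      fix r assume r: "r \<in> carrier R"
      show "r \<odot>\<^bsub>val (N n) X A\<^esub> (\<theta> \<oplus>\<^bsub>val (N n) X A\<^esub> \<theta>') =
          r \<odot>\<^bsub>val (N n) X A\<^esub> \<theta> \<oplus>\<^bsub>val (N n) X A\<^esub> r \<odot>\<^bsub>val (N n) X A\<^esub> \<theta>'" (is "?l = ?r")
      proof (rule Eneg_eqI)
        fix Y v assume v: "v \<in> elt \<C> (P n) A Y"
        interpret H: module R "Hom \<C> X Y" by (rule mod[OF v])
        show "?l Y v = ?r Y v"
          using ta[OF v] ta'[OF v] r by (simp add: Eneg_apply[OF v] H.smult_r_distr)
      qed (use r t t' in \<open>auto intro!: Eneg_smult_closed Eneg_add_closed\<close>)
    }
    fix \<theta>'' assume t'': "\<theta>'' \<in> elt \<C> (N n) X A"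
    note ta'' = Eneg_arr[OF t'', THEN arrD(3)]
    show "(\<theta> \<oplus>\<^bsub>val (N n) X A\<^esub> \<theta>') \<oplus>\<^bsub>val (N n) X A\<^esub> \<theta>'' =
        \<theta> \<oplus>\<^bsub>val (N n) X A\<^esub> (\<theta>' \<oplus>\<^bsub>val (N n) X A\<^esub> \<theta>'')" (is "?l = ?r")
    proof (rule Eneg_eqI)
      fix Y v assume v: "v \<in> elt \<C> (P n) A Y"
      interpret H: module R "Hom \<C> X Y" by (rule mod[OF v])
      show "?l Y v = ?r Y v"
        using ta[OF v] ta'[OF v] ta''[OF v] by (simp add: Eneg_apply[OF v] H.a_assoc)
    qed (use t t' t'' in \<open>auto intro!: Eneg_add_closed\<close>)
  qed (auto intro: R_cring Eneg_smult_closed Eneg_add_closed Eneg_zero_closed X A)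
qed

lemma Eneg_pull_closed:
  assumes c: "c \<in> arr \<C> X' X" and t: "\<theta> \<in> elt \<C> (N n) X A"
  shows "pull (N n) c A \<theta> \<in> elt \<C> (N n) X' A"
  unfolding Eneg_simps
proof (rule tabulate_closed[OF arrD(1)[OF c] eltD(2)[OF t]])
  show "Y \<in> Ob \<C> \<Longrightarrow> linear_map R (val (P n) A Y) (Hom \<C> X' Y) (\<lambda>v. \<theta> Y v \<cdot> c)" for Y
    by (rule linear_map_compose[OF Eneg_linear[OF t] cmp_linear_left[OF c]])
qed (simp add: Eneg_natural[OF t] cmp_assoc[OF c Eneg_arr[OF t]])

lemma Eneg_push_closed:
  assumes a: "a \<in> arr \<C> A A'" and t: "\<theta> \<in> elt \<C> (N n) X A"
  shows "push (N n) X a \<theta> \<in> elt \<C> (N n) X A'"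
  unfolding Eneg_simps Cod_arr[OF a]
proof (rule tabulate_closed[OF eltD(1)[OF t] arrD(2)[OF a]])
  show "Y \<in> Ob \<C> \<Longrightarrow> linear_map R (val (P n) A' Y) (Hom \<C> X Y) (\<lambda>v. \<theta> Y (pull (P n) a Y v))" for Y
    by (rule linear_map_compose[OF P.pull_linear[OF a] Eneg_linear[OF t]])
qed (simp add: P.pull_push[OF a] Eneg_natural[OF t] P.pull_closed[OF a])

lemma precomp_closed:
  assumes d: "\<delta> \<in> elt \<C> \<E> C A" and t: "\<theta> \<in> elt \<C> (N (Suc n)) X C"
  shows "precomp_sharp R \<C> \<E> n C A \<delta> \<theta> \<in> elt \<C> (N n) X A"
  unfolding Eneg_simps
proof (rule tabulate_closed[OF eltD(1)[OF t] eltD(2)[OF d]])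
  show "Y \<in> Ob \<C> \<Longrightarrow> linear_map R (val (P n) A Y) (Hom \<C> X Y) (\<lambda>v. \<theta> Y (up n C A \<delta> Y v))" for Y
    by (rule linear_map_compose[OF balanced_left[OF up_balanced[OF eltD(1)[OF d]] d] Eneg_linear[OF t]])
qed (simp add: up_push[OF _ _ d, symmetric] Eneg_natural[OF t] up_closed[OF _ d])

lemma bilinear_functor_Eneg: "bilinear_functor R \<C> (N n)"
proof (rule bilinear_functor.intro[OF linear_category_axioms], rule bilinear_functor_axioms.intro)
  note closed = Eneg_pull_closed Eneg_push_closed Eneg_add_closed Eneg_smult_closed
  {
    fix f X' X Y assume f: "f \<in> arr \<C> X' X" and Y: "Y \<in> Ob \<C>"
    note X' = arrD(1)[OF f] and X = arrD(2)[OF f]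
    show "linear_map R (val (N n) X Y) (val (N n) X' Y) (pull (N n) f Y)"
    proof (rule linear_mapI)
      fix u assume "u \<in> carrier (val (N n) X Y)"
      then have u: "u \<in> elt \<C> (N n) X Y" using X Y by (simp add: elt_def)
      show "pull (N n) f Y u \<in> carrier (val (N n) X' Y)"
        by (rule eltD(3)[OF Eneg_pull_closed[OF f u]])
      {
        fix r assume r: "r \<in> carrier R"
        show "pull (N n) f Y (r \<odot>\<^bsub>val (N n) X Y\<^esub> u) = r \<odot>\<^bsub>val (N n) X' Y\<^esub> pull (N n) f Y u"
          by (rule Eneg_eqI) (auto simp: Eneg_apply Eneg_arr[OF u] cmp_smult_left[OF f _ r] intro!: closed f u r)
      }
      fix v assume "v \<in> carrier (val (N n) X Y)"
      then have v: "v \<in> elt \<C> (N n) X Y" using X Y by (simp add: elt_def)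
      show "pull (N n) f Y (u \<oplus>\<^bsub>val (N n) X Y\<^esub> v) = pull (N n) f Y u \<oplus>\<^bsub>val (N n) X' Y\<^esub> pull (N n) f Y v"
        by (rule Eneg_eqI) (auto simp: Eneg_apply Eneg_arr[OF u] Eneg_arr[OF v] cmp_add_left[OF f] intro!: closed f u v)
    qed
  }
  {
    fix g Y Y' X assume g: "g \<in> arr \<C> Y Y'" and X: "X \<in> Ob \<C>"
    note Y = arrD(1)[OF g] and Y' = arrD(2)[OF g]
    show "linear_map R (val (N n) X Y) (val (N n) X Y') (push (N n) X g)"
    proof (rule linear_mapI)
      fix u assume "u \<in> carrier (val (N n) X Y)"
      then have u: "u \<in> elt \<C> (N n) X Y" using X Y by (simp add: elt_def)
      show "push (N n) X g u \<in> carrier (val (N n) X Y')"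
        by (rule eltD(3)[OF Eneg_push_closed[OF g u]])
      {
        fix r assume r: "r \<in> carrier R"
        show "push (N n) X g (r \<odot>\<^bsub>val (N n) X Y\<^esub> u) = r \<odot>\<^bsub>val (N n) X Y'\<^esub> push (N n) X g u"
          by (rule Eneg_eqI) (auto simp: Eneg_apply(1-4) Eneg_apply(5)[OF _ g] P.pull_closed[OF g] intro!: closed g u r)
      }
      fix v assume "v \<in> carrier (val (N n) X Y)"
      then have v: "v \<in> elt \<C> (N n) X Y" using X Y by (simp add: elt_def)
      show "push (N n) X g (u \<oplus>\<^bsub>val (N n) X Y\<^esub> v) = push (N n) X g u \<oplus>\<^bsub>val (N n) X Y'\<^esub> push (N n) X g v"
        by (rule Eneg_eqI) (auto simp: Eneg_apply(1-4) Eneg_apply(5)[OF _ g] P.pull_closed[OF g] intro!: closed g u v)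
    qed
  }
  {
    fix v X Y assume v: "v \<in> elt \<C> (N n) X Y"
    note X = eltD(1)[OF v] and Y = eltD(2)[OF v]
    show "pull (N n) (Idn \<C> X) Y v = v"
      by (rule Eneg_eqI) (auto simp: Eneg_apply cmp_Idn_right[OF Eneg_arr[OF v]] intro!: closed v Idn_arr X)
    show "push (N n) X (Idn \<C> Y) v = v"
      by (rule Eneg_eqI) (auto simp: Eneg_apply(5)[OF _ Idn_arr[OF Y]] P.pull_Idn intro!: closed v Idn_arr Y)
  }
  {
    fix f X' X Y v assume f: "f \<in> arr \<C> X' X" and v: "v \<in> elt \<C> (N n) X Y"
    note X = eltD(1)[OF v] and Y = eltD(2)[OF v] and X' = arrD(1)[OF f]
    {
      fix f' X'' assume f': "f' \<in> arr \<C> X'' X'"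
      show "pull (N n) (f \<cdot> f') Y v = pull (N n) f' Y (pull (N n) f Y v)"
        by (rule Eneg_eqI) (auto simp: Eneg_apply cmp_assoc[OF f' f Eneg_arr[OF v]] intro!: closed v f f' cmp_arr[OF f' f])
    }
    {
      fix f' assume f': "f' \<in> arr \<C> X' X"
      interpret H: module R "Hom \<C> X' X" by (rule Hom_module[OF X' X])
      have s: "f \<oplus>\<^bsub>Hom \<C> X' X\<^esub> f' \<in> arr \<C> X' X" using f f' by (simp add: arr_def)
      show "pull (N n) (f \<oplus>\<^bsub>Hom \<C> X' X\<^esub> f') Y v = pull (N n) f Y v \<oplus>\<^bsub>val (N n) X' Y\<^esub> pull (N n) f' Y v"
        by (rule Eneg_eqI) (auto simp: Eneg_apply cmp_add_right[OF Eneg_arr[OF v] f f'] intro!: closed v f f' s)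
    }
    {
      fix r assume r: "r \<in> carrier R"
      interpret H: module R "Hom \<C> X' X" by (rule Hom_module[OF X' X])
      have s: "r \<odot>\<^bsub>Hom \<C> X' X\<^esub> f \<in> arr \<C> X' X" using f r by (simp add: arr_def)
      show "pull (N n) (r \<odot>\<^bsub>Hom \<C> X' X\<^esub> f) Y v = r \<odot>\<^bsub>val (N n) X' Y\<^esub> pull (N n) f Y v"
        by (rule Eneg_eqI) (auto simp: Eneg_apply cmp_smult_right[OF Eneg_arr[OF v] f r] intro!: closed v f r s)
    }
    {
      fix g Y' assume g: "g \<in> arr \<C> Y Y'"
      show "pull (N n) f Y' (push (N n) X g v) = push (N n) X' g (pull (N n) f Y v)"
        by (rule Eneg_eqI) (auto simp: Eneg_apply(1-4) Eneg_apply(5)[OF _ g] P.pull_closed[OF g] intro!: closed v f g)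
    }
  }
  {
    fix g Y Y' X v assume g: "g \<in> arr \<C> Y Y'" and v: "v \<in> elt \<C> (N n) X Y"
    note X = eltD(1)[OF v] and Y = eltD(2)[OF v] and Y' = arrD(2)[OF g]
    {
      fix g' Y'' assume g': "g' \<in> arr \<C> Y' Y''"
      note gg = cmp_arr[OF g g']
      show "push (N n) X (g' \<cdot> g) v = push (N n) X g' (push (N n) X g v)"
        by (rule Eneg_eqI) (auto simp: Eneg_apply(5)[OF _ g] Eneg_apply(5)[OF _ g'] Eneg_apply(5)[OF _ gg]
            P.pull_closed[OF g'] P.pull_cmp[OF g' g] intro!: closed v g g' gg)
    }
    {
      fix g' assume g': "g' \<in> arr \<C> Y Y'"
      interpret H: module R "Hom \<C> Y Y'" by (rule Hom_module[OF Y Y'])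
      have s: "g \<oplus>\<^bsub>Hom \<C> Y Y'\<^esub> g' \<in> arr \<C> Y Y'" using g g' by (simp add: arr_def)
      show "push (N n) X (g \<oplus>\<^bsub>Hom \<C> Y Y'\<^esub> g') v = push (N n) X g v \<oplus>\<^bsub>val (N n) X Y'\<^esub> push (N n) X g' v"
        by (rule Eneg_eqI) (auto simp: Eneg_apply(1-4) Eneg_apply(5)[OF _ g] Eneg_apply(5)[OF _ g'] Eneg_apply(5)[OF _ s]
            P.pull_add[OF g g'] eltD(2) eltD(3)[OF P.pull_closed[OF g]] eltD(3)[OF P.pull_closed[OF g']]
            linear_map_add[OF Eneg_linear[OF v]] intro!: closed v g g' s)
    }
    {
      fix r assume r: "r \<in> carrier R"
      interpret H: module R "Hom \<C> Y Y'" by (rule Hom_module[OF Y Y'])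
      have s: "r \<odot>\<^bsub>Hom \<C> Y Y'\<^esub> g \<in> arr \<C> Y Y'" using g r by (simp add: arr_def)
      show "push (N n) X (r \<odot>\<^bsub>Hom \<C> Y Y'\<^esub> g) v = r \<odot>\<^bsub>val (N n) X Y'\<^esub> push (N n) X g v"
        by (rule Eneg_eqI) (auto simp: Eneg_apply(1-4) Eneg_apply(5)[OF _ g] Eneg_apply(5)[OF _ s]
            P.pull_smult[OF r g] eltD(2) eltD(3)[OF P.pull_closed[OF g]]
            linear_map_smult[OF Eneg_linear[OF v] r] intro!: closed v g r s)
    }
  }
qed (rule module_Eneg)

sublocale N: bilinear_functor R \<C> "N n" for n
  by (rule bilinear_functor_Eneg)

lemma precomp_linear:
  assumes d: "\<delta> \<in> elt \<C> \<E> C A" and X: "X \<in> Ob \<C>"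
  shows "linear_map R (val (N (Suc n)) X C) (val (N n) X A) (precomp_sharp R \<C> \<E> n C A \<delta>)"
proof (rule linear_mapI)
  note C = eltD(1)[OF d]
  fix u assume "u \<in> carrier (val (N (Suc n)) X C)"
  then have u: "u \<in> elt \<C> (N (Suc n)) X C" using X C by (simp add: elt_def)
  show "precomp_sharp R \<C> \<E> n C A \<delta> u \<in> carrier (val (N n) X A)"
    by (rule eltD(3)[OF precomp_closed[OF d u]])
  {
    fix r assume r: "r \<in> carrier R"
    show "precomp_sharp R \<C> \<E> n C A \<delta> (r \<odot>\<^bsub>val (N (Suc n)) X C\<^esub> u) =
        r \<odot>\<^bsub>val (N n) X A\<^esub> precomp_sharp R \<C> \<E> n C A \<delta> u"
      by (rule Eneg_eqI)
        (auto simp: Eneg_apply up_closed[OF _ d] intro!: precomp_closed d u r Eneg_smult_closed)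
  }
  fix v assume "v \<in> carrier (val (N (Suc n)) X C)"
  then have v: "v \<in> elt \<C> (N (Suc n)) X C" using X C by (simp add: elt_def)
  show "precomp_sharp R \<C> \<E> n C A \<delta> (u \<oplus>\<^bsub>val (N (Suc n)) X C\<^esub> v) =
      precomp_sharp R \<C> \<E> n C A \<delta> u \<oplus>\<^bsub>val (N n) X A\<^esub> precomp_sharp R \<C> \<E> n C A \<delta> v"
    by (rule Eneg_eqI)
      (auto simp: Eneg_apply up_closed[OF _ d] intro!: precomp_closed d u v Eneg_add_closed)
qed

lemma precomp_natural:
  assumes d: "\<delta> \<in> elt \<C> \<E> C A" and f: "f \<in> arr \<C> X' X" and u: "u \<in> elt \<C> (N (Suc n)) X C"
  shows "precomp_sharp R \<C> \<E> n C A \<delta> (pull (N (Suc n)) f C u) =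
    pull (N n) f A (precomp_sharp R \<C> \<E> n C A \<delta> u)"
  by (rule Eneg_eqI)
    (auto simp: Eneg_apply up_closed[OF _ d] intro!: precomp_closed d u f Eneg_pull_closed)

lemma precomp_ext_morphism:
  assumes m: "ext_morphism \<C> \<E> C A \<delta> C' A' \<delta>' a c" and u: "u \<in> elt \<C> (N (Suc n)) X C"
  shows "push (N n) X a (precomp_sharp R \<C> \<E> n C A \<delta> u) =
    precomp_sharp R \<C> \<E> n C' A' \<delta>' (push (N (Suc n)) X c u)"
proof -
  have d: "\<delta> \<in> elt \<C> \<E> C A" "\<delta>' \<in> elt \<C> \<E> C' A'" and a: "a \<in> arr \<C> A A'" and c: "c \<in> arr \<C> C C'"
    using m by (simp_all add: ext_morphism_def)
  show ?thesis
    by (rule Eneg_eqI)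
      (auto simp: Eneg_apply(5)[OF _ a] Eneg_apply(5)[OF _ c] Eneg_apply(6) up_closed[OF _ d(1)]
        up_closed[OF _ d(2)] P.pull_closed[OF a] up_ext_morphism[OF m]
        intro!: precomp_closed d u a c Eneg_push_closed)
qed

lemma up_0_Idn: "\<delta> \<in> elt \<C> \<E> C A \<Longrightarrow> up 0 C A \<delta> A (HomEl (Idn \<C> A)) = ExtEl \<delta>"
  by (simp add: upper_sharp_0 push_Idn)

lemma HomEl_Idn: "A \<in> Ob \<C> \<Longrightarrow> HomEl (Idn \<C> A) \<in> elt \<C> (P 0) A A"
  unfolding elt_P0 using Idn_arr by blast

lemma ExtEl_elt: "\<delta> \<in> elt \<C> \<E> C A \<Longrightarrow> ExtEl \<delta> \<in> elt \<C> (P (Suc 0)) C A"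
  unfolding elt_P1 by blast

abbreviation "I n \<equiv> EI R \<C> \<E> n"
abbreviation "I_sharp n \<equiv> EI_sharp R \<C> \<E> n"

lemma nat_degree:
  "nat (1 + int k) = Suc k" "nat (2 + int k) = Suc (Suc k)"
  "nat (int k + 1) = Suc k" "nat (int k + 2) = Suc (Suc k)"
  by simp_all

lemma EI_cases:
  "I (int k) = transport Inl (P k)"
  "I (int k + 1) = transport Inl (P (Suc k))"
  "I (- 1) = transport Inr (N (Suc 0))"
  "I 0 = transport Inl (P 0)"
  "I (- int (Suc (Suc k))) = transport Inr (N (Suc (Suc k)))"
  "I (- int (Suc (Suc k)) + 1) = transport Inr (N (Suc k))"
  "I (- int (Suc k)) = transport Inr (N (Suc k))"
  by (simp_all add: EI_def nat_degree)

lemma EI_sharp_cases: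
  "I_sharp (int k) C A \<delta> X (Inl u) = Inl (low k C A \<delta> X u)"
  "\<delta> \<in> elt \<C> \<E> C A \<Longrightarrow> I_sharp (- 1) C A \<delta> X (Inr \<theta>) = Inl (HomEl (\<theta> A (ExtEl \<delta>)))"
  "I_sharp (- int (Suc (Suc k))) C A \<delta> X (Inr \<theta>) = Inr (precomp_sharp R \<C> \<E> (Suc k) C A \<delta> \<theta>)"
  using Eneg_apply(6)[OF HomEl_Idn[of A], of C \<delta> \<theta>]
  by (simp_all add: EI_sharp_def up_0_Idn eltD(2) nat_add_distrib)

lemma int_degree_cases:
  obtains k where "n = int k" | "n = - 1" | k where "n = - int (Suc (Suc k))"
proof (cases "n \<ge> 0")
  case True
  then show ?thesis using that(1)[of "nat n"] by simp
next
  case False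
  show ?thesis
  proof (cases "n = - 1")
    case True
    then show ?thesis by (rule that(2))
  next
    case False
    with \<open>\<not> n \<ge> 0\<close> show ?thesis using that(3)[of "nat (- n - 2)"] by simp
  qed
qed

text \<open>
  From degree \<open>-1\<close> to degree \<open>0\<close>, naturality with respect to a morphism of extensions
  \<open>(a, c) : \<delta> \<rightarrow> \<delta>'\<close> reads \<open>a \<cdot> \<theta>(\<delta>) = \<theta>(a\<^sub>*\<delta>) = \<theta>(c\<^sup>*\<delta>')\<close>, by naturality of \<open>\<theta>\<close>.  From lower
  degrees it is the compatibility of \<open>\<delta>\<^sup>\<sharp>\<close> with \<open>(a, c)\<close>.
\<close>

lemma connected_sequence_EI: "connected_sequence R \<C> \<E> (EI R \<C> \<E>) (EI_sharp R \<C> \<E>)"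
proof (rule connected_sequence.intro[OF linear_category_axioms], rule connected_sequence_axioms.intro)
  fix n
  show "bilinear_functor R \<C> (I n)"
    by (simp add: EI_def P.bilinear_functor_transport N.bilinear_functor_transport)
next
  fix \<delta> C A X n assume d: "\<delta> \<in> elt \<C> \<E> C A" and X: "X \<in> Ob \<C>"
  show "linear_map R (val (I n) X C) (val (I (n + 1)) X A) (I_sharp n C A \<delta> X)"
  proof (cases n rule: int_degree_cases)
    case (1 k)
    show ?thesis
      unfolding 1 EI_cases transport_simps linear_map_from_transport[OF inj_Inl] EI_sharp_cases
      by (rule linear_map_compose[OF low_linear[OF d X] linear_map_transport[OF inj_Inl]])
  next
    case 2
    have "linear_map R (val (N (Suc 0)) X C) (Hom \<C> X A) (\<lambda>\<theta>. \<theta> A (ExtEl \<delta>))"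
    proof (rule linear_mapI)
      fix u assume "u \<in> carrier (val (N (Suc 0)) X C)"
      then have "u \<in> elt \<C> (N (Suc 0)) X C" using X d by (simp add: elt_def)
      then show "u A (ExtEl \<delta>) \<in> carrier (Hom \<C> X A)"
        by (rule arrD(3)[OF Eneg_arr[OF _ ExtEl_elt[OF d]]])
    qed (simp_all add: Eneg_apply[OF ExtEl_elt[OF d]])
    then have "linear_map R (val (N (Suc 0)) X C) (val (transport Inl (P 0)) X A) (\<lambda>\<theta>. Inl (HomEl (\<theta> A (ExtEl \<delta>))))"
      unfolding transport_simps val_P0
      by (intro linear_map_compose[OF linear_map_compose[OF _ linear_map_transport[OF inj_pext(1)]]
            linear_map_transport[OF inj_Inl]])
    then show ?thesis
      unfolding 2 by (simp add: EI_cases linear_map_from_transport EI_sharp_cases(2)[OF d])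
  next
    case (3 k)
    show ?thesis
      unfolding 3 EI_cases transport_simps linear_map_from_transport[OF inj_Inr] EI_sharp_cases
      by (rule linear_map_compose[OF precomp_linear[OF d X] linear_map_transport[OF inj_Inr]])
  qed
next
  fix \<delta> C A f X' X v n
  assume d: "\<delta> \<in> elt \<C> \<E> C A" and f: "f \<in> arr \<C> X' X" and v: "v \<in> elt \<C> (I n) X C"
  show "I_sharp n C A \<delta> X' (pull (I n) f C v) = pull (I (n + 1)) f A (I_sharp n C A \<delta> X v)"
  proof (cases n rule: int_degree_cases)
    case (1 k)
    with v obtain u where "u \<in> elt \<C> (P k) X C" "v = Inl u" by (auto simp: EI_cases elt_transport)
    then show ?thesis
      unfolding 1 EI_cases by (simp add: EI_sharp_cases low_natural[OF d f])
  next
    case 2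
    with v obtain u where u: "u \<in> elt \<C> (N (Suc 0)) X C" "v = Inr u" by (auto simp: EI_cases elt_transport)
    then show ?thesis
      unfolding 2 by (simp add: EI_cases EI_sharp_cases(2)[OF d] pull_P0 Eneg_apply[OF ExtEl_elt[OF d]])
  next
    case (3 k)
    from v obtain u where "u \<in> elt \<C> (N (Suc (Suc k))) X C" "v = Inr u"
      unfolding 3 EI_cases elt_transport by blast
    then show ?thesis
      unfolding 3 EI_cases by (simp only: EI_sharp_cases precomp_natural[OF d f] transport_simps inj_Inr)
  qed
next
  fix C A \<delta> C' A' \<delta>' a c v n X
  assume m: "ext_morphism \<C> \<E> C A \<delta> C' A' \<delta>' a c" and v: "v \<in> elt \<C> (I n) X C"
  have d: "\<delta> \<in> elt \<C> \<E> C A" "\<delta>' \<in> elt \<C> \<E> C' A'" and a: "a \<in> arr \<C> A A'" and c: "c \<in> arr \<C> C C'"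
    and eq: "push \<E> C a \<delta> = pull \<E> c A' \<delta>'"
    using m by (simp_all add: ext_morphism_def)
  show "push (I (n + 1)) X a (I_sharp n C A \<delta> X v) = I_sharp n C' A' \<delta>' X (push (I n) X c v)"
  proof (cases n rule: int_degree_cases)
    case (1 k)
    with v obtain u where "u \<in> elt \<C> (P k) X C" "v = Inl u" by (auto simp: EI_cases elt_transport)
    then show ?thesis
      unfolding 1 EI_cases by (simp add: EI_sharp_cases low_ext_morphism[OF m])
  next
    case 2
    with v obtain u where u: "u \<in> elt \<C> (N (Suc 0)) X C" "v = Inr u" by (auto simp: EI_cases elt_transport)
    \<comment> \<open>\<open>u\<close> is a natural transformation \<open>\<E>(C, -) \<rightarrow> \<C>(X, -)\<close>, evaluated at \<open>\<delta>\<close>.\<close>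
    have "a \<cdot> u A (ExtEl \<delta>) = u A' (ExtEl (push \<E> C a \<delta>))"
      using Eneg_natural[OF u(1) a ExtEl_elt[OF d(1)]] by (simp add: push_P1)
    also have "\<dots> = push (N (Suc 0)) X c u A' (ExtEl \<delta>')"
      by (simp add: Eneg_apply(5)[OF ExtEl_elt[OF d(2)] c] pull_P1 eq)
    finally show ?thesis
      unfolding 2 u(2) by (simp add: EI_cases EI_sharp_cases(2)[OF d(1)] EI_sharp_cases(2)[OF d(2)] push_P0)
  next
    case (3 k)
    from v obtain u where "u \<in> elt \<C> (N (Suc (Suc k))) X C" "v = Inr u"
      unfolding 3 EI_cases elt_transport by blast
    then show ?thesis
      unfolding 3 EI_cases by (simp only: EI_sharp_cases precomp_ext_morphism[OF m] transport_simps inj_Inr)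
  qed
qed

lemma canonical_nonneg_EI: "canonical_nonneg R \<C> \<E> (EI R \<C> \<E>) (EI_sharp R \<C> \<E>)"
  by (simp add: canonical_nonneg_def same_functor_def same_module_def EI_cases EI_sharp_cases)

end


section \<open>The pairing of positive with negative degrees\<close>

locale canonical_sequence = additive_category R \<C> + ext_bifunctor R \<C> \<E> + connected_sequence R \<C> \<E> F d
  for R :: "'r ring" and \<C> :: "('r, 'o, 'm) lincat" (structure)
    and \<E> :: "('r, 'o, 'm, 'e) bifun"
    and F :: "int \<Rightarrow> ('r, 'o, 'm, ('o, 'm, 'e) pext + 'f) bifun"
    and d :: "int \<Rightarrow> 'o \<Rightarrow> 'o \<Rightarrow> 'e \<Rightarrow> 'o \<Rightarrow> ('o, 'm, 'e) pext + 'f \<Rightarrow> ('o, 'm, 'e) pext + 'f" +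
  assumes canonical: "canonical_nonneg R \<C> \<E> F d"
begin

text \<open>
  The nonpositive degrees indexed by natural numbers, so that \<open>D n\<close> maps \<open>Q (n + 1)\<close> to \<open>Q n\<close>.
\<close>

definition "Q n = F (- int n)"
definition "D n = d (- int (Suc n))"

sublocale Q: bilinear_functor R \<C> "Q n" for n
  unfolding Q_def by (rule functors)

lemma succ_degree: "- int (Suc n) + 1 = - int n"
  by simp

lemma D_linear:
  "\<delta> \<in> elt \<C> \<E> C A \<Longrightarrow> X \<in> Ob \<C> \<Longrightarrow> linear_map R (val (Q (Suc n)) X C) (val (Q n) X A) (D n C A \<delta> X)"
  using d_linear[of \<delta> C A X "- int (Suc n)"] unfolding succ_degree by (simp only: Q_def D_def)

lemma D_natural:
  "\<lbrakk>\<delta> \<in> elt \<C> \<E> C A; f \<in> arr \<C> X' X; v \<in> elt \<C> (Q (Suc n)) X C\<rbrakk>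
    \<Longrightarrow> D n C A \<delta> X' (pull (Q (Suc n)) f C v) = pull (Q n) f A (D n C A \<delta> X v)"
  using d_natural[of \<delta> C A f X' X v "- int (Suc n)"] unfolding succ_degree by (simp only: Q_def D_def)

lemma D_ext_morphism:
  "\<lbrakk>ext_morphism \<C> \<E> C A \<delta> C' A' \<delta>' a c; v \<in> elt \<C> (Q (Suc n)) X C\<rbrakk>
    \<Longrightarrow> push (Q n) X a (D n C A \<delta> X v) = D n C' A' \<delta>' X (push (Q (Suc n)) X c v)"
  using d_ext_morphism[of C A \<delta> C' A' \<delta>' a c v "- int (Suc n)" X] unfolding succ_degree
  by (simp only: Q_def D_def)

lemma D_closed:
  assumes "\<delta> \<in> elt \<C> \<E> C A" "v \<in> elt \<C> (Q (Suc n)) X C"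
  shows "D n C A \<delta> X v \<in> elt \<C> (Q n) X A"
  using linear_map_closed[OF D_linear[OF assms(1) eltD(1)[OF assms(2)]] eltD(3)[OF assms(2)]]
    eltD[OF assms(1)] eltD[OF assms(2)]
  by (intro eltI)

lemma D_push:
  assumes a: "a \<in> arr \<C> A A'" and \<delta>: "\<delta> \<in> elt \<C> \<E> C A" and v: "v \<in> elt \<C> (Q (Suc n)) X C"
  shows "push (Q n) X a (D n C A \<delta> X v) = D n C A' (push \<E> C a \<delta>) X v"
proof -
  have "ext_morphism \<C> \<E> C A \<delta> C A' (push \<E> C a \<delta>) a (Idn \<C> C)"
    using \<delta> a push_closed[OF a \<delta>] by (simp add: ext_morphism_def pull_Idn Idn_arr eltD(1)[OF \<delta>])
  from D_ext_morphism[OF this v] show ?thesis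
    by (simp add: Q.push_Idn[OF v])
qed

lemma D_pull:
  assumes c: "c \<in> arr \<C> C C'" and \<delta>: "\<delta> \<in> elt \<C> \<E> C' A" and v: "v \<in> elt \<C> (Q (Suc n)) X C"
  shows "D n C' A \<delta> X (push (Q (Suc n)) X c v) = D n C A (pull \<E> c A \<delta>) X v"
proof -
  have pd: "pull \<E> c A \<delta> \<in> elt \<C> \<E> C A" by (rule pull_closed[OF c \<delta>])
  have "ext_morphism \<C> \<E> C A (pull \<E> c A \<delta>) C' A \<delta> (Idn \<C> A) c"
    using \<delta> c pd by (simp add: ext_morphism_def push_Idn[OF pd] Idn_arr eltD(2)[OF \<delta>])
  from D_ext_morphism[OF this v] show ?thesis
    by (simp add: Q.push_Idn[OF D_closed[OF pd v]])
qed

text \<open>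
  The connecting morphisms depend linearly on the extension, although this is not among the axioms:
  the components of \<open>\<sigma> = (\<delta>, \<delta>') \<in> \<E>(C, A \<oplus> A)\<close> along the projections \<open>p\<close> and \<open>q\<close> are \<open>\<delta>\<close> and
  \<open>\<delta>'\<close>, and the component along \<open>p + q\<close> is \<open>\<delta> + \<delta>'\<close>.
\<close>

lemma D_linear_in_extension:
  assumes v: "v \<in> elt \<C> (Q (Suc n)) X C" and A: "A \<in> Ob \<C>"
  shows "linear_map R (val \<E> C A) (val (Q n) X A) (\<lambda>\<delta>. D n C A \<delta> X v)"
proof (rule linear_mapI)
  note C = eltD(2)[OF v]
  fix \<delta> assume "\<delta> \<in> carrier (val \<E> C A)"
  then have \<delta>: "\<delta> \<in> elt \<C> \<E> C A" using A C by (simp add: elt_def)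
  show "D n C A \<delta> X v \<in> carrier (val (Q n) X A)"
    by (rule eltD(3)[OF D_closed[OF \<delta> v]])
  {
    fix r assume r: "r \<in> carrier R"
    interpret H: module R "Hom \<C> A A" by (rule Hom_module[OF A A])
    have a: "r \<odot>\<^bsub>Hom \<C> A A\<^esub> Idn \<C> A \<in> arr \<C> A A"
      using r Idn_arr[OF A] by (simp add: arr_def)
    show "D n C A (r \<odot>\<^bsub>val \<E> C A\<^esub> \<delta>) X v = r \<odot>\<^bsub>val (Q n) X A\<^esub> D n C A \<delta> X v"
      using D_push[OF a \<delta> v] push_smult[OF r Idn_arr[OF A] \<delta>]
        Q.push_smult[OF r Idn_arr[OF A] D_closed[OF \<delta> v]]
      by (simp add: push_Idn[OF \<delta>] Q.push_Idn[OF D_closed[OF \<delta> v]])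
  }
  fix \<delta>' assume "\<delta>' \<in> carrier (val \<E> C A)"
  then have \<delta>': "\<delta>' \<in> elt \<C> \<E> C A" using A C by (simp add: elt_def)
  obtain S i j p q where "biproduct \<C> A A S i j p q"
    using has_biproducts[OF A A] by blast
  then have i: "i \<in> arr \<C> A S" and j: "j \<in> arr \<C> A S" and p: "p \<in> arr \<C> S A" and q: "q \<in> arr \<C> S A"
    and eqs: "p \<cdot> i = Idn \<C> A" "q \<cdot> j = Idn \<C> A" "p \<cdot> j = \<zero>\<^bsub>Hom \<C> A A\<^esub>" "q \<cdot> i = \<zero>\<^bsub>Hom \<C> A A\<^esub>"
    by (simp_all add: biproduct_def)
  interpret E: module R "val \<E> C A" by (rule val_module[OF C A])
  interpret H: module R "Hom \<C> S A" by (rule Hom_module[OF arrD(1,2)[OF p]])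
  have pq: "p \<oplus>\<^bsub>Hom \<C> S A\<^esub> q \<in> arr \<C> S A"
    using p q by (simp add: arr_def)
  define \<sigma> where "\<sigma> = push \<E> C i \<delta> \<oplus>\<^bsub>val \<E> C S\<^esub> push \<E> C j \<delta>'"
  have \<sigma>: "\<sigma> \<in> elt \<C> \<E> C S"
    unfolding \<sigma>_def by (intro add_closed push_closed[OF i \<delta>] push_closed[OF j \<delta>'])
  have zero: "push \<E> C \<zero>\<^bsub>Hom \<C> A A\<^esub> \<epsilon> = \<zero>\<^bsub>val \<E> C A\<^esub>" if "\<epsilon> \<in> elt \<C> \<E> C A" for \<epsilon>
    by (rule linear_map_zero[OF push_by_linear[OF that A] Hom_module[OF A A] val_module[OF C A]])
  have p\<sigma>: "push \<E> C p \<sigma> = \<delta>"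
    unfolding \<sigma>_def push_sum[OF p push_closed[OF i \<delta>] push_closed[OF j \<delta>']]
      push_cmp[OF i p \<delta>, symmetric] push_cmp[OF j p \<delta>', symmetric] eqs push_Idn[OF \<delta>] zero[OF \<delta>']
    using eltD(3)[OF \<delta>] by simp
  have q\<sigma>: "push \<E> C q \<sigma> = \<delta>'"
    unfolding \<sigma>_def push_sum[OF q push_closed[OF i \<delta>] push_closed[OF j \<delta>']]
      push_cmp[OF i q \<delta>, symmetric] push_cmp[OF j q \<delta>', symmetric] eqs push_Idn[OF \<delta>'] zero[OF \<delta>]
    using eltD(3)[OF \<delta>'] by simp
  show "D n C A (\<delta> \<oplus>\<^bsub>val \<E> C A\<^esub> \<delta>') X v = D n C A \<delta> X v \<oplus>\<^bsub>val (Q n) X A\<^esub> D n C A \<delta>' X v"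
    using D_push[OF pq \<sigma> v] Q.push_add[OF p q D_closed[OF \<sigma> v]]
    by (simp add: D_push[OF p \<sigma> v] D_push[OF q \<sigma> v] p\<sigma> q\<sigma> push_add[OF p q \<sigma>])
qed

text \<open>In degree zero, \<open>F\<^sup>0(X, Y)\<close> is \<open>\<C>(X, Y)\<close> up to the embeddings \<open>Inl\<close> and \<open>HomEl\<close>.\<close>

definition "as_arr v = hom_of (projl v)"

lemma same_nonneg: "same_functor R \<C> (F (int k)) (transport Inl (P k))"
  using canonical by (simp add: canonical_nonneg_def)

lemma d_nonneg:
  "\<delta> \<in> elt \<C> \<E> C A \<Longrightarrow> \<tau> \<in> elt \<C> (P k) X C \<Longrightarrow> d (int k) C A \<delta> X (Inl \<tau>) = Inl (low k C A \<delta> X \<tau>)"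
  using canonical by (simp add: canonical_nonneg_def)

lemma elt_nonneg: "v \<in> elt \<C> (F (int k)) X Y \<longleftrightarrow> (\<exists>u\<in>elt \<C> (P k) X Y. v = Inl u)"
  using same_nonneg[of k] by (auto simp: same_functor_def same_module_def elt_def)

lemma pull_nonneg:
  "f \<in> arr \<C> X' X \<Longrightarrow> u \<in> elt \<C> (P k) X Y \<Longrightarrow> pull (F (int k)) f Y (Inl u) = Inl (pull (P k) f Y u)"
  using same_nonneg[of k] elt_nonneg[of "Inl u" k X Y] by (simp add: same_functor_def)

lemma push_nonneg:
  "g \<in> arr \<C> Y Y' \<Longrightarrow> u \<in> elt \<C> (P k) X Y \<Longrightarrow> push (F (int k)) X g (Inl u) = Inl (push (P k) X g u)"
  using same_nonneg[of k] elt_nonneg[of "Inl u" k X Y] by (simp add: same_functor_def)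

lemma projl_linear:
  assumes "X \<in> Ob \<C>" "Y \<in> Ob \<C>"
  shows "linear_map R (val (F (int k)) X Y) (val (P k) X Y) projl"
proof (rule linear_mapI)
  have same: "same_module R (val (F (int k)) X Y) (transport_module Inl (val (P k) X Y))"
    using same_nonneg[of k] assms by (simp add: same_functor_def)
  fix u assume "u \<in> carrier (val (F (int k)) X Y)"
  then obtain u' where u: "u' \<in> carrier (val (P k) X Y)" "u = Inl u'"
    using same by (auto simp: same_module_def)
  then show "projl u \<in> carrier (val (P k) X Y)" by simp
  show "projl (r \<odot>\<^bsub>val (F (int k)) X Y\<^esub> u) = r \<odot>\<^bsub>val (P k) X Y\<^esub> projl u" if "r \<in> carrier R" for r
    using same u that by (auto simp: same_module_def)
  fix v assume "v \<in> carrier (val (F (int k)) X Y)"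
  then obtain v' where v: "v' \<in> carrier (val (P k) X Y)" "v = Inl v'"
    using same by (auto simp: same_module_def)
  show "projl (u \<oplus>\<^bsub>val (F (int k)) X Y\<^esub> v) = projl u \<oplus>\<^bsub>val (P k) X Y\<^esub> projl v"
    using same u v by (auto simp: same_module_def)
qed

lemma Q_0: "Q 0 = F (int 0)"
  by (simp add: Q_def)

lemma elt_Q0: "v \<in> elt \<C> (Q 0) X Y \<longleftrightarrow> (\<exists>h\<in>arr \<C> X Y. v = Inl (HomEl h))"
  unfolding Q_0 elt_nonneg by (auto simp: elt_P0)

lemma as_arr_closed: "v \<in> elt \<C> (Q 0) X Y \<Longrightarrow> as_arr v \<in> arr \<C> X Y"
  by (auto simp: elt_Q0 as_arr_def)

lemma as_arr_linear:
  assumes "X \<in> Ob \<C>" "Y \<in> Ob \<C>"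
  shows "linear_map R (val (Q 0) X Y) (Hom \<C> X Y) as_arr"
proof -
  have "linear_map R (Hom \<C> X Y) (Hom \<C> X Y) (\<lambda>u. u)" by (rule linear_mapI) simp_all
  then have "linear_map R (val (P 0) X Y) (Hom \<C> X Y) hom_of"
    by (simp add: val_P0 linear_map_from_transport)
  from linear_map_compose[OF projl_linear[OF assms, of 0] this] show ?thesis
    by (simp add: Q_0 as_arr_def[abs_def])
qed

lemma as_arr_pull:
  assumes f: "f \<in> arr \<C> X' X" and v: "v \<in> elt \<C> (Q 0) X Y"
  shows "as_arr (pull (Q 0) f Y v) = as_arr v \<cdot> f"
proof -
  obtain h where h: "HomEl h \<in> elt \<C> (P 0) X Y" "v = Inl (HomEl h)"
    using v by (auto simp: elt_Q0 elt_P0)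
  show ?thesis
    unfolding Q_0 h(2) pull_nonneg[OF f h(1)] by (simp add: as_arr_def pull_P0)
qed

lemma as_arr_push:
  assumes g: "g \<in> arr \<C> Y Y'" and v: "v \<in> elt \<C> (Q 0) X Y"
  shows "as_arr (push (Q 0) X g v) = g \<cdot> as_arr v"
proof -
  obtain h where h: "HomEl h \<in> elt \<C> (P 0) X Y" "v = Inl (HomEl h)"
    using v by (auto simp: elt_Q0 elt_P0)
  show ?thesis
    unfolding Q_0 h(2) push_nonneg[OF g h(1)] by (simp add: as_arr_def push_P0)
qed

text \<open>
  The curried form of natural transformations from \<open>F\<^sup>-\<^sup>n\<close> to \<open>\<E>\<^sub>I\<^sup>-\<^sup>n\<close>: the value of \<open>b X A Y\<close> at
  \<open>u \<in> \<E>\<^sup>n(A, Y)\<close> and \<open>v \<in> F\<^sup>-\<^sup>n(X, A)\<close> is a morphism from \<open>X\<close> to \<open>Y\<close>.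
\<close>

definition natural_pairing ::
    "nat \<Rightarrow> ('o \<Rightarrow> 'o \<Rightarrow> 'o \<Rightarrow> ('o, 'm, 'e) pext \<Rightarrow> ('o, 'm, 'e) pext + 'f \<Rightarrow> 'm) \<Rightarrow> bool" where
  "natural_pairing n b \<longleftrightarrow>
     (\<forall>X A Y v. v \<in> elt \<C> (Q n) X A \<longrightarrow> Y \<in> Ob \<C> \<longrightarrow>
        linear_map R (val (P n) A Y) (Hom \<C> X Y) (\<lambda>u. b X A Y u v)) \<and>
     (\<forall>X A Y u. u \<in> elt \<C> (P n) A Y \<longrightarrow> X \<in> Ob \<C> \<longrightarrow>
        linear_map R (val (Q n) X A) (Hom \<C> X Y) (b X A Y u)) \<and>
     (\<forall>g X A Y Y' u v. g \<in> arr \<C> Y Y' \<longrightarrow> u \<in> elt \<C> (P n) A Y \<longrightarrow> v \<in> elt \<C> (Q n) X A \<longrightarrow>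
        b X A Y' (push (P n) A g u) v = g \<cdot> b X A Y u v) \<and>
     (\<forall>a X A A' Y u v. a \<in> arr \<C> A A' \<longrightarrow> u \<in> elt \<C> (P n) A' Y \<longrightarrow> v \<in> elt \<C> (Q n) X A \<longrightarrow>
        b X A Y (pull (P n) a Y u) v = b X A' Y u (push (Q n) X a v)) \<and>
     (\<forall>f X X' A Y u v. f \<in> arr \<C> X' X \<longrightarrow> u \<in> elt \<C> (P n) A Y \<longrightarrow> v \<in> elt \<C> (Q n) X A \<longrightarrow>
        b X' A Y u (pull (Q n) f A v) = b X A Y u v \<cdot> f)"

lemma natural_pairingD:
  assumes "natural_pairing n b"
  shows pairing_linear_left: "v \<in> elt \<C> (Q n) X A \<Longrightarrow> Y \<in> Ob \<C> \<Longrightarrow>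
        linear_map R (val (P n) A Y) (Hom \<C> X Y) (\<lambda>u. b X A Y u v)"
    and pairing_linear_right: "u \<in> elt \<C> (P n) A Y \<Longrightarrow> X \<in> Ob \<C> \<Longrightarrow>
        linear_map R (val (Q n) X A) (Hom \<C> X Y) (b X A Y u)"
    and pairing_push: "g \<in> arr \<C> Y Y' \<Longrightarrow> u \<in> elt \<C> (P n) A Y \<Longrightarrow> v \<in> elt \<C> (Q n) X A \<Longrightarrow>
        b X A Y' (push (P n) A g u) v = g \<cdot> b X A Y u v"
    and pairing_dinatural: "a \<in> arr \<C> A A' \<Longrightarrow> u \<in> elt \<C> (P n) A' Y \<Longrightarrow> v \<in> elt \<C> (Q n) X A \<Longrightarrow>
        b X A Y (pull (P n) a Y u) v = b X A' Y u (push (Q n) X a v)"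
    and pairing_pull: "f \<in> arr \<C> X' X \<Longrightarrow> u \<in> elt \<C> (P n) A Y \<Longrightarrow> v \<in> elt \<C> (Q n) X A \<Longrightarrow>
        b X' A Y u (pull (Q n) f A v) = b X A Y u v \<cdot> f"
  using assms by (simp_all add: natural_pairing_def)

text \<open>
  The only possible continuation of a pairing to the next degree, \<open>\<langle>\<rho> \<union> \<tau>, v\<rangle> = \<langle>\<rho>, \<tau>\<^sub>\<sharp> v\<rangle>\<close>.
\<close>

definition extend_pairing ::
    "nat \<Rightarrow> ('o \<Rightarrow> 'o \<Rightarrow> 'o \<Rightarrow> ('o, 'm, 'e) pext \<Rightarrow> ('o, 'm, 'e) pext + 'f \<Rightarrow> 'm) \<Rightarrow>
     'o \<Rightarrow> 'o \<Rightarrow> 'o \<Rightarrow> ('o, 'm, 'e) pext \<Rightarrow> ('o, 'm, 'e) pext + 'f \<Rightarrow> 'm" where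
  "extend_pairing n b X A Y u v =
     ext_lift n (Hom \<C> X Y) Y (\<lambda>M \<rho> \<tau>. b X M Y \<rho> (D n A M \<tau> X v)) u"

text \<open>
  Dinaturality moves \<open>f\<close> from \<open>\<rho>\<close> across the pairing of degree \<open>n\<close> and then into the extension:
  \<open>\<langle>f\<^sup>*\<rho>, \<tau>\<^sub>\<sharp> v\<rangle> = \<langle>\<rho>, f\<^sub>*(\<tau>\<^sub>\<sharp> v)\<rangle> = \<langle>\<rho>, (f\<^sub>*\<tau>)\<^sub>\<sharp> v\<rangle>\<close>.
\<close>

lemma extend_pairing_balanced:
  assumes b: "natural_pairing n b" and v: "v \<in> elt \<C> (Q (Suc n)) X A" and Y: "Y \<in> Ob \<C>"
  shows "balanced R \<C> (P n) \<E> A Y (Hom \<C> X Y) (\<lambda>M \<rho> \<tau>. b X M Y \<rho> (D n A M \<tau> X v))"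
proof (rule balancedI)
  fix M \<tau> assume "\<tau> \<in> elt \<C> \<E> A M"
  then show "linear_map R (val (P n) M Y) (Hom \<C> X Y) (\<lambda>\<rho>. b X M Y \<rho> (D n A M \<tau> X v))"
    by (intro pairing_linear_left[OF b] D_closed v Y)
next
  fix M \<rho> assume \<rho>: "\<rho> \<in> elt \<C> (P n) M Y"
  show "linear_map R (val \<E> A M) (Hom \<C> X Y) (\<lambda>\<tau>. b X M Y \<rho> (D n A M \<tau> X v))"
    by (rule linear_map_compose[OF D_linear_in_extension[OF v eltD(1)[OF \<rho>]]
          pairing_linear_right[OF b \<rho> eltD(1)[OF v]]])
next
  fix f M M' \<rho> \<tau>
  assume "f \<in> arr \<C> M M'" "\<rho> \<in> elt \<C> (P n) M' Y" "\<tau> \<in> elt \<C> \<E> A M"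
  then show "b X M Y (pull (P n) f Y \<rho>) (D n A M \<tau> X v) = b X M' Y \<rho> (D n A M' (push \<E> A f \<tau>) X v)"
    by (simp add: pairing_dinatural[OF b] D_push[OF _ _ v] D_closed[OF _ v])
qed

lemma extend_pairing_linear:
  assumes b: "natural_pairing n b" and v: "v \<in> elt \<C> (Q (Suc n)) X A" and Y: "Y \<in> Ob \<C>"
  shows "linear_map R (val (P (Suc n)) A Y) (Hom \<C> X Y) (\<lambda>u. extend_pairing n b X A Y u v)"
  unfolding extend_pairing_def
  by (rule ext_lift_linear[OF Hom_module[OF eltD(1)[OF v] Y] extend_pairing_balanced[OF b v Y] Y])

lemma extend_pairing_up:
  assumes b: "natural_pairing n b" and v: "v \<in> elt \<C> (Q (Suc n)) X A"
    and el: "\<rho> \<in> elt \<C> (P n) M Y" "\<tau> \<in> elt \<C> \<E> A M"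
  shows "extend_pairing n b X A Y (up n A M \<tau> Y \<rho>) v = b X M Y \<rho> (D n A M \<tau> X v)"
  unfolding extend_pairing_def using el
  by (intro ext_lift_up[OF Hom_module[OF eltD(1)[OF v] eltD(2)[OF el(1)]]
        extend_pairing_balanced[OF b v eltD(2)[OF el(1)]]])

text \<open>
  Both sides of each condition are linear in \<open>u \<in> \<E>\<^sup>n\<^sup>+\<^sup>1(A, Y)\<close>, so \<open>u\<close> may be taken to be a product
  \<open>\<rho> \<union> \<tau>\<close>.  There the conditions reduce to those on the given pairing and to properties of
  \<open>v \<mapsto> \<tau>\<^sub>\<sharp> v\<close>: linearity, naturality in \<open>X\<close>, and \<open>\<tau>\<^sub>\<sharp>(a\<^sub>* v) = (a\<^sup>*\<tau>)\<^sub>\<sharp> v\<close>.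
\<close>

lemma natural_pairing_extend:
  assumes b: "natural_pairing n b"
  shows "natural_pairing (Suc n) (extend_pairing n b)"
proof -
  note lin = extend_pairing_linear[OF b] and gen = extend_pairing_up[OF b]
  have 2: "linear_map R (val (Q (Suc n)) X A) (Hom \<C> X Y) (extend_pairing n b X A Y u)"
    if u: "u \<in> elt \<C> (P (Suc n)) A Y" and X: "X \<in> Ob \<C>" for X A Y u
  proof (rule linear_mapI)
    note A = eltD(1)[OF u] and Y = eltD(2)[OF u]
    note H = Hom_module[OF X Y]
    fix v assume "v \<in> carrier (val (Q (Suc n)) X A)"
    then have v: "v \<in> elt \<C> (Q (Suc n)) X A" using X A by (simp add: elt_def)
    show "extend_pairing n b X A Y u v \<in> carrier (Hom \<C> X Y)"
      by (rule linear_map_closed[OF lin[OF v Y] eltD(3)[OF u]])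
    {
      fix r assume r: "r \<in> carrier R"
      show "extend_pairing n b X A Y u (r \<odot>\<^bsub>val (Q (Suc n)) X A\<^esub> v) =
          r \<odot>\<^bsub>Hom \<C> X Y\<^esub> extend_pairing n b X A Y u v"
      proof (rule up_hom_ext[OF lin[OF Q.smult_closed[OF r v] Y] linear_map_scale[OF lin[OF v Y] H r] H u])
        fix M \<rho> \<tau> assume el: "\<rho> \<in> elt \<C> (P n) M Y" "\<tau> \<in> elt \<C> \<E> A M"
        show "extend_pairing n b X A Y (up n A M \<tau> Y \<rho>) (r \<odot>\<^bsub>val (Q (Suc n)) X A\<^esub> v) =
            r \<odot>\<^bsub>Hom \<C> X Y\<^esub> extend_pairing n b X A Y (up n A M \<tau> Y \<rho>) v"
          by (simp add: gen[OF _ el] v Q.smult_closed[OF r v] linear_map_smult[OF D_linear[OF el(2) X] r eltD(3)[OF v]]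
              linear_map_smult[OF pairing_linear_right[OF b el(1) X] r eltD(3)[OF D_closed[OF el(2) v]]])
      qed
    }
    fix w assume "w \<in> carrier (val (Q (Suc n)) X A)"
    then have w: "w \<in> elt \<C> (Q (Suc n)) X A" using X A by (simp add: elt_def)
    show "extend_pairing n b X A Y u (v \<oplus>\<^bsub>val (Q (Suc n)) X A\<^esub> w) =
        extend_pairing n b X A Y u v \<oplus>\<^bsub>Hom \<C> X Y\<^esub> extend_pairing n b X A Y u w"
    proof (rule up_hom_ext[OF lin[OF Q.add_closed[OF v w] Y] linear_map_sum[OF lin[OF v Y] lin[OF w Y] H] H u])
      fix M \<rho> \<tau> assume el: "\<rho> \<in> elt \<C> (P n) M Y" "\<tau> \<in> elt \<C> \<E> A M"
      show "extend_pairing n b X A Y (up n A M \<tau> Y \<rho>) (v \<oplus>\<^bsub>val (Q (Suc n)) X A\<^esub> w) =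
          extend_pairing n b X A Y (up n A M \<tau> Y \<rho>) v \<oplus>\<^bsub>Hom \<C> X Y\<^esub>
          extend_pairing n b X A Y (up n A M \<tau> Y \<rho>) w"
        by (simp add: gen[OF _ el] v w Q.add_closed[OF v w]
            linear_map_add[OF D_linear[OF el(2) X] eltD(3)[OF v] eltD(3)[OF w]]
            linear_map_add[OF pairing_linear_right[OF b el(1) X] eltD(3)[OF D_closed[OF el(2) v]]
              eltD(3)[OF D_closed[OF el(2) w]]])
    qed
  qed
  have 3: "extend_pairing n b X A Y' (push (P (Suc n)) A g u) v = g \<cdot> extend_pairing n b X A Y u v"
    if g: "g \<in> arr \<C> Y Y'" and u: "u \<in> elt \<C> (P (Suc n)) A Y" and v: "v \<in> elt \<C> (Q (Suc n)) X A"
    for g X A Y Y' u v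
  proof (rule up_hom_ext[OF linear_map_compose[OF P.push_linear[OF g eltD(1)[OF u]] lin[OF v arrD(2)[OF g]]]
        linear_map_compose[OF lin[OF v arrD(1)[OF g]] cmp_linear_right[OF g eltD(1)[OF v]]]
        Hom_module[OF eltD(1)[OF v] arrD(2)[OF g]] u])
    fix M \<rho> \<tau> assume el: "\<rho> \<in> elt \<C> (P n) M Y" "\<tau> \<in> elt \<C> \<E> A M"
    show "extend_pairing n b X A Y' (push (P (Suc n)) A g (up n A M \<tau> Y \<rho>)) v =
        g \<cdot> extend_pairing n b X A Y (up n A M \<tau> Y \<rho>) v"
      by (simp add: up_push[OF g el] gen[OF v] el P.push_closed[OF g] pairing_push[OF b g el(1)] D_closed v)
  qed
  have 4: "extend_pairing n b X A Y (pull (P (Suc n)) a Y u) v = extend_pairing n b X A' Y u (push (Q (Suc n)) X a v)"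
    if a: "a \<in> arr \<C> A A'" and u: "u \<in> elt \<C> (P (Suc n)) A' Y" and v: "v \<in> elt \<C> (Q (Suc n)) X A"
    for a X A A' Y u v
  proof (rule up_hom_ext[OF linear_map_compose[OF P.pull_linear[OF a eltD(2)[OF u]] lin[OF v eltD(2)[OF u]]]
        lin[OF Q.push_closed[OF a v] eltD(2)[OF u]] Hom_module[OF eltD(1)[OF v] eltD(2)[OF u]] u])
    fix M \<rho> \<tau> assume el: "\<rho> \<in> elt \<C> (P n) M Y" "\<tau> \<in> elt \<C> \<E> A' M"
    show "extend_pairing n b X A Y (pull (P (Suc n)) a Y (up n A' M \<tau> Y \<rho>)) v =
        extend_pairing n b X A' Y (up n A' M \<tau> Y \<rho>) (push (Q (Suc n)) X a v)"
      by (simp add: up_pull[OF a el] gen[OF v el(1) pull_closed[OF a el(2)]]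
          gen[OF Q.push_closed[OF a v] el] D_pull[OF a el(2) v])
  qed
  have 5: "extend_pairing n b X' A Y u (pull (Q (Suc n)) f A v) = extend_pairing n b X A Y u v \<cdot> f"
    if f: "f \<in> arr \<C> X' X" and u: "u \<in> elt \<C> (P (Suc n)) A Y" and v: "v \<in> elt \<C> (Q (Suc n)) X A"
    for f X X' A Y u v
  proof (rule up_hom_ext[OF lin[OF Q.pull_closed[OF f v] eltD(2)[OF u]]
        linear_map_compose[OF lin[OF v eltD(2)[OF u]] cmp_linear_left[OF f eltD(2)[OF u]]]
        Hom_module[OF arrD(1)[OF f] eltD(2)[OF u]] u])
    fix M \<rho> \<tau> assume el: "\<rho> \<in> elt \<C> (P n) M Y" "\<tau> \<in> elt \<C> \<E> A M"
    show "extend_pairing n b X' A Y (up n A M \<tau> Y \<rho>) (pull (Q (Suc n)) f A v) =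
        extend_pairing n b X A Y (up n A M \<tau> Y \<rho>) v \<cdot> f"
      by (simp add: gen[OF _ el] v Q.pull_closed[OF f v] D_natural[OF el(2) f v]
          pairing_pull[OF b f el(1) D_closed[OF el(2) v]])
  qed
  show ?thesis
    by (simp add: natural_pairing_def lin 2 3 4 5)
qed

primrec act :: "nat \<Rightarrow> 'o \<Rightarrow> 'o \<Rightarrow> 'o \<Rightarrow> ('o, 'm, 'e) pext \<Rightarrow> ('o, 'm, 'e) pext + 'f \<Rightarrow> 'm" where
  "act 0 = (\<lambda>X A Y u v. hom_of u \<cdot> as_arr v)"
| "act (Suc n) = extend_pairing n (act n)"

lemma natural_pairing_act: "natural_pairing n (act n)"
proof (induction n)
  case 0
  have 1: "linear_map R (val (P 0) A Y) (Hom \<C> X Y) (\<lambda>u. hom_of u \<cdot> as_arr v)"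
    if "v \<in> elt \<C> (Q 0) X A" "Y \<in> Ob \<C>" for X A Y v
    unfolding val_P0 linear_map_from_transport[OF inj_pext(1)] pext.sel
    by (rule cmp_linear_left[OF as_arr_closed[OF that(1)] that(2)])
  have 2: "linear_map R (val (Q 0) X A) (Hom \<C> X Y) (\<lambda>v. hom_of u \<cdot> as_arr v)"
    if "u \<in> elt \<C> (P 0) A Y" "X \<in> Ob \<C>" for X A Y u
    using that
    by (auto simp: elt_P0 dest: arrD intro!: linear_map_compose[OF as_arr_linear cmp_linear_right])
  show ?case
    unfolding natural_pairing_def act.simps
    using 1 2
    by (auto simp: elt_P0 push_P0 pull_P0 as_arr_push as_arr_pull
        cmp_assoc[OF as_arr_closed] cmp_assoc[OF _ as_arr_closed])
next
  case (Suc n)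
  then show ?case by (simp add: natural_pairing_extend)
qed

lemma act_up:
  "\<lbrakk>v \<in> elt \<C> (Q (Suc n)) X A; \<rho> \<in> elt \<C> (P n) M Y; \<tau> \<in> elt \<C> \<E> A M\<rbrakk>
    \<Longrightarrow> act (Suc n) X A Y (up n A M \<tau> Y \<rho>) v = act n X M Y \<rho> (D n A M \<tau> X v)"
  by (simp add: extend_pairing_up[OF natural_pairing_act])

end


section \<open>The universal property\<close>

context canonical_sequence
begin

definition act_transpose :: "nat \<Rightarrow> 'o \<Rightarrow> 'o \<Rightarrow> ('o, 'm, 'e) pext + 'f \<Rightarrow> ('o, 'm, 'e) neg_ext" where
  "act_transpose n X A v = tabulate n A (\<lambda>Y u. act n X A Y u v)"

lemma act_transpose_apply: "u \<in> elt \<C> (P n) A Y \<Longrightarrow> act_transpose n X A v Y u = act n X A Y u v"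
  by (simp add: act_transpose_def tabulate_apply)

lemma act_transpose_closed:
  assumes v: "v \<in> elt \<C> (Q n) X A"
  shows "act_transpose n X A v \<in> elt \<C> (N n) X A"
  unfolding act_transpose_def
  using pairing_linear_left[OF natural_pairing_act v] pairing_push[OF natural_pairing_act _ _ v]
  by (intro tabulate_closed eltD[OF v]) blast+

lemma act_transpose_linear:
  assumes X: "X \<in> Ob \<C>" and A: "A \<in> Ob \<C>"
  shows "linear_map R (val (Q n) X A) (val (N n) X A) (act_transpose n X A)"
proof (rule linear_mapI)
  note right = pairing_linear_right[OF natural_pairing_act _ X]
  fix v assume vc: "v \<in> carrier (val (Q n) X A)"
  then have v: "v \<in> elt \<C> (Q n) X A" using X A by (simp add: elt_def)
  show "act_transpose n X A v \<in> carrier (val (N n) X A)"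
    by (rule eltD(3)[OF act_transpose_closed[OF v]])
  {
    fix r assume r: "r \<in> carrier R"
    show "act_transpose n X A (r \<odot>\<^bsub>val (Q n) X A\<^esub> v) = r \<odot>\<^bsub>val (N n) X A\<^esub> act_transpose n X A v"
      by (rule Eneg_eqI)
        (auto simp: Eneg_apply act_transpose_apply linear_map_smult[OF right r vc]
          intro!: act_transpose_closed Eneg_smult_closed Q.smult_closed r v)
  }
  fix w assume wc: "w \<in> carrier (val (Q n) X A)"
  then have w: "w \<in> elt \<C> (Q n) X A" using X A by (simp add: elt_def)
  show "act_transpose n X A (v \<oplus>\<^bsub>val (Q n) X A\<^esub> w) =
      act_transpose n X A v \<oplus>\<^bsub>val (N n) X A\<^esub> act_transpose n X A w"
    by (rule Eneg_eqI)
      (auto simp: Eneg_apply act_transpose_apply linear_map_add[OF right vc wc]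
        intro!: act_transpose_closed Eneg_add_closed Q.add_closed w v)
qed

lemma act_transpose_pull:
  assumes f: "f \<in> arr \<C> X' X" and v: "v \<in> elt \<C> (Q n) X A"
  shows "act_transpose n X' A (pull (Q n) f A v) = pull (N n) f A (act_transpose n X A v)"
  by (rule Eneg_eqI)
    (auto simp: Eneg_apply act_transpose_apply pairing_pull[OF natural_pairing_act f _ v]
      intro!: act_transpose_closed Eneg_pull_closed Q.pull_closed f v)

lemma act_transpose_push:
  assumes a: "a \<in> arr \<C> A A'" and v: "v \<in> elt \<C> (Q n) X A"
  shows "act_transpose n X A' (push (Q n) X a v) = push (N n) X a (act_transpose n X A v)"
  by (rule Eneg_eqI)
    (auto simp: Eneg_apply(5)[OF _ a] act_transpose_apply P.pull_closed[OF a]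
      pairing_dinatural[OF natural_pairing_act a _ v]
      intro!: act_transpose_closed Eneg_push_closed Q.push_closed a v)

lemma act_transpose_D:
  assumes \<delta>: "\<delta> \<in> elt \<C> \<E> C A" and v: "v \<in> elt \<C> (Q (Suc n)) X C"
  shows "act_transpose n X A (D n C A \<delta> X v) =
    precomp_sharp R \<C> \<E> n C A \<delta> (act_transpose (Suc n) X C v)"
  by (rule Eneg_eqI)
    (auto simp del: act.simps simp: Eneg_apply act_transpose_apply up_closed[OF _ \<delta>] act_up[OF v _ \<delta>]
      intro!: act_transpose_closed precomp_closed D_closed \<delta> v)

lemma act_transpose_D_0:
  assumes \<delta>: "\<delta> \<in> elt \<C> \<E> C A" and v: "v \<in> elt \<C> (Q (Suc 0)) X C"
  shows "Inl (HomEl (act_transpose (Suc 0) X C v A (ExtEl \<delta>))) = D 0 C A \<delta> X v"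
proof -
  obtain h where h: "h \<in> arr \<C> X A" "D 0 C A \<delta> X v = Inl (HomEl h)"
    using D_closed[OF \<delta> v] by (auto simp: elt_Q0)
  have "act (Suc 0) X C A (ExtEl \<delta>) v = h"
    using act_up[OF v HomEl_Idn[OF eltD(2)[OF \<delta>]] \<delta>] h
    by (simp del: act.simps(2) add: up_0_Idn[OF \<delta>] as_arr_def cmp_Idn_left)
  with h show ?thesis
    by (simp del: act.simps add: act_transpose_apply[OF ExtEl_elt[OF \<delta>]])
qed

text \<open>
  Outside the objects and the elements the values are \<open>undefined\<close>, as transformations are required to
  be extensional.
\<close>

definition universal_map :: "int \<Rightarrow> 'o \<Rightarrow> 'o \<Rightarrow> ('o, 'm, 'e) pext + 'f \<Rightarrow>
    ('o, 'm, 'e) pext + ('o, 'm, 'e) neg_ext" where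
  "universal_map n X Y =
     (if X \<in> Ob \<C> \<and> Y \<in> Ob \<C>
      then \<lambda>v\<in>carrier (val (F n) X Y).
        if n \<ge> 0 then Inl (projl v) else Inr (act_transpose (nat (- n)) X Y v)
      else undefined)"

lemma universal_map_apply:
  "u \<in> elt \<C> (P k) X Y \<Longrightarrow> universal_map (int k) X Y (Inl u) = Inl u"
  "v \<in> elt \<C> (Q (Suc k)) X Y \<Longrightarrow>
    universal_map (- int (Suc k)) X Y v = Inr (act_transpose (Suc k) X Y v)"
proof -
  assume "u \<in> elt \<C> (P k) X Y"
  then have "Inl u \<in> elt \<C> (F (int k)) X Y" unfolding elt_nonneg by blast
  then show "universal_map (int k) X Y (Inl u) = Inl u"
    by (simp add: universal_map_def elt_def)
next
  assume "v \<in> elt \<C> (Q (Suc k)) X Y"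
  then have "v \<in> elt \<C> (F (- int (Suc k))) X Y" unfolding Q_def .
  moreover have "\<not> - int (Suc k) \<ge> 0" "nat (- (- int (Suc k))) = Suc k" by simp_all
  ultimately show "universal_map (- int (Suc k)) X Y v = Inr (act_transpose (Suc k) X Y v)"
    unfolding universal_map_def elt_def by (simp only: if_False restrict_apply mem_Collect_eq if_True simp_thms)
qed

lemma int_sign_cases:
  obtains k where "n = int k" | k where "n = - int (Suc k)"
  by (metis int_cases)

lemma universal_map_nat_transformation: "nat_transformation R \<C> (F n) (I n) (universal_map n)"
  unfolding nat_transformation_def
proof (intro conjI ballI allI impI)
  fix X Y assume X: "X \<in> Ob \<C>" and Y: "Y \<in> Ob \<C>"
  show "universal_map n X Y \<in> extensional (carrier (val (F n) X Y))"
    using X Y by (simp add: universal_map_def)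
  show "linear_map R (val (F n) X Y) (val (I n) X Y) (universal_map n X Y)"
  proof (cases n rule: int_sign_cases)
    case (1 k)
    have "linear_map R (val (F n) X Y) (val (I n) X Y) (\<lambda>v. Inl (projl v))"
      unfolding 1 EI_cases transport_simps
      by (rule linear_map_compose[OF projl_linear[OF X Y] linear_map_transport[OF inj_Inl]])
    then show ?thesis
      by (rule linear_map_cong[OF _ bilinear_functor.val_module[OF functors X Y]])
        (simp add: universal_map_def 1 X Y)
  next
    case (2 k)
    have "linear_map R (val (Q (Suc k)) X Y) (val (I n) X Y) (\<lambda>v. Inr (act_transpose (Suc k) X Y v))"
      unfolding 2 EI_cases transport_simps
      by (rule linear_map_compose[OF act_transpose_linear[OF X Y] linear_map_transport[OF inj_Inr]])
    then have "linear_map R (val (Q (Suc k)) X Y) (val (I n) X Y) (universal_map n X Y)"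
      by (rule linear_map_cong[OF _ Q.val_module[OF X Y]])
        (unfold 2, rule universal_map_apply(2), rule eltI[OF X Y])
    then show ?thesis by (simp only: Q_def 2)
  qed
next
  fix X Y assume "\<not> (X \<in> Ob \<C> \<and> Y \<in> Ob \<C>)"
  then show "universal_map n X Y = undefined"
    by (simp only: universal_map_def if_False)
next
  fix X' X Y f v assume f: "f \<in> arr \<C> X' X" and v: "v \<in> elt \<C> (F n) X Y"
  show "universal_map n X' Y (pull (F n) f Y v) = pull (I n) f Y (universal_map n X Y v)"
  proof (cases n rule: int_sign_cases)
    case (1 k)
    from v obtain u where u: "u \<in> elt \<C> (P k) X Y" "v = Inl u" unfolding 1 elt_nonneg by blast
    show ?thesis
      unfolding 1 u(2) pull_nonneg[OF f u(1)] universal_map_apply(1)[OF u(1)]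
        universal_map_apply(1)[OF P.pull_closed[OF f u(1)]] EI_cases by simp
  next
    case (2 k)
    from v have u: "v \<in> elt \<C> (Q (Suc k)) X Y" unfolding 2 Q_def .
    show ?thesis
      using act_transpose_pull[OF f u] universal_map_apply(2)[OF Q.pull_closed[OF f u]]
      unfolding 2 universal_map_apply(2)[OF u] EI_cases Q_def transport_simps(2)[OF inj_Inr] by simp
  qed
next
  fix X Y Y' g v assume g: "g \<in> arr \<C> Y Y'" and v: "v \<in> elt \<C> (F n) X Y"
  show "universal_map n X Y' (push (F n) X g v) = push (I n) X g (universal_map n X Y v)"
  proof (cases n rule: int_sign_cases)
    case (1 k)
    from v obtain u where u: "u \<in> elt \<C> (P k) X Y" "v = Inl u" unfolding 1 elt_nonneg by blast
    show ?thesis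
      unfolding 1 u(2) push_nonneg[OF g u(1)] universal_map_apply(1)[OF u(1)]
        universal_map_apply(1)[OF P.push_closed[OF g u(1)]] EI_cases by simp
  next
    case (2 k)
    from v have u: "v \<in> elt \<C> (Q (Suc k)) X Y" unfolding 2 Q_def .
    show ?thesis
      using act_transpose_push[OF g u] universal_map_apply(2)[OF Q.push_closed[OF g u]]
      unfolding 2 universal_map_apply(2)[OF u] EI_cases Q_def transport_simps(3)[OF inj_Inr] by simp
  qed
qed

lemma universal_map_connecting:
  assumes \<delta>: "\<delta> \<in> elt \<C> \<E> C A" and v: "v \<in> elt \<C> (F n) X C"
  shows "universal_map (n + 1) X A (d n C A \<delta> X v) = I_sharp n C A \<delta> X (universal_map n X C v)"
proof (cases n rule: int_sign_cases)
  case (1 k)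
  from v obtain u where u: "u \<in> elt \<C> (P k) X C" "v = Inl u" unfolding 1 elt_nonneg by blast
  have "int k + 1 = int (Suc k)" by simp
  then show ?thesis
    unfolding 1 u(2) d_nonneg[OF \<delta> u(1)] universal_map_apply(1)[OF u(1)] EI_sharp_cases
    using universal_map_apply(1)[OF low_closed[OF \<delta> u(1)]] by (simp only:)
next
  case (2 k)
  from v have v': "v \<in> elt \<C> (Q (Suc k)) X C" unfolding 2 Q_def .
  have Dv: "D k C A \<delta> X v \<in> elt \<C> (Q k) X A" by (rule D_closed[OF \<delta> v'])
  have "universal_map (- int k) X A (D k C A \<delta> X v) =
      I_sharp (- int (Suc k)) C A \<delta> X (Inr (act_transpose (Suc k) X C v))"
  proof (cases k)
    case 0
    have v0: "v \<in> elt \<C> (Q (Suc 0)) X C" using v' 0 by simp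
    obtain h where h: "HomEl h \<in> elt \<C> (P 0) X A" "D 0 C A \<delta> X v = Inl (HomEl h)"
      using D_closed[OF \<delta> v0] by (auto simp: elt_Q0 elt_P0)
    show ?thesis
      using act_transpose_D_0[OF \<delta> v0] universal_map_apply(1)[OF h(1)] EI_sharp_cases(2)[OF \<delta>]
      by (simp add: 0 h(2))
  next
    case (Suc j)
    show ?thesis
      using universal_map_apply(2) Dv act_transpose_D[OF \<delta> v'] unfolding Suc EI_sharp_cases by simp
  qed
  then show ?thesis
    using universal_map_apply(2)[OF v'] unfolding 2 succ_degree D_def by simp
qed

lemma sequence_morphism_universal_map:
  "sequence_morphism R \<C> \<E> F d (EI R \<C> \<E>) (EI_sharp R \<C> \<E>) universal_map"
  unfolding sequence_morphism_def
  using universal_map_nat_transformation universal_map_connecting by blast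

text \<open>
  Let \<open>\<theta>\<close> be the value at \<open>v\<close>.  Compatibility with \<open>\<tau>\<^sub>\<sharp>\<close> says that \<open>\<rho> \<mapsto> \<theta>(\<rho> \<union> \<tau>)\<close> is the value at
  \<open>\<tau>\<^sub>\<sharp> v\<close> in the degree above, which is known by induction.  At the bottom of the induction,
  it says that \<open>\<theta>(\<tau>)\<close> is the morphism \<open>\<tau>\<^sub>\<sharp> v \<in> F\<^sup>0 = \<C>\<close>, and naturality of \<open>\<theta>\<close> gives
  \<open>\<theta>(g\<^sub>*\<tau>) = g \<cdot> \<theta>(\<tau>)\<close>.
\<close>

lemma negative_components_determined:
  assumes \<psi>: "sequence_morphism R \<C> \<E> F d (EI R \<C> \<E>) (EI_sharp R \<C> \<E>) \<psi>"
    and id: "\<And>n X Y u. u \<in> elt \<C> (P n) X Y \<Longrightarrow> \<psi> (int n) X Y (Inl u) = Inl u"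
    and v: "v \<in> elt \<C> (Q (Suc k)) X A"
  shows "\<psi> (- int (Suc k)) X A v = Inr (act_transpose (Suc k) X A v)"
  using v
proof (induction k arbitrary: A v)
  have lin: "linear_map R (val (F n) X A) (val (I n) X A) (\<psi> n X A)"
    if "X \<in> Ob \<C>" "A \<in> Ob \<C>" for n X A
    using \<psi> that by (simp add: sequence_morphism_def nat_transformation_def)
  have obt: "\<exists>\<theta>\<in>elt \<C> (N (Suc k)) X A. \<psi> (- int (Suc k)) X A v = Inr \<theta>"
    if v: "v \<in> elt \<C> (Q (Suc k)) X A" for k A v
  proof -
    have "\<psi> (- int (Suc k)) X A v \<in> elt \<C> (I (- int (Suc k))) X A"
      using linear_map_closed[OF lin[OF eltD(1,2)[OF v]] eltD(3)[OF v[unfolded Q_def]]] eltD[OF v]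
      by (intro eltI)
    then show ?thesis unfolding EI_cases elt_transport by blast
  qed
  have conn: "\<psi> (- int k) X M (D k A M \<tau> X v) = I_sharp (- int (Suc k)) A M \<tau> X (\<psi> (- int (Suc k)) X A v)"
    if v: "v \<in> elt \<C> (Q (Suc k)) X A" and \<tau>: "\<tau> \<in> elt \<C> \<E> A M" for k A M v \<tau>
  proof -
    have "\<psi> (- int (Suc k) + 1) X M (d (- int (Suc k)) A M \<tau> X v) =
        I_sharp (- int (Suc k)) A M \<tau> X (\<psi> (- int (Suc k)) X A v)"
      using \<psi> \<tau> v[unfolded Q_def] unfolding sequence_morphism_def by blast
    then show ?thesis unfolding succ_degree D_def .
  qed
  have eqI: "\<psi> (- int (Suc k)) X A v = Inr (act_transpose (Suc k) X A v)"
    if v: "v \<in> elt \<C> (Q (Suc k)) X A" and \<theta>: "\<theta> \<in> elt \<C> (N (Suc k)) X A" "\<psi> (- int (Suc k)) X A v = Inr \<theta>"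
      and gen: "\<And>M \<rho> \<tau> Y. \<rho> \<in> elt \<C> (P k) M Y \<Longrightarrow> \<tau> \<in> elt \<C> \<E> A M \<Longrightarrow>
        \<theta> Y (up k A M \<tau> Y \<rho>) = act k X M Y \<rho> (D k A M \<tau> X v)" for k A v \<theta>
  proof -
    have "\<theta> = act_transpose (Suc k) X A v"
    proof (rule Eneg_eqI[OF \<theta>(1) act_transpose_closed[OF v]])
      fix Y u assume u: "u \<in> elt \<C> (P (Suc k)) A Y"
      have "\<theta> Y u = act (Suc k) X A Y u v"
        by (rule up_hom_ext[OF Eneg_linear[OF \<theta>(1) eltD(2)[OF u]]
              pairing_linear_left[OF natural_pairing_act v eltD(2)[OF u]]
              Hom_module[OF eltD(1)[OF v] eltD(2)[OF u]] u])
          (simp only: gen act_up[OF v])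
      then show "\<theta> Y u = act_transpose (Suc k) X A v Y u"
        by (simp only: act_transpose_apply[OF u])
    qed
    with \<theta>(2) show ?thesis by simp
  qed
  {
    case 0
    then have v: "v \<in> elt \<C> (Q (Suc 0)) X A" .
    from obt[OF v] obtain \<theta> where \<theta>: "\<theta> \<in> elt \<C> (N (Suc 0)) X A" "\<psi> (- int (Suc 0)) X A v = Inr \<theta>"
      by blast
    show ?case
    proof (rule eqI[OF v \<theta>])
      fix M \<rho> \<tau> Y assume "\<rho> \<in> elt \<C> (P 0) M Y" and \<tau>: "\<tau> \<in> elt \<C> \<E> A M"
      then obtain g where g: "g \<in> arr \<C> M Y" "\<rho> = HomEl g" by (auto simp: elt_P0)
      obtain h where h: "HomEl h \<in> elt \<C> (P 0) X M" "D 0 A M \<tau> X v = Inl (HomEl h)"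
        using D_closed[OF \<tau> v] by (auto simp: elt_Q0 elt_P0)
      have "\<theta> M (ExtEl \<tau>) = h"
        using conn[OF v \<tau>] id[OF h(1)] EI_sharp_cases(2)[OF \<tau>, of X \<theta>] \<theta>(2) by (simp add: h(2))
      then have "\<theta> Y (ExtEl (push \<E> A g \<tau>)) = g \<cdot> h"
        using Eneg_natural[OF \<theta>(1) g(1) ExtEl_elt[OF \<tau>]] by (simp add: push_P1)
      then show "\<theta> Y (up 0 A M \<tau> Y \<rho>) = act 0 X M Y \<rho> (D 0 A M \<tau> X v)"
        by (simp add: g(2) h(2) upper_sharp_0 as_arr_def)
    qed
  next
    case (Suc k)
    then have v: "v \<in> elt \<C> (Q (Suc (Suc k))) X A" by simp
    from obt[OF v] obtain \<theta> where
      \<theta>: "\<theta> \<in> elt \<C> (N (Suc (Suc k))) X A" "\<psi> (- int (Suc (Suc k))) X A v = Inr \<theta>"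
      by blast
    show ?case
    proof (rule eqI[OF v \<theta>])
      fix M \<rho> \<tau> Y assume \<rho>: "\<rho> \<in> elt \<C> (P (Suc k)) M Y" and \<tau>: "\<tau> \<in> elt \<C> \<E> A M"
      have "precomp_sharp R \<C> \<E> (Suc k) A M \<tau> \<theta> = act_transpose (Suc k) X M (D (Suc k) A M \<tau> X v)"
        using conn[OF v \<tau>] Suc.IH[OF D_closed[OF \<tau> v]] unfolding \<theta>(2) EI_sharp_cases by simp
      from fun_cong[OF fun_cong[OF this], of Y \<rho>]
      show "\<theta> Y (up (Suc k) A M \<tau> Y \<rho>) = act (Suc k) X M Y \<rho> (D (Suc k) A M \<tau> X v)"
        by (simp only: Eneg_apply(6)[OF \<rho>] act_transpose_apply[OF \<rho>])
    qed
  }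
qed

lemma universal_map_unique:
  assumes \<psi>: "sequence_morphism R \<C> \<E> F d (EI R \<C> \<E>) (EI_sharp R \<C> \<E>) \<psi>"
    and id: "\<And>n X Y u. u \<in> elt \<C> (P n) X Y \<Longrightarrow> \<psi> (int n) X Y (Inl u) = Inl u"
  shows "\<psi> = universal_map"
proof (intro ext)
  fix n X Y v
  have nt: "nat_transformation R \<C> (F n) (I n) (\<psi> n)"
    using \<psi> by (simp add: sequence_morphism_def)
  show "\<psi> n X Y v = universal_map n X Y v"
  proof (cases "v \<in> elt \<C> (F n) X Y")
    case True
    show ?thesis
    proof (cases n rule: int_sign_cases)
      case (1 k)
      from True obtain u where u: "u \<in> elt \<C> (P k) X Y" "v = Inl u" unfolding 1 elt_nonneg by blast
      show ?thesis
        unfolding 1 u(2) universal_map_apply(1)[OF u(1)] by (rule id[OF u(1)])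
    next
      case (2 k)
      from True have v: "v \<in> elt \<C> (Q (Suc k)) X Y" unfolding 2 Q_def .
      show ?thesis
        unfolding 2 universal_map_apply(2)[OF v] by (rule negative_components_determined[OF \<psi> id v])
    qed
  next
    case False
    then have "X \<in> Ob \<C> \<Longrightarrow> Y \<in> Ob \<C> \<Longrightarrow> v \<notin> carrier (val (F n) X Y)"
      by (simp add: elt_def)
    then show ?thesis
      using nt by (auto simp: nat_transformation_def universal_map_def extensional_def)
  qed
qed

end

theorem proposition5p18:
  fixes R :: "'r ring"
    and \<C> :: "('r, 'o, 'm) lincat"
    and \<E> :: "('r, 'o, 'm, 'e) bifun"
    and s :: "'o \<Rightarrow> 'o \<Rightarrow> 'e \<Rightarrow> ('m \<times> 'o \<times> 'm) set"
  assumes "extriangulated_category R \<C> \<E> s"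
    and "enough_projective_morphisms \<C> \<E> s"
  shows "connected_sequence R \<C> \<E> (EI R \<C> \<E>) (EI_sharp R \<C> \<E>) \<and>
    canonical_nonneg R \<C> \<E> (EI R \<C> \<E>) (EI_sharp R \<C> \<E>) \<and>
    (\<forall>(F :: int \<Rightarrow> ('r, 'o, 'm, ('o, 'm, 'e) pext + 'f) bifun) d.
       connected_sequence R \<C> \<E> F d \<and> canonical_nonneg R \<C> \<E> F d \<longrightarrow>
       (\<exists>!\<phi>. sequence_morphism R \<C> \<E> F d (EI R \<C> \<E>) (EI_sharp R \<C> \<E>) \<phi> \<and>
             (\<forall>n X Y u. u \<in> elt \<C> (Epos R \<C> \<E> n) X Y \<longrightarrow> \<phi> (int n) X Y (Inl u) = Inl u)))"
proof -
  interpret extriangulated_category R \<C> \<E> s by fact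
  interpret X: ext_bifunctor R \<C> \<E>
    by (intro ext_bifunctor.intro bilinear_functor_axioms)
  have "\<exists>!\<phi>. sequence_morphism R \<C> \<E> F d (EI R \<C> \<E>) (EI_sharp R \<C> \<E>) \<phi> \<and>
      (\<forall>n X Y u. u \<in> elt \<C> (Epos R \<C> \<E> n) X Y \<longrightarrow> \<phi> (int n) X Y (Inl u) = Inl u)"
    if F: "connected_sequence R \<C> \<E> F d" and can: "canonical_nonneg R \<C> \<E> F d"
    for F :: "int \<Rightarrow> ('r, 'o, 'm, ('o, 'm, 'e) pext + 'f) bifun" and d
  proof -
    interpret U: canonical_sequence R \<C> \<E> F d
      by (intro canonical_sequence.intro canonical_sequence_axioms.intro additive_category_axioms
          X.ext_bifunctor_axioms F can)
    show ?thesis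
      by (rule ex1I[of _ U.universal_map])
        (use U.sequence_morphism_universal_map U.universal_map_apply(1) U.universal_map_unique in blast)+
  qed
  with X.connected_sequence_EI X.canonical_nonneg_EI show ?thesis by blast
qed

end
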